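(* Let $m$ be a positive integer, let $\alpha \in [0,1]$, and let $F$ be a Borel subset of $\mathbf{R}$. Then there exists a $C^{m+\alpha}$-diffeomorphism $f : \mathbf{R} \to \mathbf{R}$ such that $$\dim_{\mathrm{F}} f(F) \geq \frac{\dim_{\mathrm{H}} F}{m+\alpha}.$$
   Context: The Fourier transform of a Borel probability measure $\mu$ on $\mathbf{R}$ is $\widehat\mu(\xi) = \int e^{-2\pi i \xi x}\,\mathrm{d}\mu(x)$. The Fourier dimension of $\mu$ is $\dim_{\mathrm{F}} \mu = \sup\{ s \in [0,1] : |\widehat\mu(\xi)|\,|\xi|^{s/2} \text{ is bounded in } \xi\}$. The Fourier dimension of a Borel set $F \subset \mathbf{R}$ is $\dim_{\mathrm{F}} F = \sup\{\dim_{\mathrm{F}} \mu : \mu \text{ a Borel probability measure on } \mathbf{R},\ \mu(F) = 1\}$ (with value $0$ if $F = \emptyset$). $\dim_{\mathrm{H}}$ denotes Hausdorff dimension (with $\dim_{\mathrm{H}}\emptyset = 0$). A $C^{m+\alpha}$-diffeomorphism $f : \mathbf{R} \to \mathbf{R}$ is a bijection such that $f$ and $f^{-1}$ are $m$ times continuously differentiable and, if $\alpha > 0$, the $m$-th derivatives of $f$ and $f^{-1}$ are Hölder continuous with exponent $\alpha$. Here a function $g$ is Hölder continuous with exponent $\alpha$ if there is a constant $K$ with $|g(y)-g(x)| \leq K|y-x|^\alpha$ for all $x, y \in \mathbf{R}$. *)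

theory Defs
  imports "HOL-Probability.Probability"
begin

definition fourier_transform :: "real measure \<Rightarrow> real \<Rightarrow> complex" where
  "fourier_transform \<mu> \<xi> = (LINT x|\<mu>. exp (- 2 * pi * \<i> * \<xi> * x))"

text \<open>The transform is the library's characteristic function up to scaling.\<close>

lemma fourier_transform_eq_char: "fourier_transform \<mu> \<xi> = char \<mu> (- 2 * pi * \<xi>)"
  by (simp add: fourier_transform_def char_def algebra_simps)

definition fourier_dim_measure :: "real measure \<Rightarrow> real" where
  "fourier_dim_measure \<mu> =
     Sup {s \<in> {0..1}. bounded (range (\<lambda>\<xi>. cmod (fourier_transform \<mu> \<xi>) * \<bar>\<xi>\<bar> powr (s / 2)))}"

text \<open>For nonempty Borel \<open>F\<close> the set below contains the value at a Dirac measure, and it lies in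
  the unit interval, so the supremum is a genuine one. For empty \<open>F\<close> the set is empty and the
  value is fixed separately.\<close>

definition fourier_dim :: "real set \<Rightarrow> real" where
  "fourier_dim F =
     (if F = {} then 0
      else Sup {fourier_dim_measure \<mu> | \<mu>. prob_space \<mu> \<and> sets \<mu> = sets borel \<and> measure \<mu> F = 1})"

lemma fourier_dim_measure_range:
  assumes "prob_space \<mu>" "sets \<mu> = sets borel"
  shows "fourier_dim_measure \<mu> \<in> {0..1}"
proof -
  interpret prob_space \<mu> by fact
  let ?S = "{s \<in> {0..1::real}. bounded (range (\<lambda>\<xi>. cmod (fourier_transform \<mu> \<xi>) * \<bar>\<xi>\<bar> powr (s / 2)))}"
  have le: "cmod (fourier_transform \<mu> \<xi>) \<le> 1" for \<xi>
  proof -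
    have "real_distribution \<mu>"
      using assms by unfold_locales (auto dest: sets_eq_imp_space_eq)
    then show ?thesis
      unfolding fourier_transform_eq_char by (rule real_distribution.cmod_char_le_1)
  qed
  have "cmod (fourier_transform \<mu> \<xi>) * \<bar>\<xi>\<bar> powr (0 / 2) \<le> 1" for \<xi>
    using le[of \<xi>] by (cases "\<xi> = 0") auto
  then have "bounded (range (\<lambda>\<xi>. cmod (fourier_transform \<mu> \<xi>) * \<bar>\<xi>\<bar> powr (0 / 2)))"
    by (intro boundedI[where B = 1]) auto
  then have mem: "0 \<in> ?S" by (intro CollectI conjI) (simp, assumption)
  have bdd: "bdd_above ?S" by (rule bdd_aboveI[of _ 1]) auto
  have "0 \<le> Sup ?S" using mem bdd by (rule cSup_upper)
  moreover have "Sup ?S \<le> 1"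
  proof (rule cSup_least)
    show "?S \<noteq> {}" using mem by blast
  qed simp
  ultimately show ?thesis by (simp add: fourier_dim_measure_def)
qed

text \<open>The cases distinguish the empty set and \<open>s = 0\<close> because \<open>0 powr 0 = 0\<close>; with them the
  zero-dimensional Hausdorff measure is the counting measure.\<close>

definition diam_power :: "real \<Rightarrow> 'a::metric_space set \<Rightarrow> real" where
  "diam_power s U = (if U = {} then 0 else if s = 0 then 1 else diameter U powr s)"

text \<open>Boundedness of the covering sets is required because \<open>diameter\<close> is unspecified on
  unbounded sets.\<close>

definition hausdorff_premeasure :: "real \<Rightarrow> real \<Rightarrow> 'a::metric_space set \<Rightarrow> ennreal" where
  "hausdorff_premeasure s \<delta> F =
     Inf {(\<Sum>i. ennreal (diam_power s (U i))) | U :: nat \<Rightarrow> 'a set.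
            F \<subseteq> (\<Union>i. U i) \<and> (\<forall>i. bounded (U i) \<and> diameter (U i) \<le> \<delta>)}"

definition hausdorff_measure :: "real \<Rightarrow> 'a::metric_space set \<Rightarrow> ennreal" where
  "hausdorff_measure s F = (SUP \<delta>\<in>{0<..}. hausdorff_premeasure s \<delta> F)"

text \<open>Restricted to subsets of the line, where every exponent above 1 belongs to the set, so the
  infimum is a real number.\<close>

definition hausdorff_dim :: "real set \<Rightarrow> real" where
  "hausdorff_dim F = Inf {s. 0 \<le> s \<and> hausdorff_measure s F = 0}"

lemma hausdorff_dim_empty: "hausdorff_dim {} = 0"
proof -
  have "hausdorff_premeasure s \<delta> ({} :: real set) = 0" if "\<delta> > 0" for s \<delta>
  proof -
    have "0 \<in> {(\<Sum>i. ennreal (diam_power s (U i))) | U :: nat \<Rightarrow> real set.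
            {} \<subseteq> (\<Union>i. U i) \<and> (\<forall>i. bounded (U i) \<and> diameter (U i) \<le> \<delta>)}"
      using that by (intro CollectI exI[of _ "\<lambda>_. {}"]) (auto simp: diam_power_def)
    then show ?thesis
      unfolding hausdorff_premeasure_def by (metis (no_types, lifting) Inf_lower le_zero_eq)
  qed
  then have "hausdorff_measure s ({} :: real set) = 0" for s
    by (auto simp: hausdorff_measure_def intro!: SUP_eq_const)
  then show ?thesis
    unfolding hausdorff_dim_def by (auto intro!: cInf_eq_minimum)
qed

definition times_cont_differentiable :: "nat \<Rightarrow> (real \<Rightarrow> real) \<Rightarrow> bool" where
  "times_cont_differentiable m f \<longleftrightarrow>
     (\<forall>k<m. (deriv ^^ k) f differentiable_on UNIV) \<and> continuous_on UNIV ((deriv ^^ m) f)"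

definition holder_continuous :: "real \<Rightarrow> (real \<Rightarrow> real) \<Rightarrow> bool" where
  "holder_continuous \<alpha> g \<longleftrightarrow> (\<exists>K. \<forall>x y. \<bar>g y - g x\<bar> \<le> K * \<bar>y - x\<bar> powr \<alpha>)"

definition diffeomorphism :: "nat \<Rightarrow> real \<Rightarrow> (real \<Rightarrow> real) \<Rightarrow> bool" where
  "diffeomorphism m \<alpha> f \<longleftrightarrow>
     bij f \<and> times_cont_differentiable m f \<and> times_cont_differentiable m (inv f) \<and>
     (\<alpha> > 0 \<longrightarrow> holder_continuous \<alpha> ((deriv ^^ m) f) \<and> holder_continuous \<alpha> ((deriv ^^ m) (inv f)))"

end

theory Submission
  imports Defs "HOL-Real_Asymp.Real_Asymp"
begin

text \<open>
  Perturb the identity at every dyadic scale \<open>2\<^sup>-\<^sup>j\<close> by independent random bumps of height roughly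
  \<open>2\<^sup>-\<^sup>j\<^sup>\<beta>\<close>, where \<open>\<beta> = m + \<alpha>\<close>; this is the largest size for which the resulting map is still a
  \<open>C\<^sup>m\<^sup>+\<^sup>\<alpha>\<close>-diffeomorphism. Let \<open>\<mu>\<close> be a Frostman measure on \<open>F\<close> with exponent \<open>s < dim\<^sub>H F\<close>. At frequency \<open>\<xi>\<close>
  use the scale \<open>2\<^sup>-\<^sup>j\<close> slightly above \<open>|\<xi>|\<^bsup>-1/\<beta>\<^esup>\<close>: the bumps there randomise the phases of the cells of
  length \<open>2\<^sup>-\<^sup>j\<close> independently, and each cell has mass at most a constant times \<open>2\<^sup>-\<^sup>s\<^sup>j\<close>. Hoeffding's
  inequality, conditionally on all other scales, bounds the Fourier transform of the image measure by
  about \<open>2\<^bsup>-sj/2\<^esup>\<close>, i.e. \<open>|\<xi>|\<^bsup>-s/(2\<beta>)\<^esup>\<close>, up to an arbitrarily small loss in the exponent, outside an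
  event whose probability is summable over the frequencies \<open>\<xi> = \<surd>n\<close>. By Borel and Cantelli one
  realisation works for a sequence of exponents \<open>s\<close> increasing to \<open>dim\<^sub>H F\<close>.

  Frostman's lemma for Borel sets is obtained from dyadic contents. These are continuous along increasing
  sequences, so a capacitability argument on a Suslin representation reduces to closed sets.
\<close>

subsection \<open>Dyadic content\<close>

text \<open>The measure \<mu> only has upper bounds on its cells, so all cancellation has to come
  from f. At frequency \<xi> the scale 2^-j must meet two demands. The phase shifts, of order
  |\<xi>| 2^(-j \<beta>), have to be large, so that each cell contributes a small mean; and the cell
  masses 2^(-s j) have to lie below the square |\<xi>|^(-t) of the wanted bound, so that Hoeffding's
  bound is smaller than every power. With 2^j = |\<xi>|^\<tau> this means \<tau> < 1/\<beta> and t <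
  s \<tau>, which is possible exactly when t < s/\<beta>. The gap between the exponents pays for all
  polynomial factors in j.

  The frequencies sqrt n suffice because the measures have bounded support: their transforms are
  Lipschitz, and the gap near \<xi> is of order 1/|\<xi>|, which is below |\<xi>|^(-t/2).\<close>

lemma ennreal_less_add_pos:
  assumes "x < (\<top>::ennreal)" "0 < e"
  shows "x < x + ennreal e"
proof -
  obtain r where r: "0 \<le> r" "x = ennreal r" using assms(1) by (cases x) auto
  show ?thesis using assms(2) r by (simp add: ennreal_lessI flip: ennreal_plus)
qed

definition cell :: "nat \<Rightarrow> int \<Rightarrow> real set" where
  "cell n k = {x. \<lfloor>2 ^ n * x\<rfloor> = k}"

text \<open>Pairs of a level and an index form a countable type, so every set \<open>G\<close> of
  them is a countable cover.\<close>

definition cells :: "(nat \<times> int) set \<Rightarrow> real set" where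
  "cells G = {x. \<exists>n. (n, \<lfloor>2 ^ n * x\<rfloor>) \<in> G}"

text \<open>With the cost of a cover stored as a measure on the set of cells, additivity over
  disjoint families of cells and countable subadditivity are facts of measure theory.\<close>

definition weight_measure :: "real \<Rightarrow> (nat \<times> int) measure" where
  "weight_measure s = density (count_space UNIV) (\<lambda>d. ennreal (2 powr (- s * real (fst d))))"

abbreviation cost :: "real \<Rightarrow> (nat \<times> int) set \<Rightarrow> ennreal" where
  "cost s \<equiv> emeasure (weight_measure s)"

definition dyadic_content :: "real \<Rightarrow> real set \<Rightarrow> ennreal" where
  "dyadic_content s E = Inf (cost s ` {G. E \<subseteq> cells G})"

lemma sets_weight_measure [simp, measurable]: "A \<in> sets (weight_measure s)"
  by (simp add: weight_measure_def)

lemma cost_singleton: "cost s {(n, k)} = ennreal (2 powr (- s * real n))"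
  by (simp add: weight_measure_def emeasure_density nn_integral_count_space_indicator[symmetric]
      nn_integral_count_space_finite)

lemma cells_UN: "cells (\<Union>i\<in>I. G i) = (\<Union>i\<in>I. cells (G i))"
  by (auto simp: cells_def)

lemma cells_singleton: "cells {(n, k)} = cell n k"
  by (auto simp: cells_def cell_def)

lemma content_le: "E \<subseteq> cells G \<Longrightarrow> dyadic_content s E \<le> cost s G"
  unfolding dyadic_content_def by (intro Inf_lower) auto

lemma content_mono: "E \<subseteq> E' \<Longrightarrow> dyadic_content s E \<le> dyadic_content s E'"
  unfolding dyadic_content_def by (intro Inf_superset_mono) auto

lemma content_cell_le: "dyadic_content s (cell n k) \<le> ennreal (2 powr (- s * real n))"
  using content_le[of "cell n k" "{(n, k)}" s] by (simp add: cells_singleton cost_singleton)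

lemma content_approx:
  assumes "dyadic_content s E < c"
  obtains G where "E \<subseteq> cells G" "cost s G < c"
  using assms unfolding dyadic_content_def by (auto simp: Inf_less_iff)

lemma content_countable_subadditive:
  "dyadic_content s (\<Union>i. E i) \<le> (\<Sum>i::nat. dyadic_content s (E i))"
proof (rule ennreal_le_epsilon)
  fix e :: real assume fin: "(\<Sum>i. dyadic_content s (E i)) < \<top>" and e: "0 < e"
  have "\<exists>G. E i \<subseteq> cells G \<and> cost s G \<le> dyadic_content s (E i) + ennreal (e * (1/2)^Suc i)" for i
  proof -
    have "dyadic_content s (E i) < \<top>"
      using fin ennreal_suminf_lessD by blast
    then have "dyadic_content s (E i) < dyadic_content s (E i) + ennreal (e * (1/2)^Suc i)"
      using e by (intro ennreal_less_add_pos) auto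
    then show ?thesis by (meson content_approx less_imp_le)
  qed
  then obtain G where G: "\<And>i. E i \<subseteq> cells (G i)"
      "\<And>i. cost s (G i) \<le> dyadic_content s (E i) + ennreal (e * (1/2)^Suc i)"
    by metis
  have "dyadic_content s (\<Union>i. E i) \<le> cost s (\<Union>i. G i)"
    using G(1) by (intro content_le) (auto simp: cells_UN)
  also have "\<dots> \<le> (\<Sum>i. cost s (G i))"
    by (intro emeasure_subadditive_countably) auto
  also have "\<dots> \<le> (\<Sum>i. dyadic_content s (E i) + ennreal (e * (1/2)^Suc i))"
    by (intro suminf_le G) auto
  also have "\<dots> = (\<Sum>i. dyadic_content s (E i)) + (\<Sum>i. ennreal (e * (1/2)^Suc i))"
    by (intro suminf_add[symmetric]) auto
  also have "(\<Sum>i. ennreal (e * (1/2)^Suc i)) = ennreal e"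
  proof (rule suminf_ennreal_eq)
    show "(\<lambda>i. e * (1/2)^Suc i) sums e"
      using sums_mult[OF power_half_series, of e] by simp
  qed (use e in auto)
  finally show "dyadic_content s (\<Union>i. E i) \<le> (\<Sum>i. dyadic_content s (E i)) + ennreal e" .
qed

lemma content_empty [simp]: "dyadic_content s {} = 0"
  using content_le[of "{}" "{}" s] by simp

lemma content_subadditive: "dyadic_content s (A \<union> B) \<le> dyadic_content s A + dyadic_content s B"
proof -
  have "(\<Union>i. (if i = 0 then A else if i = (1::nat) then B else {})) = A \<union> B"
    by (auto split: if_splits)
  then have "dyadic_content s (A \<union> B) \<le> (\<Sum>i::nat. dyadic_content s (if i = 0 then A else if i = 1 then B else {}))"
    by (metis content_countable_subadditive)
  also have "\<dots> = (\<Sum>i<2::nat. dyadic_content s (if i = 0 then A else if i = 1 then B else {}))"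
    by (intro suminf_finite) auto
  also have "\<dots> = dyadic_content s A + dyadic_content s B"
    by (simp add: numeral_2_eq_2)
  finally show ?thesis .
qed

lemma floor_scale_div:
  assumes "n \<le> n'"
  shows "\<lfloor>2 ^ n * x :: real\<rfloor> = \<lfloor>2 ^ n' * x\<rfloor> div 2 ^ (n' - n)"
proof -
  have "(2::real) ^ n' = 2 ^ (n' - n) * 2 ^ n"
    using assms by (simp flip: power_add)
  then have "2 ^ n * x = (2 ^ n' * x) / real_of_int (2 ^ (n' - n))"
    by simp
  then show ?thesis
    by (metis floor_divide_real_eq_div zero_le_numeral zero_le_power)
qed

lemma cell_nonempty: "cell n k \<noteq> {}"
proof -
  have "real_of_int k / 2 ^ n \<in> cell n k" by (simp add: cell_def)
  then show ?thesis by blast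
qed

lemma cell_nested:
  assumes "n \<le> n'" "x \<in> cell n k" "x \<in> cell n' k'"
  shows "cell n' k' \<subseteq> cell n k"
  using assms floor_scale_div[OF assms(1)] by (auto simp: cell_def)

text \<open>Cover each \<open>E n\<close> almost optimally and keep only the maximal cells of the union of all covers. Those
  coming from the \<open>j\<close>-th cover cannot be replaced cheaply by cells of a later cover, as this would improve
  the \<open>j\<close>-th cover by more than its error. Hence the maximal cells cost little more than a late cover.\<close>

lemma content_incseq:
  assumes E: "incseq E" and le: "\<And>n::nat. dyadic_content s (E n) \<le> c"
  shows "dyadic_content s (\<Union>n. E n) \<le> c"
proof (rule ennreal_le_epsilon)
  fix e :: real assume c: "c < \<top>" and e: "0 < e"
  define \<epsilon> where "\<epsilon> i = e * (1/2) ^ Suc i / 2" for i :: nat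
  have \<epsilon>: "\<epsilon> i > 0" for i using e by (simp add: \<epsilon>_def)
  have fin: "dyadic_content s (E i) < \<top>" for i using le[of i] c by (rule le_less_trans)
  have "\<exists>G. E i \<subseteq> cells G \<and> cost s G \<le> dyadic_content s (E i) + ennreal (\<epsilon> i)" for i
  proof -
    have "dyadic_content s (E i) < dyadic_content s (E i) + ennreal (\<epsilon> i)"
      using fin[of i] \<epsilon>[of i] by (intro ennreal_less_add_pos) auto
    then show ?thesis by (meson content_approx less_imp_le)
  qed
  then obtain G where G: "\<And>i. E i \<subseteq> cells (G i)"
      "\<And>i. cost s (G i) \<le> dyadic_content s (E i) + ennreal (\<epsilon> i)"
    by metis
  define Q where "Q = {(n, k) \<in> (\<Union>i. G i). \<forall>x\<in>cell n k. \<forall>n'<n. (n', \<lfloor>2 ^ n' * x\<rfloor>) \<notin> (\<Union>i. G i)}"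
  have Qmax: "n \<le> n'" if "(n, k) \<in> Q" "(n', k') \<in> G i" "x \<in> cell n k" "x \<in> cell n' k'" for n k n' k' i x
  proof (rule ccontr)
    assume "\<not> n \<le> n'"
    then have "(n', \<lfloor>2 ^ n' * x\<rfloor>) \<notin> (\<Union>i. G i)" using that unfolding Q_def by auto
    then show False using that by (auto simp: cell_def)
  qed
  have cov: "(\<Union>n. E n) \<subseteq> cells Q"
  proof safe
    fix x i assume "x \<in> E i"
    then have ex: "\<exists>n. (n, \<lfloor>2 ^ n * x\<rfloor>) \<in> (\<Union>i. G i)"
      using G(1)[of i] by (fastforce simp: cells_def)
    define n where "n = (LEAST n. (n, \<lfloor>2 ^ n * x\<rfloor>) \<in> (\<Union>i. G i))"
    have n: "(n, \<lfloor>2 ^ n * x\<rfloor>) \<in> (\<Union>i. G i)"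
      unfolding n_def by (rule LeastI_ex[OF ex])
    have "(n', \<lfloor>2 ^ n' * y\<rfloor>) \<notin> (\<Union>i. G i)" if "y \<in> cell n \<lfloor>2 ^ n * x\<rfloor>" "n' < n" for y n'
    proof -
      have "\<lfloor>2 ^ n' * y\<rfloor> = \<lfloor>2 ^ n' * x\<rfloor>"
        using floor_scale_div[of n' n x] floor_scale_div[of n' n y] that by (simp add: cell_def)
      then show ?thesis using not_less_Least[of n' "\<lambda>n. (n, \<lfloor>2 ^ n * x\<rfloor>) \<in> (\<Union>i. G i)"] that
        by (simp add: n_def)
    qed
    then have "(n, \<lfloor>2 ^ n * x\<rfloor>) \<in> Q" using n unfolding Q_def by blast
    then show "x \<in> cells Q" by (auto simp: cells_def)
  qed
  define P where "P j = {d \<in> Q. d \<in> G j \<and> (\<forall>i<j. d \<notin> G i)}" for j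
  have P_disj: "disjoint_family P"
    unfolding disjoint_family_on_def P_def by (auto, metis linorder_neqE_nat)
  have Q_UN: "Q = (\<Union>j. P j)"
  proof safe
    fix n k assume q: "(n, k) \<in> Q"
    then have "\<exists>j. (n, k) \<in> G j" by (auto simp: Q_def)
    then have "(n, k) \<in> P (LEAST j. (n, k) \<in> G j)"
      using q by (auto simp: P_def intro: LeastI_ex dest: not_less_Least)
    then show "(n, k) \<in> (\<Union>j. P j)" by blast
  qed (auto simp: P_def)
  have costG: "cost s (G i) < \<top>" for i
    using G(2)[of i] fin[of i] by (metis ennreal_add_eq_top ennreal_neq_top infinity_ennreal_def less_top neq_top_trans)
  have partial: "(\<Sum>j<N. cost s (P j)) \<le> c + ennreal e" for N
  proof -
    \<comment> \<open>These are the cells of the late cover \<open>G N\<close> below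
      \<open>P j\<close>. As \<open>E j\<close> is contained in \<open>E N\<close>, exchanging
      \<open>P j\<close> for \<open>S j\<close> in \<open>G j\<close> still covers
      \<open>E j\<close>, so near-optimality of \<open>G j\<close> limits the saving to
      \<open>\<epsilon> j\<close>. A cell lies below at most one maximal cell; hence the
      \<open>S j\<close> are disjoint and together cost at most as much as
      \<open>G N\<close>.\<close>
    define S where "S j = {(n', k') \<in> G N. \<exists>(n, k)\<in>P j. cell n' k' \<subseteq> cell n k}" for j
    have S_disj: "disjoint_family_on S {..<N}"
      unfolding disjoint_family_on_def
    proof safe
      fix i j n' k' assume ij: "i \<noteq> j" and d: "(n', k') \<in> S i" "(n', k') \<in> S j"
      obtain n1 k1 n2 k2 where 1: "(n1, k1) \<in> P i" "cell n' k' \<subseteq> cell n1 k1"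
        and 2: "(n2, k2) \<in> P j" "cell n' k' \<subseteq> cell n2 k2"
        using d by (auto simp: S_def)
      obtain x where x: "x \<in> cell n' k'" using cell_nonempty by blast
      have "n1 \<le> n2" using Qmax[of n1 k1 n2 k2 j x] 1 2 x by (auto simp: P_def)
      moreover have "n2 \<le> n1" using Qmax[of n2 k2 n1 k1 i x] 1 2 x by (auto simp: P_def)
      ultimately have "n1 = n2" by simp
      moreover have "k1 = k2" using x 1 2 \<open>n1 = n2\<close> by (auto simp: cell_def)
      ultimately have "(n1, k1) \<in> P i \<inter> P j" using 1 2 by auto
      then show "(n', k') \<in> {}" using P_disj ij by (auto simp: disjoint_family_on_def)
    qed
    have step: "cost s (P j) \<le> cost s (S j) + ennreal (\<epsilon> j)" if "j < N" for j
    proof -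
      have "E j \<subseteq> cells ((G j - P j) \<union> S j)"
      proof
        fix x assume x: "x \<in> E j"
        then obtain n where n: "(n, \<lfloor>2 ^ n * x\<rfloor>) \<in> G j" using G(1) by (auto simp: cells_def)
        show "x \<in> cells ((G j - P j) \<union> S j)"
        proof (cases "(n, \<lfloor>2 ^ n * x\<rfloor>) \<in> P j")
          case True
          have "x \<in> E N" using x E that by (meson incseqD less_imp_le subsetD)
          then obtain n' where n': "(n', \<lfloor>2 ^ n' * x\<rfloor>) \<in> G N" using G(1) by (auto simp: cells_def)
          have xin: "x \<in> cell n \<lfloor>2 ^ n * x\<rfloor>" "x \<in> cell n' \<lfloor>2 ^ n' * x\<rfloor>" by (auto simp: cell_def)
          have "n \<le> n'" using Qmax[OF _ n' xin] True by (auto simp: P_def)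
          then have "cell n' \<lfloor>2 ^ n' * x\<rfloor> \<subseteq> cell n \<lfloor>2 ^ n * x\<rfloor>" using xin by (rule cell_nested)
          then have "(n', \<lfloor>2 ^ n' * x\<rfloor>) \<in> S j" using n' True by (auto simp: S_def)
          then show ?thesis by (auto simp: cells_def)
        next
          case False
          then show ?thesis using n by (auto simp: cells_def)
        qed
      qed
      then have "dyadic_content s (E j) \<le> cost s ((G j - P j) \<union> S j)" by (rule content_le)
      also have "\<dots> \<le> cost s (G j - P j) + cost s (S j)" by (intro emeasure_subadditive) auto
      finally have 1: "dyadic_content s (E j) \<le> cost s (G j - P j) + cost s (S j)" .
      have "P j \<subseteq> G j" by (auto simp: P_def)
      then have 2: "cost s (G j) = cost s (G j - P j) + cost s (P j)"
        by (subst plus_emeasure) (auto intro!: arg_cong[where f="cost s"])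
      have "cost s (G j - P j) + cost s (P j) \<le> dyadic_content s (E j) + ennreal (\<epsilon> j)"
        using G(2)[of j] 2 by simp
      also have "\<dots> \<le> cost s (G j - P j) + (cost s (S j) + ennreal (\<epsilon> j))"
        using 1 by (simp add: add.assoc[symmetric] add_right_mono)
      finally have "cost s (G j - P j) + cost s (P j) \<le> cost s (G j - P j) + (cost s (S j) + ennreal (\<epsilon> j))" .
      moreover have "cost s (G j - P j) < \<top>"
        using 2 costG[of j] by (metis ennreal_add_eq_top less_top)
      ultimately show ?thesis by (auto simp: ennreal_add_left_cancel_le)
    qed
    have "(\<Sum>j<N. cost s (P j)) \<le> (\<Sum>j<N. cost s (S j) + ennreal (\<epsilon> j))"
      by (intro sum_mono step) auto
    also have "\<dots> = cost s (\<Union>j<N. S j) + (\<Sum>j<N. ennreal (\<epsilon> j))"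
      using S_disj by (subst sum.distrib, subst sum_emeasure[symmetric]) auto
    also have "(\<Sum>j<N. ennreal (\<epsilon> j)) = ennreal (\<Sum>j<N. \<epsilon> j)"
      using \<epsilon> by (intro sum_ennreal) (simp add: less_imp_le)
    also have "cost s (\<Union>j<N. S j) \<le> cost s (G N)"
      by (intro emeasure_mono) (auto simp: S_def)
    also have "cost s (G N) \<le> c + ennreal (\<epsilon> N)"
      using G(2)[of N] le[of N] by (meson add_right_mono order_trans)
    finally have "(\<Sum>j<N. cost s (P j)) \<le> c + (ennreal (\<epsilon> N) + ennreal (\<Sum>j<N. \<epsilon> j))"
      by (simp add: add.assoc add_right_mono)
    also have "ennreal (\<epsilon> N) + ennreal (\<Sum>j<N. \<epsilon> j) = ennreal (\<epsilon> N + (\<Sum>j<N. \<epsilon> j))"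
      using \<epsilon> by (intro ennreal_plus[symmetric]) (auto intro!: sum_nonneg simp: less_imp_le)
    also have "\<dots> \<le> ennreal e"
    proof (rule ennreal_leI)
      have "(\<Sum>j<Suc N. \<epsilon> j) \<le> suminf \<epsilon>"
        using sums_mult[OF power_half_series, of "e/2"] \<epsilon>
        by (intro sum_le_suminf) (auto simp: \<epsilon>_def[abs_def] sums_iff less_imp_le)
      moreover have "suminf \<epsilon> = e / 2"
        using sums_mult[OF power_half_series, of "e/2"] by (simp add: \<epsilon>_def[abs_def] sums_iff)
      ultimately show "\<epsilon> N + (\<Sum>j<N. \<epsilon> j) \<le> e" using e by simp
    qed
    finally show ?thesis by (simp add: add_left_mono)
  qed
  have "dyadic_content s (\<Union>n. E n) \<le> cost s Q" by (rule content_le[OF cov])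
  also have "cost s Q = (\<Sum>j. cost s (P j))"
    unfolding Q_UN using P_disj by (intro suminf_emeasure[symmetric]) auto
  also have "\<dots> \<le> c + ennreal e"
    by (intro suminf_le_const partial) simp
  finally show "dyadic_content s (\<Union>n. E n) \<le> c + ennreal e" .
qed

subsection \<open>Capacitability of Borel sets\<close>

text \<open>Analytic sets, as projections of closed subsets of the line times Baire space. The
  representation supplies a witness sequence whose coordinates can be bounded one at a time.\<close>

definition suslin :: "real set \<Rightarrow> bool" where
  "suslin F \<longleftrightarrow> (\<exists>R :: (real \<times> (nat \<Rightarrow> nat)) set. closed R \<and> F = fst ` R)"

lemma suslin_closed: "closed F \<Longrightarrow> suslin F"
  unfolding suslin_def by (intro exI[of _ "F \<times> UNIV"]) (auto simp: closed_Times)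

lemma continuous_on_reindex:
  "continuous_on UNIV (\<lambda>z :: real \<times> (nat \<Rightarrow> nat). (fst z, \<lambda>k. snd z (h k)))"
  by (intro continuous_on_Pair continuous_on_fst continuous_on_id continuous_on_coordinatewise_then_product
      continuous_on_product_then_coordinatewise[OF continuous_on_snd])

text \<open>Coordinate 0 of the sequence names a set that contains the point; the shifted sequence
  is the witness for it.\<close>

lemma suslin_UN:
  assumes "\<And>i::nat. suslin (F i)"
  shows "suslin (\<Union>i. F i)"
proof -
  obtain R :: "nat \<Rightarrow> (real \<times> (nat \<Rightarrow> nat)) set" where R: "\<And>i. closed (R i)" "\<And>i. F i = fst ` R i"
    using assms unfolding suslin_def by metis
  define g where "g = (\<lambda>z :: real \<times> (nat \<Rightarrow> nat). (fst z, \<lambda>k. snd z (Suc k)))"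
  have g: "continuous_on UNIV g" unfolding g_def by (rule continuous_on_reindex)
  define R' where "R' = {z. g z \<in> R (snd z 0)}"
  have "open (- R')"
  proof -
    have "- R' = (\<Union>i. {z. snd z 0 = i} \<inter> g -` (- R i))" by (auto simp: R'_def)
    moreover have "open ({z :: real \<times> (nat \<Rightarrow> nat). snd z 0 = i} \<inter> g -` (- R i))" for i
    proof (intro open_Int)
      have "continuous_on UNIV (\<lambda>z :: real \<times> (nat \<Rightarrow> nat). snd z 0)"
        by (intro continuous_on_product_then_coordinatewise[OF continuous_on_snd] continuous_on_id)
      then have "open ((\<lambda>z :: real \<times> (nat \<Rightarrow> nat). snd z 0) -` {i})"
        by (rule open_vimage[OF discrete_topology_class.open_discrete])
      then show "open {z :: real \<times> (nat \<Rightarrow> nat). snd z 0 = i}" by (simp add: vimage_def)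
      show "open (g -` (- R i))" using g R(1) by (intro open_vimage) auto
    qed
    ultimately show ?thesis by auto
  qed
  moreover have "(\<Union>i. F i) = fst ` R'"
  proof safe
    fix x i assume "x \<in> F i"
    then obtain \<sigma> where "(x, \<sigma>) \<in> R i" using R(2) by auto
    then have "(x, case_nat i \<sigma>) \<in> R'" by (simp add: R'_def g_def)
    then show "x \<in> fst ` R'" by force
  next
    fix x \<sigma> assume "(x, \<sigma>) \<in> R'"
    then have "(x, \<lambda>k. \<sigma> (Suc k)) \<in> R (\<sigma> 0)" by (simp add: R'_def g_def)
    then show "fst (x, \<sigma>) \<in> (\<Union>i. F i)" using R(2) by force
  qed
  ultimately show ?thesis unfolding suslin_def closed_def by blast
qed

text \<open>One sequence stores witnesses for all the sets at once, the n-th of them in the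
  coordinates \<open>prod_encode (n, k)\<close>.\<close>

lemma suslin_INT:
  assumes "\<And>i::nat. suslin (F i)"
  shows "suslin (\<Inter>i. F i)"
proof -
  obtain R :: "nat \<Rightarrow> (real \<times> (nat \<Rightarrow> nat)) set" where R: "\<And>i. closed (R i)" "\<And>i. F i = fst ` R i"
    using assms unfolding suslin_def by metis
  define g where "g = (\<lambda>n. \<lambda>z :: real \<times> (nat \<Rightarrow> nat). (fst z, \<lambda>k. snd z (prod_encode (n, k))))"
  have g: "continuous_on UNIV (g n)" for n unfolding g_def by (rule continuous_on_reindex)
  define R' where "R' = (\<Inter>n. g n -` R n)"
  have "closed R'" unfolding R'_def using g R(1) by (intro closed_INT ballI closed_vimage) auto
  moreover have "(\<Inter>i. F i) = fst ` R'"
  proof safe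
    fix x assume "x \<in> (\<Inter>i. F i)"
    then have "\<forall>i. \<exists>\<sigma>. (x, \<sigma>) \<in> R i" using R(2) by fastforce
    then obtain \<sigma> where "\<And>i. (x, \<sigma> i) \<in> R i" by metis
    then have "(x, \<lambda>j. case prod_decode j of (n, k) \<Rightarrow> \<sigma> n k) \<in> R'" by (simp add: R'_def g_def)
    then show "x \<in> fst ` R'" by force
  next
    fix x \<sigma> i assume "(x, \<sigma>) \<in> R'"
    then have "(x, \<lambda>k. \<sigma> (prod_encode (i, k))) \<in> R i" by (auto simp: R'_def g_def)
    then show "fst (x, \<sigma>) \<in> F i" using R(2) by force
  qed
  ultimately show ?thesis unfolding suslin_def by blast
qed

lemma suslin_open:
  assumes "open S"
  shows "suslin S"
\<comment> \<open>\<open>infdist\<close> to the empty set is 0 by convention, so the whole line is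
  treated separately.\<close>
proof (cases "- S = {}")
  case True
  then have "S = UNIV" by auto
  then show ?thesis by (simp add: suslin_closed)
next
  case False
  have eq: "S = (\<Union>n. {x. 1 / real (Suc n) \<le> infdist x (- S)})"
  proof safe
    fix x assume "x \<in> S"
    then have "infdist x (- S) \<noteq> 0"
      using in_closed_iff_infdist_zero[of "- S" x] assms False by (auto simp: closed_Compl)
    then have "0 < infdist x (- S)" using infdist_nonneg[of x "- S"] by linarith
    then obtain n where "1 / real (Suc n) < infdist x (- S)" by (rule nat_approx_posE)
    then show "x \<in> (\<Union>n. {x. 1 / real (Suc n) \<le> infdist x (- S)})"
      by (intro UN_I[of n] CollectI) auto
  next
    fix x n assume "1 / real (Suc n) \<le> infdist x (- S)"
    moreover have "0 < 1 / real (Suc n)" by simp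
    ultimately have "infdist x (- S) \<noteq> 0" by linarith
    then show "x \<in> S" using infdist_zero[of x "- S"] by blast
  qed
  have "suslin {x. 1 / real (Suc n) \<le> infdist x (- S)}" for n
    by (intro suslin_closed closed_Collect_le continuous_intros)
  then show ?thesis by (subst eq) (rule suslin_UN)
qed

text \<open>The complement of an analytic set need not be analytic, so the induction carries a set
  and its complement together.\<close>

lemma suslin_borel:
  assumes "F \<in> sets borel"
  shows "suslin F"
proof -
  have "F \<in> sigma_sets UNIV {S. open S}" using assms by (simp add: borel_def)
  then have "suslin F \<and> suslin (- F)"
  proof induction
    case (Basic a)
    then show ?case by (auto intro: suslin_open suslin_closed)
  next
    case Empty
    then show ?case by (auto intro: suslin_closed)
  next
    case (Compl a)
    then show ?case by (simp add: Compl_eq_Diff_UNIV double_diff)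
  next
    case (Union a)
    have "- (\<Union>i. a i) = (\<Inter>i. - a i)" by auto
    then show ?case using Union suslin_UN[of a] suslin_INT[of "\<lambda>i. - a i"] by auto
  qed
  then show ?thesis ..
qed

section \<open>Sequences of naturals with the product topology\<close>

lemma tendsto_fun_discrete:
  fixes f :: "nat \<Rightarrow> nat \<Rightarrow> nat"
  assumes "\<And>i. \<forall>\<^sub>F n in sequentially. f n i = l i"
  shows "f \<longlonglongrightarrow> l"
proof (rule topological_tendstoI)
  fix S :: "(nat \<Rightarrow> nat) set" assume "open S" "l \<in> S"
  then have "openin (product_topology (\<lambda>i. euclidean) UNIV) S"
    by (simp add: euclidean_product_topology)
  then obtain U where U: "finite {i. U i \<noteq> UNIV}" "l \<in> Pi\<^sub>E UNIV U" "Pi\<^sub>E UNIV U \<subseteq> S"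
    using \<open>l \<in> S\<close> unfolding openin_product_topology_alt by force
  have "\<forall>\<^sub>F n in sequentially. \<forall>i\<in>{i. U i \<noteq> UNIV}. f n i = l i"
    using U(1) assms by (intro eventually_ball_finite) auto
  then show "\<forall>\<^sub>F n in sequentially. f n \<in> S"
  proof eventually_elim
    case (elim n)
    then have "f n \<in> Pi\<^sub>E UNIV U" using U(2) by (auto simp: PiE_iff) (metis UNIV_I)
    then show ?case using U(3) by blast
  qed
qed

lemma tendsto_fun_coordinate:
  fixes f :: "nat \<Rightarrow> nat \<Rightarrow> nat"
  assumes "f \<longlonglongrightarrow> l"
  shows "\<forall>\<^sub>F n in sequentially. f n i = l i"
proof -
  have "open ((\<lambda>\<sigma> :: nat \<Rightarrow> nat. \<sigma> i) -` {l i})"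
    by (rule open_vimage[OF discrete_topology_class.open_discrete continuous_on_product_coordinates])
  then show ?thesis using topological_tendstoD[OF assms, of "(\<lambda>\<sigma>. \<sigma> i) -` {l i}"] by simp
qed

context
  fixes R :: "(real \<times> (nat \<Rightarrow> nat)) set" and N :: "nat \<Rightarrow> nat" and a b :: real
  assumes R: "closed R"
begin

lemma compact_bounded_sequences: "compact {\<sigma> :: nat \<Rightarrow> nat. \<forall>i. \<sigma> i \<le> N i}"
proof -
  have "compactin (product_topology (\<lambda>i. euclidean) UNIV) (Pi\<^sub>E UNIV (\<lambda>i. {..N i}))"
    by (simp add: compactin_PiE finite_imp_compact)
  moreover have "Pi\<^sub>E UNIV (\<lambda>i. {..N i}) = {\<sigma>. \<forall>i. \<sigma> i \<le> N i}" by (auto simp: PiE_iff)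
  ultimately show ?thesis by (simp add: euclidean_product_topology)
qed

lemma closed_bounded_projection: "closed {x\<in>{a..b}. \<exists>\<sigma>. (x, \<sigma>) \<in> R \<and> (\<forall>i. \<sigma> i \<le> N i)}"
proof -
  have "compact (R \<inter> ({a..b} \<times> {\<sigma>. \<forall>i. \<sigma> i \<le> N i}))"
    using R by (intro closed_Int_compact compact_Times compact_bounded_sequences) auto
  then have "compact (fst ` (R \<inter> ({a..b} \<times> {\<sigma>. \<forall>i. \<sigma> i \<le> N i})))"
    by (intro compact_continuous_image continuous_intros)
  moreover have "fst ` (R \<inter> ({a..b} \<times> {\<sigma>. \<forall>i. \<sigma> i \<le> N i})) = {x\<in>{a..b}. \<exists>\<sigma>. (x, \<sigma>) \<in> R \<and> (\<forall>i. \<sigma> i \<le> N i)}"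
    by force
  ultimately show ?thesis by (simp add: compact_imp_closed)
qed

text \<open>Compactness replaces infinitely many coordinate bounds by finitely many: points outside
  \<open>U\<close> that satisfy more and more of the bounds would have a limit outside
  \<open>U\<close> that satisfies all of them.\<close>

lemma bounded_projection_open:
  assumes U: "open U" and sub: "{x\<in>{a..b}. \<exists>\<sigma>. (x, \<sigma>) \<in> R \<and> (\<forall>i. \<sigma> i \<le> N i)} \<subseteq> U"
  shows "\<exists>k. {x\<in>{a..b}. \<exists>\<sigma>. (x, \<sigma>) \<in> R \<and> (\<forall>i<k. \<sigma> i \<le> N i)} \<subseteq> U"
proof (rule ccontr)
  assume "\<not> ?thesis"
  then have "\<forall>k. \<exists>x \<sigma>. x \<in> {a..b} \<and> x \<notin> U \<and> (x, \<sigma>) \<in> R \<and> (\<forall>i<k. \<sigma> i \<le> N i)"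
    by (simp add: subset_iff) blast
  then obtain x \<sigma> where x: "\<And>k. x k \<in> {a..b}" "\<And>k. x k \<notin> U" and \<sigma>: "\<And>k. (x k, \<sigma> k) \<in> R" "\<And>k i. i < k \<Longrightarrow> \<sigma> k i \<le> N i"
    by metis
  \<comment> \<open>The coordinates of \<open>\<sigma> k\<close> from k on are uncontrolled. Set to
    0, they give sequences in a compact set that agree with \<open>\<sigma> k\<close> on the first k
    coordinates, hence have the same limits.\<close>
  define \<tau> where "\<tau> k i = (if i < k then \<sigma> k i else 0)" for k i
  have "seq_compact ({a..b} \<times> {\<sigma>. \<forall>i. \<sigma> i \<le> N i})"
    by (intro compact_imp_seq_compact compact_Times compact_bounded_sequences) simp
  moreover have "\<forall>k. (x k, \<tau> k) \<in> {a..b} \<times> {\<sigma>. \<forall>i. \<sigma> i \<le> N i}"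
    using x \<sigma> by (auto simp: \<tau>_def)
  ultimately obtain l r where l: "l \<in> {a..b} \<times> {\<sigma>. \<forall>i. \<sigma> i \<le> N i}" and r: "strict_mono r"
    and lim: "((\<lambda>k. (x k, \<tau> k)) \<circ> r) \<longlonglongrightarrow> l"
    by (rule seq_compactE)
  have limx: "(\<lambda>k. x (r k)) \<longlonglongrightarrow> fst l" and lim\<tau>: "(\<lambda>k. \<tau> (r k)) \<longlonglongrightarrow> snd l"
    using tendsto_fst[OF lim] tendsto_snd[OF lim] by (simp_all add: o_def)
  have "(\<lambda>k. \<sigma> (r k)) \<longlonglongrightarrow> snd l"
  proof (rule tendsto_fun_discrete)
    fix i
    have "\<forall>\<^sub>F k in sequentially. i < r k"
      using seq_suble[OF r] by (intro eventually_sequentiallyI[of "Suc i"]) (meson Suc_le_eq le_trans)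
    then show "\<forall>\<^sub>F k in sequentially. \<sigma> (r k) i = snd l i"
      using tendsto_fun_coordinate[OF lim\<tau>, of i] by eventually_elim (simp add: \<tau>_def)
  qed
  then have "(\<lambda>k. (x (r k), \<sigma> (r k))) \<longlonglongrightarrow> (fst l, snd l)" using limx by (intro tendsto_Pair)
  then have "(fst l, snd l) \<in> R" by (rule closed_sequentially[OF R, rotated]) (use \<sigma> in auto)
  then have "fst l \<in> U" using sub l by (cases l) auto
  moreover have "fst l \<in> - U" using U x(2) by (intro closed_sequentially[OF _ _ limx]) auto
  ultimately show False by simp
qed

end

lemma cost_eq_nn_integral: "cost s A = (\<integral>\<^sup>+ d. ennreal (2 powr (- s * real (fst d))) \<partial>count_space A)"
  by (simp add: weight_measure_def emeasure_density nn_integral_count_space_indicator[symmetric])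

lemma cost_shift: "cost s ((\<lambda>(n, k). (n, k + j)) ` G) = cost s G"
proof -
  have "bij_betw (\<lambda>(n, k). (n, k + j)) G ((\<lambda>(n, k). (n, k + j)) ` G)"
    by (auto simp: bij_betw_def inj_on_def)
  from nn_integral_bij_count_space[OF this, of "\<lambda>d. ennreal (2 powr (- s * real (fst d)))"]
  show ?thesis by (simp add: cost_eq_nn_integral case_prod_unfold)
qed

text \<open>Half-open cells are not open; adding both neighbours costs a factor 3, which is harmless because
  only positivity of the content of the compact set matters below.\<close>

lemma cells_open_neighbourhood:
  obtains U where "open U" "cells G \<subseteq> U" "dyadic_content s U \<le> cost s G + cost s G + cost s G"
proof
  define U where "U = (\<Union>(n, k)\<in>G. {x. real_of_int k - 1 / 2 < 2 ^ n * x} \<inter> {x. 2 ^ n * x < real_of_int k + 3 / 2})"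
  define H where "H j = (\<lambda>(n, k). (n, k + j)) ` G" for j :: int
  show "open U" unfolding U_def
    by (intro open_UN ballI) (auto intro!: open_Int open_Collect_less continuous_intros)
  show "cells G \<subseteq> U"
  proof
    fix x assume "x \<in> cells G"
    then obtain n where n: "(n, \<lfloor>2 ^ n * x\<rfloor>) \<in> G" by (auto simp: cells_def)
    have "real_of_int \<lfloor>2 ^ n * x\<rfloor> - 1 / 2 < 2 ^ n * x \<and> 2 ^ n * x < real_of_int \<lfloor>2 ^ n * x\<rfloor> + 3 / 2"
      by linarith
    then show "x \<in> U" using n unfolding U_def by blast
  qed
  have "U \<subseteq> cells (H (-1) \<union> H 0 \<union> H 1)"
  proof
    fix x assume "x \<in> U"
    then obtain n k where nk: "(n, k) \<in> G" "real_of_int k - 1 / 2 < 2 ^ n * x" "2 ^ n * x < real_of_int k + 3 / 2"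
      by (auto simp: U_def)
    then have "\<lfloor>2 ^ n * x\<rfloor> = k + (-1) \<or> \<lfloor>2 ^ n * x\<rfloor> = k + 0 \<or> \<lfloor>2 ^ n * x\<rfloor> = k + 1" by linarith
    then have "(n, \<lfloor>2 ^ n * x\<rfloor>) \<in> H (-1) \<union> H 0 \<union> H 1" using nk(1) unfolding H_def by force
    then show "x \<in> cells (H (-1) \<union> H 0 \<union> H 1)" by (auto simp: cells_def)
  qed
  then have "dyadic_content s U \<le> cost s (H (-1) \<union> H 0 \<union> H 1)" by (rule content_le)
  also have "\<dots> \<le> cost s (H (-1)) + cost s (H 0) + cost s (H 1)"
    by (intro order_trans[OF emeasure_subadditive] add_right_mono emeasure_subadditive) auto
  finally show "dyadic_content s U \<le> cost s G + cost s G + cost s G" unfolding H_def cost_shift .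
qed

text \<open>Choquet's argument: coordinate bounds are chosen one by one, and
  \<open>content_incseq\<close> keeps the content above \<open>c\<close>. Along the decreasing sets
  \<open>P (f k)\<close> the content is not known to be continuous, so the limit set
  \<open>K\<close> is reached through open neighbourhoods and compactness.\<close>

lemma content_capacitable:
  assumes F: "F \<in> sets borel" "F \<subseteq> {a..b}" and pos: "0 < dyadic_content s F"
  obtains K where "closed K" "K \<subseteq> F" "0 < dyadic_content s K"
proof -
  obtain R :: "(real \<times> (nat \<Rightarrow> nat)) set" where R: "closed R" and FR: "F = fst ` R"
    using suslin_borel[OF F(1)] unfolding suslin_def by metis
  obtain c where c: "0 < c" "c < dyadic_content s F" using pos dense by blast
  define P where "P xs = {x\<in>{a..b}. \<exists>\<sigma>. (x, \<sigma>) \<in> R \<and> (\<forall>i<length xs. \<sigma> i \<le> xs ! i)}" for xs :: "nat list"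
  have "\<exists>f. \<forall>n. (length (f n) = n \<and> c < dyadic_content s (P (f n))) \<and> (\<exists>j. f (Suc n) = f n @ [j])"
  proof (rule dependent_nat_choice)
    have "P [] = F" using F(2) FR by (force simp: P_def)
    then show "\<exists>xs. length xs = 0 \<and> c < dyadic_content s (P xs)" using c by auto
  next
    fix xs :: "nat list" and n assume xs: "length xs = n \<and> c < dyadic_content s (P xs)"
    have UN: "P xs = (\<Union>j. P (xs @ [j]))"
      by (auto simp: P_def nth_append less_Suc_eq)
    have "incseq (\<lambda>j. P (xs @ [j]))"
      by (rule incseq_SucI) (auto simp: P_def nth_append less_Suc_eq, metis le_SucI)
    then have "\<exists>j. c < dyadic_content s (P (xs @ [j]))"
      using content_incseq[of "\<lambda>j. P (xs @ [j])" s c] xs UN by (metis not_less)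
    then obtain j where "c < dyadic_content s (P (xs @ [j]))" ..
    then show "\<exists>ys. (length ys = Suc n \<and> c < dyadic_content s (P ys)) \<and> (\<exists>j. ys = xs @ [j])"
      using xs by (intro exI[of _ "xs @ [j]"]) auto
  qed
  then obtain f where f: "\<And>n. length (f n) = n" "\<And>n. c < dyadic_content s (P (f n))" "\<And>n. \<exists>j. f (Suc n) = f n @ [j]"
    by blast
  define N where "N i = f (Suc i) ! i" for i
  have fN: "f n ! i = N i" if "i < n" for n i
    using that
  proof (induction n)
    case (Suc n)
    then show ?case using f(1)[of n] f(3)[of n] by (auto simp: N_def less_Suc_eq nth_append)
  qed simp
  define K where "K = {x\<in>{a..b}. \<exists>\<sigma>. (x, \<sigma>) \<in> R \<and> (\<forall>i. \<sigma> i \<le> N i)}"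
  have "closed K" unfolding K_def by (rule closed_bounded_projection[OF R])
  moreover have "K \<subseteq> F" using FR by (force simp: K_def)
  moreover have "dyadic_content s K \<noteq> 0"
  proof
    assume 0: "dyadic_content s K = 0"
    obtain r where r: "0 < r" "c = ennreal r"
      using c by (cases c) auto
    \<comment> \<open>A cover of \<open>K\<close> that costs less than c/3 enlarges to an open set
      of content at most c, and this open set already contains some \<open>P (f k)\<close>.\<close>
    have "dyadic_content s K < ennreal (r / 3)" using r 0 by simp
    then obtain G where G: "K \<subseteq> cells G" "cost s G < ennreal (r / 3)" by (rule content_approx)
    obtain U where U: "open U" "cells G \<subseteq> U" "dyadic_content s U \<le> cost s G + cost s G + cost s G"
      by (rule cells_open_neighbourhood)
    have "\<exists>k. {x\<in>{a..b}. \<exists>\<sigma>. (x, \<sigma>) \<in> R \<and> (\<forall>i<k. \<sigma> i \<le> N i)} \<subseteq> U"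
      using G(1) U(2) by (intro bounded_projection_open[OF R U(1)]) (auto simp: K_def)
    then obtain k where "{x\<in>{a..b}. \<exists>\<sigma>. (x, \<sigma>) \<in> R \<and> (\<forall>i<k. \<sigma> i \<le> N i)} \<subseteq> U" by blast
    moreover have "P (f k) = {x\<in>{a..b}. \<exists>\<sigma>. (x, \<sigma>) \<in> R \<and> (\<forall>i<k. \<sigma> i \<le> N i)}"
      using fN by (auto simp: P_def f(1))
    ultimately have "dyadic_content s (P (f k)) \<le> dyadic_content s U" by (simp add: content_mono)
    also have "\<dots> \<le> ennreal (r / 3) + ennreal (r / 3) + ennreal (r / 3)"
      using G(2) U(3) by (meson add_mono less_imp_le order_trans)
    also have "\<dots> = c" using r by (simp flip: ennreal_plus)
    finally show False using f(2)[of k] by simp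
  qed
  ultimately show thesis using that by (simp add: zero_less_iff_neq_zero)
qed

subsection \<open>Frostman measures\<close>

lemma sum_int_double:
  fixes f :: "int \<Rightarrow> real"
  shows "(\<Sum>k\<in>{2 * a..<2 * b}. f k) = (\<Sum>k\<in>{a..<b}. f (2 * k) + f (2 * k + 1))"
proof (cases "a \<le> b")
  case True
  then show ?thesis
  proof (induction rule: int_ge_induct)
    case (step b)
    have "{2 * a..<2 * (b + 1)} = insert (2 * b + 1) (insert (2 * b) {2 * a..<2 * b})"
      using step(1) by auto
    moreover have "{a..<b + 1} = insert b {a..<b}" using step(1) by auto
    ultimately show ?case using step(2) by simp
  qed simp
qed simp

text \<open>The mass of a cell is divided among its two children in proportion to \<open>m\<close>; subadditivity of \<open>m\<close>
  keeps the mass of each child below its value of \<open>m\<close>. If \<open>m\<close> vanishes at both children, then so does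
  the mass of the parent, and the junk value \<open>0 / 0 = 0\<close> is the right one.\<close>

primrec mass :: "(nat \<Rightarrow> int \<Rightarrow> real) \<Rightarrow> int \<Rightarrow> nat \<Rightarrow> int \<Rightarrow> real" where
  "mass m a 0 k = (if k = a then m 0 a else 0)"
| "mass m a (Suc n) k =
     mass m a n (k div 2) * m (Suc n) k / (m (Suc n) (2 * (k div 2)) + m (Suc n) (2 * (k div 2) + 1))"

context
  fixes m :: "nat \<Rightarrow> int \<Rightarrow> real" and a :: int and s :: real and C :: real
  assumes m0: "\<And>n k. 0 \<le> m n k" and sub: "\<And>n k. m n k \<le> m (Suc n) (2 * k) + m (Suc n) (2 * k + 1)"
    and upper: "\<And>n k. m n k \<le> C * 2 powr (- s * real n)" and s: "0 < s"
begin

lemma mass_nonneg: "0 \<le> mass m a n k"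
  using m0 by (induction n arbitrary: k) auto

lemma mass_le: "mass m a n k \<le> m n k"
proof (induction n arbitrary: k)
  case 0
  then show ?case using m0 by simp
next
  case (Suc n)
  define d where "d = m (Suc n) (2 * (k div 2)) + m (Suc n) (2 * (k div 2) + 1)"
  have d: "mass m a n (k div 2) \<le> d" using Suc[of "k div 2"] sub[of n "k div 2"] by (simp add: d_def)
  show ?case
  proof (cases "d = 0")
    case False
    then have "0 < d" using m0 by (simp add: d_def less_le)
    have "mass m a n (k div 2) * m (Suc n) k \<le> d * m (Suc n) k"
      using d m0 by (intro mult_right_mono) auto
    then show ?thesis using \<open>0 < d\<close> by (simp add: d_def[symmetric] divide_le_eq mult.commute)
  qed (use m0 in \<open>simp add: d_def[symmetric]\<close>)
qed

lemma mass_split: "mass m a n k = mass m a (Suc n) (2 * k) + mass m a (Suc n) (2 * k + 1)"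
proof -
  define d where "d = m (Suc n) (2 * k) + m (Suc n) (2 * k + 1)"
  have "mass m a (Suc n) (2 * k) + mass m a (Suc n) (2 * k + 1) = mass m a n k * d / d"
    by (simp add: d_def add_divide_distrib[symmetric] distrib_left)
  also have "\<dots> = mass m a n k"
  proof (cases "d = 0")
    case True
    then show ?thesis using mass_le[of n k] mass_nonneg[of n k] sub[of n k] by (simp add: d_def)
  qed simp
  finally show ?thesis ..
qed

text \<open>A lower approximation, at level n, of the distribution function of the measure to be
  built; adding the mass of the cell of x gives an upper one. Refinement of the level tightens
  both.\<close>

definition mass_below :: "nat \<Rightarrow> real \<Rightarrow> real" where
  "mass_below n x = (\<Sum>k\<in>{a * 2 ^ n..<\<lfloor>2 ^ n * x\<rfloor>}. mass m a n k)"

lemma floor_Suc_cases: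
  "\<lfloor>2 ^ Suc n * x\<rfloor> = 2 * \<lfloor>2 ^ n * x\<rfloor> \<or> \<lfloor>2 ^ Suc n * x :: real\<rfloor> = 2 * \<lfloor>2 ^ n * x\<rfloor> + 1"
proof -
  have "2 ^ Suc n * x = 2 * (2 ^ n * x)" by simp
  then show ?thesis by linarith
qed

lemma mass_below_double:
  "(\<Sum>k\<in>{a * 2 ^ Suc n..<2 * b}. mass m a (Suc n) k) = (\<Sum>k\<in>{a * 2 ^ n..<b}. mass m a n k)"
proof -
  have "a * 2 ^ Suc n = 2 * (a * 2 ^ n)" by simp
  then show ?thesis by (simp only: sum_int_double mass_split[symmetric])
qed

lemma mass_below_Suc:
  "mass_below n x \<le> mass_below (Suc n) x"
  "mass_below (Suc n) x + mass m a (Suc n) \<lfloor>2 ^ Suc n * x\<rfloor> \<le> mass_below n x + mass m a n \<lfloor>2 ^ n * x\<rfloor>"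
proof -
  define b where "b = \<lfloor>2 ^ n * x\<rfloor>"
  have split: "mass m a n b = mass m a (Suc n) (2 * b) + mass m a (Suc n) (2 * b + 1)" by (rule mass_split)
  consider "\<lfloor>2 ^ Suc n * x\<rfloor> = 2 * b" | "\<lfloor>2 ^ Suc n * x\<rfloor> = 2 * b + 1"
    using floor_Suc_cases[of n x] by (auto simp: b_def)
  then have "mass_below n x \<le> mass_below (Suc n) x \<and>
    mass_below (Suc n) x + mass m a (Suc n) \<lfloor>2 ^ Suc n * x\<rfloor> \<le> mass_below n x + mass m a n b"
  proof cases
    case 1
    have "mass_below (Suc n) x = mass_below n x"
      unfolding mass_below_def 1 mass_below_double by (simp add: b_def)
    then show ?thesis using split mass_nonneg[of "Suc n" "2 * b + 1"] 1 by (simp del: mass.simps)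
  next
    case 2
    have "mass_below (Suc n) x \<le> mass_below n x + mass m a (Suc n) (2 * b)"
      and "mass_below n x \<le> mass_below (Suc n) x"
    proof -
      have "{a * 2 ^ Suc n..<2 * b + 1} \<subseteq> insert (2 * b) {a * 2 ^ Suc n..<2 * b}" by auto
      then have "mass_below (Suc n) x \<le> sum (mass m a (Suc n)) (insert (2 * b) {a * 2 ^ Suc n..<2 * b})"
        unfolding mass_below_def 2 using mass_nonneg by (intro sum_mono2) (auto simp del: mass.simps)
      also have "\<dots> = mass m a (Suc n) (2 * b) + mass_below n x"
        unfolding mass_below_def using mass_below_double[of n b] by (simp add: b_def del: mass.simps)
      finally show "mass_below (Suc n) x \<le> mass_below n x + mass m a (Suc n) (2 * b)" by simp
      have "mass_below n x = sum (mass m a (Suc n)) {a * 2 ^ Suc n..<2 * b}"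
        unfolding mass_below_def mass_below_double by (simp add: b_def)
      also have "\<dots> \<le> mass_below (Suc n) x"
        unfolding mass_below_def 2 using mass_nonneg by (intro sum_mono2) (auto simp del: mass.simps)
      finally show "mass_below n x \<le> mass_below (Suc n) x" .
    qed
    then show ?thesis using split 2 by (simp del: mass.simps)
  qed
  then show "mass_below n x \<le> mass_below (Suc n) x"
    "mass_below (Suc n) x + mass m a (Suc n) \<lfloor>2 ^ Suc n * x\<rfloor> \<le> mass_below n x + mass m a n \<lfloor>2 ^ n * x\<rfloor>"
    unfolding b_def by auto
qed

definition mass_cdf :: "real \<Rightarrow> real" where
  "mass_cdf x = lim (\<lambda>n. mass_below n x)"

lemma mass_cdf:
  "(\<lambda>n. mass_below n x) \<longlonglongrightarrow> mass_cdf x"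
  "mass_below n x \<le> mass_cdf x"
  "mass_cdf x \<le> mass_below n x + mass m a n \<lfloor>2 ^ n * x\<rfloor>"
proof -
  have inc: "incseq (\<lambda>n. mass_below n x)" by (intro incseq_SucI mass_below_Suc)
  have dec: "decseq (\<lambda>n. mass_below n x + mass m a n \<lfloor>2 ^ n * x\<rfloor>)" by (intro decseq_SucI mass_below_Suc)
  have le: "mass_below k x \<le> mass_below n x + mass m a n \<lfloor>2 ^ n * x\<rfloor>" for k n
  proof -
    have "mass_below k x \<le> mass_below (max k n) x" using inc by (auto simp: incseq_def)
    also have "\<dots> \<le> mass_below (max k n) x + mass m a (max k n) \<lfloor>2 ^ max k n * x\<rfloor>"
      using mass_nonneg by simp
    also have "\<dots> \<le> mass_below n x + mass m a n \<lfloor>2 ^ n * x\<rfloor>"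
      using dec by (auto simp: decseq_def)
    finally show ?thesis .
  qed
  have "convergent (\<lambda>n. mass_below n x)"
    using incseq_convergent[OF inc, of "mass_below 0 x + mass m a 0 \<lfloor>2 ^ 0 * x\<rfloor>"] le
    by (metis convergentI)
  then show lim: "(\<lambda>n. mass_below n x) \<longlonglongrightarrow> mass_cdf x"
    unfolding mass_cdf_def by (simp add: convergent_LIMSEQ_iff)
  show "mass_below n x \<le> mass_cdf x" by (rule incseq_le[OF inc lim])
  show "mass_cdf x \<le> mass_below n x + mass m a n \<lfloor>2 ^ n * x\<rfloor>"
    by (rule LIMSEQ_le_const2[OF lim]) (use le in auto)
qed

lemma mass_below_mono: "x \<le> y \<Longrightarrow> mass_below n x \<le> mass_below n y"
  unfolding mass_below_def using mass_nonneg
  by (intro sum_mono2) (auto intro: order.strict_trans2 floor_mono)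

lemma mass_cdf_mono: "x \<le> y \<Longrightarrow> mass_cdf x \<le> mass_cdf y"
  by (rule LIMSEQ_le[OF mass_cdf(1) mass_cdf(1)]) (use mass_below_mono in auto)

lemma mass_upper: "mass m a n k \<le> C * 2 powr (- s * real n)"
  using mass_le upper order_trans by blast

lemma mass_below_step:
  assumes "\<lfloor>2 ^ n * y\<rfloor> \<le> \<lfloor>2 ^ n * x\<rfloor> + 1"
  shows "mass_below n y \<le> mass_below n x + mass m a n \<lfloor>2 ^ n * x\<rfloor>"
proof -
  have "mass_below n y \<le> sum (mass m a n) (insert \<lfloor>2 ^ n * x\<rfloor> {a * 2 ^ n..<\<lfloor>2 ^ n * x\<rfloor>})"
    unfolding mass_below_def using mass_nonneg assms by (intro sum_mono2) auto
  then show ?thesis by (simp add: mass_below_def)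
qed

lemma mass_cdf_step:
  assumes "\<lfloor>2 ^ n * y\<rfloor> \<le> \<lfloor>2 ^ n * x\<rfloor> + 1"
  shows "mass_cdf y \<le> mass_cdf x + mass m a n \<lfloor>2 ^ n * x\<rfloor> + mass m a n \<lfloor>2 ^ n * y\<rfloor>"
  using mass_below_step[OF assms] mass_cdf(2)[of n x] mass_cdf(3)[of y n] by linarith

lemma geometric_decay: "(\<lambda>n. C * 2 powr (- s * real n)) \<longlonglongrightarrow> 0"
proof -
  have "(\<lambda>n. (2 powr (- s)) ^ n) \<longlonglongrightarrow> 0"
    using s by (intro LIMSEQ_realpow_zero) (auto simp: powr_less_one)
  then have "(\<lambda>n. 2 powr (- s * real n)) \<longlonglongrightarrow> 0"
    by (simp add: powr_realpow[symmetric] powr_powr)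
  then show ?thesis by (auto intro: tendsto_mult_right_zero)
qed

text \<open>Points closer than 2^-n lie in equal or adjacent cells. As s is positive the bound tends
  to 0, so the limit measure will have no atoms and endpoints of cells carry no mass.\<close>

lemma mass_cdf_uniform:
  assumes "\<bar>y - x\<bar> * 2 ^ n < 1"
  shows "\<bar>mass_cdf y - mass_cdf x\<bar> \<le> 2 * (C * 2 powr (- s * real n))"
proof -
  have *: "mass_cdf v \<le> mass_cdf u + 2 * (C * 2 powr (- s * real n))" if "\<bar>v - u\<bar> * 2 ^ n < 1" for u v
  proof -
    have "(v - u) * 2 ^ n \<le> \<bar>v - u\<bar> * 2 ^ n" by (intro mult_right_mono) auto
    moreover have "2 ^ n * v - 2 ^ n * u = (v - u) * 2 ^ n" by (simp add: algebra_simps)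
    ultimately have "\<lfloor>2 ^ n * v\<rfloor> \<le> \<lfloor>2 ^ n * u\<rfloor> + 1" using that by linarith
    from mass_cdf_step[OF this] show ?thesis
      using mass_upper[of n "\<lfloor>2 ^ n * u\<rfloor>"] mass_upper[of n "\<lfloor>2 ^ n * v\<rfloor>"] by linarith
  qed
  show ?thesis using *[of x y] *[of y x] assms by (simp add: abs_minus_commute)
qed

lemma mass_cdf_continuous: "continuous_on UNIV mass_cdf"
proof (intro continuous_at_imp_continuous_on ballI)
  fix x
  show "isCont mass_cdf x"
    unfolding continuous_at_eps_delta
  proof (intro allI impI)
    fix e :: real assume "0 < e"
    then obtain n where n: "2 * (C * 2 powr (- s * real n)) < e"
      using order_tendstoD(2)[OF tendsto_mult_right_zero[OF geometric_decay, of 2]]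
      by (fastforce simp: eventually_sequentially)
    show "\<exists>d>0. \<forall>y. dist y x < d \<longrightarrow> dist (mass_cdf y) (mass_cdf x) < e"
    proof (intro exI[of _ "1 / 2 ^ n"] conjI allI impI)
      fix y assume "dist y x < 1 / 2 ^ n"
      then have "\<bar>y - x\<bar> * 2 ^ n < 1" by (simp add: dist_real_def less_divide_eq)
      from mass_cdf_uniform[OF this] show "dist (mass_cdf y) (mass_cdf x) < e"
        using n by (simp add: dist_real_def)
    qed simp
  qed
qed

lemma mass_cdf_below:
  assumes "x < real_of_int a"
  shows "mass_cdf x = 0"
proof -
  have "mass_below n x = 0" for n
  proof -
    have "2 ^ n * x < 2 ^ n * real_of_int a" using assms by (intro mult_strict_left_mono) auto
    then have "2 ^ n * x < real_of_int (a * 2 ^ n)" by (simp add: mult.commute)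
    then have "\<lfloor>2 ^ n * x\<rfloor> < a * 2 ^ n" by (subst floor_less_iff)
    then show ?thesis by (simp add: mass_below_def)
  qed
  then show ?thesis using mass_cdf(1)[of x] by (simp add: LIMSEQ_const_iff)
qed

lemma mass_cdf_above:
  assumes "real_of_int a + 1 \<le> x"
  shows "mass_cdf x = m 0 a"
proof -
  have f: "a + 1 \<le> \<lfloor>x\<rfloor>" using assms by linarith
  then have "(\<Sum>k\<in>{a..<\<lfloor>x\<rfloor>}. mass m a 0 k) = (\<Sum>k\<in>{a}. mass m a 0 k)"
    by (intro sum.mono_neutral_right) auto
  then have "mass_below 0 x = m 0 a" by (simp add: mass_below_def)
  then show ?thesis using mass_cdf(2)[of 0 x] mass_cdf(3)[of x 0] f by simp
qed

lemma frostman_measure_exists: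
  assumes one: "m 0 a = 1"
  obtains \<mu> where "real_distribution \<mu>" "\<And>n k. measure \<mu> (cell n k) \<le> m n k + m n (k + 1)"
proof
  define \<mu> where "\<mu> = interval_measure mass_cdf"
  have cont: "continuous (at_right x) mass_cdf" for x
    using mass_cdf_continuous by (simp add: continuous_on_eq_continuous_at continuous_at_imp_continuous_at_within)
  show rd: "real_distribution \<mu>"
    unfolding \<mu>_def
  proof (rule real_distribution_interval_measure[OF mass_cdf_mono cont])
    have "\<forall>\<^sub>F x in at_bot. mass_cdf x = 0"
      using eventually_gt_at_bot[of "real_of_int a"] by eventually_elim (rule mass_cdf_below)
    then show "(mass_cdf \<longlongrightarrow> 0) at_bot" by (rule tendsto_eventually)
    have "\<forall>\<^sub>F x in at_top. mass_cdf x = 1"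
      using eventually_ge_at_top[of "real_of_int a + 1"] by eventually_elim (simp add: mass_cdf_above one)
    then show "(mass_cdf \<longlongrightarrow> 1) at_top" by (rule tendsto_eventually)
  qed
  interpret real_distribution \<mu> by fact
  fix n k
  define u where "u = real_of_int k / 2 ^ n"
  define v where "v = real_of_int (k + 1) / 2 ^ n"
  have uv: "u \<le> v" by (simp add: u_def v_def divide_right_mono)
  have "cell n k \<subseteq> {u..v}"
    unfolding cell_def u_def v_def by (auto simp: divide_le_eq le_divide_eq mult.commute)
  then have "measure \<mu> (cell n k) \<le> measure \<mu> {u..v}"
    by (intro finite_measure_mono) auto
  also have "\<dots> = mass_cdf v - mass_cdf u"
    using emeasure_interval_measure_Icc[OF uv mass_cdf_mono mass_cdf_continuous] mass_cdf_mono[OF uv]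
    by (simp add: measure_def \<mu>_def)
  \<comment> \<open>The right endpoint v belongs to cell k + 1, so \<open>mass_cdf_step\<close>
    charges this neighbour as well.\<close>
  also have "\<dots> \<le> mass m a n k + mass m a n (k + 1)"
    using mass_cdf_step[of n v u] by (simp add: u_def v_def)
  also have "\<dots> \<le> m n k + m n (k + 1)" by (intro add_mono mass_le)
  finally show "measure \<mu> (cell n k) \<le> m n k + m n (k + 1)" .
qed

end

lemma cell_borel [measurable]: "cell n k \<in> sets borel"
  unfolding cell_def by measurable

text \<open>Mass is distributed according to the content of \<open>K\<close> in each cell, divided
  by the content of \<open>K\<close> to reach total mass 1. Closedness of \<open>K\<close> ensures
  full mass on \<open>K\<close>: the complement is covered by countably many null cells.\<close>

lemma frostman_closed:
  assumes K: "closed K" "K \<subseteq> cell 0 a" and pos: "0 < dyadic_content s K" and s: "0 < s"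
  obtains \<mu> C where "real_distribution \<mu>" "measure \<mu> K = 1"
    "\<And>n k. measure \<mu> (cell n k) \<le> C * 2 powr (- s * real n)"
proof -
  have fin: "dyadic_content s (K \<inter> cell n k) \<le> ennreal (2 powr (- s * real n))" for n k
    using content_mono[of "K \<inter> cell n k" "cell n k" s] content_cell_le[of s n k] by (auto intro: order_trans)
  then have fin': "dyadic_content s (K \<inter> cell n k) < \<top>" for n k
    by (rule le_less_trans) simp
  define c where "c = enn2real (dyadic_content s K)"
  have Ka: "K \<inter> cell 0 a = K" using K by blast
  have c: "0 < c" using fin'[of 0 a] pos unfolding Ka c_def by (simp add: enn2real_positive_iff)
  define m where "m n k = enn2real (dyadic_content s (K \<inter> cell n k)) / c" for n k
  have m0: "0 \<le> m n k" for n k using c by (simp add: m_def)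
  have sub: "m n k \<le> m (Suc n) (2 * k) + m (Suc n) (2 * k + 1)" for n k
  proof -
    have "K \<inter> cell n k \<subseteq> (K \<inter> cell (Suc n) (2 * k)) \<union> (K \<inter> cell (Suc n) (2 * k + 1))"
    proof
      fix x assume "x \<in> K \<inter> cell n k"
      moreover have "2 ^ Suc n * x = 2 * (2 ^ n * x)" by simp
      then have "\<lfloor>2 ^ Suc n * x\<rfloor> = 2 * \<lfloor>2 ^ n * x\<rfloor> \<or> \<lfloor>2 ^ Suc n * x\<rfloor> = 2 * \<lfloor>2 ^ n * x\<rfloor> + 1" by linarith
      ultimately show "x \<in> (K \<inter> cell (Suc n) (2 * k)) \<union> (K \<inter> cell (Suc n) (2 * k + 1))"
        by (auto simp: cell_def)
    qed
    then have "dyadic_content s (K \<inter> cell n k) \<le> dyadic_content s (K \<inter> cell (Suc n) (2 * k)) + dyadic_content s (K \<inter> cell (Suc n) (2 * k + 1))"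
      by (meson content_mono content_subadditive order_trans)
    then have "enn2real (dyadic_content s (K \<inter> cell n k)) \<le>
        enn2real (dyadic_content s (K \<inter> cell (Suc n) (2 * k)) + dyadic_content s (K \<inter> cell (Suc n) (2 * k + 1)))"
      using fin' by (intro enn2real_mono) auto
    also have "\<dots> = enn2real (dyadic_content s (K \<inter> cell (Suc n) (2 * k))) + enn2real (dyadic_content s (K \<inter> cell (Suc n) (2 * k + 1)))"
      using fin' by (intro enn2real_plus) auto
    finally show ?thesis using c by (simp add: m_def add_divide_distrib[symmetric] divide_right_mono)
  qed
  have upper: "m n k \<le> (1 / c) * 2 powr (- s * real n)" for n k
    using enn2real_mono[OF fin[of n k]] c by (simp add: m_def divide_right_mono)
  have one: "m 0 a = 1" using c unfolding m_def Ka c_def by simp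
  obtain \<mu> where \<mu>: "real_distribution \<mu>" and bnd: "\<And>n k. measure \<mu> (cell n k) \<le> m n k + m n (k + 1)"
    using frostman_measure_exists[OF m0 sub upper s one] by blast
  interpret real_distribution \<mu> by fact
  have "measure \<mu> (cell n k) \<le> (2 / c) * 2 powr (- s * real n)" for n k
    using bnd[of n k] upper[of n k] upper[of n "k + 1"] by simp
  moreover have "measure \<mu> K = 1"
  proof -
    define Z where "Z = {(n, k). measure \<mu> (cell n k) = 0}"
    have "- K \<subseteq> (\<Union>(n, k)\<in>Z. cell n k)"
    proof
      fix x assume "x \<in> - K"
      then obtain e where e: "0 < e" "ball x e \<subseteq> - K" using K(1) by (metis openE open_Compl)
      obtain n where n: "(1 / 2) ^ n < e / 2" using real_arch_pow_inv[of "e / 2" "1 / 2"] e by auto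
      define k where "k = \<lfloor>2 ^ n * x\<rfloor>"
      \<comment> \<open>The cell of x and its right neighbour must both miss \<open>K\<close>,
        because \<open>bnd\<close> estimates the measure of a cell by \<open>m\<close> at these
        two.\<close>
      have "K \<inter> cell n j = {}" if "j = k \<or> j = k + 1" for j
      proof -
        have "y \<notin> K" if "y \<in> cell n j" for y
        proof -
          have "\<bar>2 ^ n * y - 2 ^ n * x\<bar> < 2"
            using that \<open>j = k \<or> j = k + 1\<close> unfolding cell_def k_def by simp linarith
          then have "2 ^ n * \<bar>y - x\<bar> < 2" by (simp add: right_diff_distrib[symmetric] abs_mult)
          then have "\<bar>y - x\<bar> < 2 * (1 / 2) ^ n" by (simp add: field_simps)
          then have "y \<in> ball x e" using n by (simp add: dist_real_def)
          then show ?thesis using e by blast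
        qed
        then show ?thesis by blast
      qed
      then have "m n k = 0" "m n (k + 1) = 0" by (auto simp: m_def)
      then have "measure \<mu> (cell n k) = 0" using bnd[of n k] by (simp add: measure_le_0_iff)
      then have "(n, k) \<in> Z" "x \<in> cell n k" by (auto simp: Z_def cell_def k_def)
      then show "x \<in> (\<Union>(n, k)\<in>Z. cell n k)" by blast
    qed
    moreover have "(\<Union>(n, k)\<in>Z. cell n k) \<in> null_sets \<mu>"
      by (intro null_sets_UN') (auto simp: Z_def null_sets_def emeasure_eq_measure)
    ultimately have "- K \<in> null_sets \<mu>"
      by (rule null_sets_subset[rotated 2]) (use K in auto)
    then have "measure \<mu> (- K) = 0" by (simp add: measure_eq_0_null_sets)
    then show ?thesis using prob_compl[of K] K by (simp add: Compl_eq_Diff_UNIV)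
  qed
  ultimately show thesis using that \<mu> by blast
qed

section \<open>From content to Hausdorff measure\<close>

lemma cell_diameter: "bounded (cell n k)" "diameter (cell n k) \<le> 1 / 2 ^ n"
proof -
  have d: "dist x y \<le> 1 / 2 ^ n" if "x \<in> cell n k" "y \<in> cell n k" for x y
  proof -
    have "\<bar>2 ^ n * x - 2 ^ n * y\<bar> \<le> 1" using that unfolding cell_def by simp linarith
    then have "2 ^ n * \<bar>x - y\<bar> \<le> 1" by (simp add: right_diff_distrib[symmetric] abs_mult)
    then show ?thesis by (simp add: dist_real_def le_divide_eq mult.commute)
  qed
  show "bounded (cell n k)"
    using d cell_nonempty[of n k] by (meson bounded_any_center bounded_def)
  show "diameter (cell n k) \<le> 1 / 2 ^ n"
    using d cell_nonempty by (intro diameter_le) (auto simp: dist_norm)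
qed

text \<open>A cover that costs less than \<delta>^s cannot contain a cell longer than \<delta>. Thus
  cheap covers are automatically fine, and null content passes to the premeasure at every
  scale.\<close>

lemma hausdorff_measure_zero_of_content:
  assumes s: "0 < s" and 0: "dyadic_content s F = 0"
  shows "hausdorff_measure s F = 0"
proof -
  have "hausdorff_premeasure s \<delta> F \<le> ennreal e" if \<delta>: "0 < \<delta>" and e: "0 < e" for \<delta> e
  proof -
    define e' where "e' = min e (\<delta> powr s)"
    have "0 < e'" using e \<delta> by (simp add: e'_def)
    then have "dyadic_content s F < ennreal e'" using 0 by simp
    then obtain G where G: "F \<subseteq> cells G" "cost s G < ennreal e'" by (rule content_approx)
    \<comment> \<open>\<open>from_nat\<close> may take the same value at several numbers; the test
      with \<open>to_nat\<close> lists every cell exactly once.\<close>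
    define U where "U i = (if from_nat i \<in> G \<and> to_nat (from_nat i :: nat \<times> int) = i then case_prod cell (from_nat i) else {})" for i
    have small: "1 / 2 ^ n \<le> \<delta>" if "(n, k) \<in> G" for n k
    proof -
      have "ennreal (2 powr (- s * real n)) \<le> cost s G"
        unfolding cost_singleton[of s n k, symmetric] using that by (intro emeasure_mono) auto
      then have "ennreal (2 powr (- s * real n)) < ennreal e'" using G(2) by (rule le_less_trans)
      then have "2 powr (- s * real n) < \<delta> powr s" by (simp add: e'_def ennreal_less_iff)
      moreover have "2 powr (- s * real n) = (1 / 2 ^ n) powr s"
        by (simp add: powr_realpow[symmetric] powr_powr powr_divide powr_minus divide_simps mult.commute)
      ultimately have "(1 / 2 ^ n) powr s < \<delta> powr s" by simp
      then show ?thesis using s \<delta> by (meson less_imp_le not_less powr_mono2)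
    qed
    have "F \<subseteq> (\<Union>i. U i)"
    proof
      fix x assume "x \<in> F"
      then obtain n where n: "(n, \<lfloor>2 ^ n * x\<rfloor>) \<in> G" using G(1) by (auto simp: cells_def)
      have "x \<in> U (to_nat (n, \<lfloor>2 ^ n * x\<rfloor>))" using n by (simp add: U_def cell_def)
      then show "x \<in> (\<Union>i. U i)" by blast
    qed
    moreover have "bounded (U i) \<and> diameter (U i) \<le> \<delta>" for i
    proof (cases "U i = {}")
      case False
      then obtain n k where "(n, k) \<in> G" "U i = cell n k"
        by (cases "from_nat i :: nat \<times> int") (auto simp: U_def split: if_splits)
      then show ?thesis using cell_diameter[of n k] small[of n k] by simp
    qed (use \<delta> in \<open>simp add: diameter_def\<close>)
    ultimately have "hausdorff_premeasure s \<delta> F \<le> (\<Sum>i. ennreal (diam_power s (U i)))"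
      unfolding hausdorff_premeasure_def by (intro Inf_lower) auto
    also have "\<dots> \<le> (\<Sum>i. cost s (if from_nat i \<in> G \<and> to_nat (from_nat i :: nat \<times> int) = i then {from_nat i} else {}))"
    proof (intro suminf_le allI)
      fix i
      obtain n k where nk: "from_nat i = (n :: nat, k :: int)" by fastforce
      have "diam_power s (cell n k) \<le> (1 / 2 ^ n) powr s"
        using cell_diameter[of n k] s cell_nonempty[of n k] diameter_ge_0[OF cell_diameter(1)]
        by (auto simp: diam_power_def intro!: powr_mono2)
      also have "(1 / 2 ^ n) powr s = 2 powr (- s * real n)"
        by (simp add: powr_realpow[symmetric] powr_powr powr_divide powr_minus divide_simps mult.commute)
      finally show "ennreal (diam_power s (U i)) \<le>
          cost s (if from_nat i \<in> G \<and> to_nat (from_nat i :: nat \<times> int) = i then {from_nat i} else {})"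
        using nk by (auto simp: U_def diam_power_def[of _ "{}"] cost_singleton intro!: ennreal_leI)
    qed auto
    also have "\<dots> = cost s (\<Union>i. if from_nat i \<in> G \<and> to_nat (from_nat i :: nat \<times> int) = i then {from_nat i} else {})"
      by (intro suminf_emeasure) (auto simp: disjoint_family_on_def split: if_splits)
    also have "\<dots> \<le> cost s G" by (intro emeasure_mono) (auto split: if_splits)
    also have "\<dots> \<le> ennreal e'" using G(2) by simp
    also have "\<dots> \<le> ennreal e" by (intro ennreal_leI) (simp add: e'_def)
    finally show ?thesis .
  qed
  then have "hausdorff_premeasure s \<delta> F = 0" if "0 < \<delta>" for \<delta>
    using that by (metis ennreal_le_epsilon add_0 le_zero_eq)
  then show ?thesis
    unfolding hausdorff_measure_def by (auto intro!: SUP_eq_const)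
qed

theorem frostman:
  assumes F: "F \<in> sets borel" and s: "0 < s" and pos: "hausdorff_measure s F \<noteq> 0"
  obtains \<mu> C R where "real_distribution \<mu>" "measure \<mu> F = 1" "measure \<mu> {-R..R} = 1"
    "\<And>n k. measure \<mu> (cell n k) \<le> C * 2 powr (- s * real n)"
proof -
  have "dyadic_content s F \<noteq> 0" using hausdorff_measure_zero_of_content[OF s] pos by blast
  \<comment> \<open>Capacitability is available for bounded sets only. Some unit cell meets F in
    positive content, and working there also gives the measure bounded support.\<close>
  have "\<exists>i::nat. dyadic_content s (F \<inter> cell 0 (from_nat i)) \<noteq> 0"
  proof (rule ccontr)
    assume "\<not> ?thesis"
    moreover have "F = (\<Union>i::nat. F \<inter> cell 0 (from_nat i))"
      by (auto simp: cell_def) (metis from_nat_to_nat)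
    then have "dyadic_content s F \<le> (\<Sum>i. dyadic_content s (F \<inter> cell 0 (from_nat i)))"
      by (metis content_countable_subadditive)
    ultimately show False using \<open>dyadic_content s F \<noteq> 0\<close> by simp
  qed
  then obtain a where a: "dyadic_content s (F \<inter> cell 0 a) \<noteq> 0" by blast
  have sub: "cell 0 a \<subseteq> {real_of_int a..real_of_int a + 1}" unfolding cell_def by auto
  have pos': "0 < dyadic_content s (F \<inter> cell 0 a)" using a by (simp add: zero_less_iff_neq_zero)
  have "F \<inter> cell 0 a \<in> sets borel" using F by simp
  moreover have "F \<inter> cell 0 a \<subseteq> {real_of_int a..real_of_int a + 1}" using sub by blast
  ultimately obtain K where K: "closed K" "K \<subseteq> F \<inter> cell 0 a" "0 < dyadic_content s K"
    by (rule content_capacitable[OF _ _ pos'])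
  obtain \<mu> C where \<mu>: "real_distribution \<mu>" "measure \<mu> K = 1"
    and C: "\<And>n k. measure \<mu> (cell n k) \<le> C * 2 powr (- s * real n)"
    by (rule frostman_closed[OF K(1) _ K(3) s, of a]) (use K(2) in blast)+
  interpret real_distribution \<mu> by fact
  have full: "measure \<mu> A = 1" if "K \<subseteq> A" "A \<in> sets borel" for A
  proof (rule antisym[OF prob_le_1])
    show "1 \<le> measure \<mu> A" using finite_measure_mono[of K A] that \<mu>(2) by simp
  qed
  define R where "R = \<bar>real_of_int a\<bar> + 1"
  have "{real_of_int a..real_of_int a + 1} \<subseteq> {-R..R}" by (auto simp: R_def)
  then have "K \<subseteq> {-R..R}" "K \<subseteq> F" using K(2) sub by auto
  then show thesis using F by (intro that[OF \<mu>(1) _ _ C] full) auto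
qed

subsection \<open>Diffeomorphisms of class $C^{m+\alpha}$\<close>

text \<open>All derivatives up to order k are bounded on the whole line, which keeps the class
  closed under products and under reciprocals of functions bounded away from 0. For \<alpha> = 0 the
  Hoelder condition merely bounds the oscillation, so the same class covers that case.\<close>

fun holder_class :: "real \<Rightarrow> nat \<Rightarrow> (real \<Rightarrow> real) \<Rightarrow> bool" where
  "holder_class \<alpha> 0 g \<longleftrightarrow> continuous_on UNIV g \<and> (\<exists>B. \<forall>x. \<bar>g x\<bar> \<le> B) \<and> holder_continuous \<alpha> g"
| "holder_class \<alpha> (Suc k) g \<longleftrightarrow>
     (\<exists>B. \<forall>x. \<bar>g x\<bar> \<le> B) \<and> (\<exists>g'. (\<forall>x. (g has_real_derivative g' x) (at x)) \<and> holder_class \<alpha> k g')"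

lemma holder_class_bounded:
  assumes "holder_class \<alpha> k g"
  obtains B where "0 \<le> B" "\<And>x. \<bar>g x\<bar> \<le> B"
proof -
  obtain B where "\<And>x. \<bar>g x\<bar> \<le> B" using assms by (cases k) auto
  then show thesis by (intro that[of "max B 0"]) (auto simp: max.coboundedI1)
qed

lemma holder_class_continuous:
  assumes "holder_class \<alpha> k g"
  shows "continuous_on UNIV g"
proof (cases k)
  case (Suc l)
  then obtain g' where "\<And>x. (g has_real_derivative g' x) (at x)" using assms by auto
  then show ?thesis by (meson DERIV_continuous_on has_field_derivative_at_within)
qed (use assms in auto)

text \<open>The smaller of A and A L t is at most A (L t)^\<alpha>. At every level this turns a
  bound on the top derivative and one on its slope into a Hoelder bound.\<close>

lemma powr_interpolation:
  fixes d \<alpha> A L t :: real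
  assumes "0 \<le> \<alpha>" "\<alpha> \<le> 1" "0 < t" "0 \<le> A" "0 < L" "d \<le> A" "d \<le> A * (L * t)"
  shows "d \<le> A * L powr \<alpha> * t powr \<alpha>"
proof (cases "L * t \<le> 1")
  case True
  have "L * t = (L * t) powr 1" using assms by simp
  also have "\<dots> \<le> (L * t) powr \<alpha>" using True assms by (intro powr_mono') auto
  finally have "A * (L * t) \<le> A * (L * t) powr \<alpha>" using assms by (intro mult_left_mono) auto
  then show ?thesis using assms by (simp add: powr_mult mult.assoc)
next
  case False
  have "1 \<le> (L * t) powr \<alpha>" using False assms by (intro ge_one_powr_ge_zero) auto
  then have "A * 1 \<le> A * (L * t) powr \<alpha>" using assms by (intro mult_left_mono) auto
  then show ?thesis using assms by (simp add: powr_mult mult.assoc)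
qed

lemma lipschitz_of_derivative:
  fixes g g' :: "real \<Rightarrow> real"
  assumes "\<And>x. (g has_real_derivative g' x) (at x)" "\<And>x. \<bar>g' x\<bar> \<le> L"
  shows "\<bar>g y - g x\<bar> \<le> L * \<bar>y - x\<bar>"
  using field_differentiable_bound[of UNIV g g' L y x] assms by auto

text \<open>The derivative controls differences at short distances and boundedness controls them at
  long ones; this is where \<alpha> \<le> 1 enters.\<close>

lemma holder_class_mono:
  assumes "0 \<le> \<alpha>" "\<alpha> \<le> 1"
  shows "holder_class \<alpha> (Suc k) g \<Longrightarrow> holder_class \<alpha> k g"
proof (induction k arbitrary: g)
  case 0
  then obtain B g' where B: "\<And>x. \<bar>g x\<bar> \<le> B" and g': "\<And>x. (g has_real_derivative g' x) (at x)"
    and hg': "holder_class \<alpha> 0 g'" by auto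
  obtain L where L: "0 \<le> L" "\<And>x. \<bar>g' x\<bar> \<le> L" using holder_class_bounded[OF hg'] by blast
  have "\<bar>g y - g x\<bar> \<le> (2 * B + L + 1) * \<bar>y - x\<bar> powr \<alpha>" for x y
  proof (cases "x = y")
    case False
    have lip: "\<bar>g y - g x\<bar> \<le> L * \<bar>y - x\<bar>" by (rule lipschitz_of_derivative[OF g' L(2)])
    have B0: "0 \<le> B" using B[of 0] by linarith
    have "\<bar>g y - g x\<bar> \<le> 2 * B + L + 1" using B[of x] B[of y] L by linarith
    moreover have "\<bar>g y - g x\<bar> \<le> (2 * B + L + 1) * (1 * \<bar>y - x\<bar>)"
      using lip mult_right_mono[of L "2 * B + L + 1" "\<bar>y - x\<bar>"] B0 by simp
    ultimately show ?thesis
      using powr_interpolation[of \<alpha> "\<bar>y - x\<bar>" "2 * B + L + 1" 1 "\<bar>g y - g x\<bar>"] assms False B0 L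
      by simp
  qed simp
  then have "holder_continuous \<alpha> g" unfolding holder_continuous_def by blast
  moreover have "continuous_on UNIV g" using 0 by (rule holder_class_continuous)
  ultimately show ?case using B by auto
next
  case (Suc k)
  then show ?case using holder_class.simps(2) by blast
qed

lemma holder_class_const: "holder_class \<alpha> k (\<lambda>_. c)"
proof (induction k arbitrary: c)
  case 0
  have "holder_continuous \<alpha> (\<lambda>_. c)" by (auto simp: holder_continuous_def intro!: exI[of _ 0])
  then show ?case by auto
next
  case (Suc k)
  have "((\<lambda>_. c) has_real_derivative 0) (at x)" for x by simp
  then show ?case using Suc[of 0] unfolding holder_class.simps by (meson order_refl)
qed

lemma holder_class_add:
  "holder_class \<alpha> k f \<Longrightarrow> holder_class \<alpha> k g \<Longrightarrow> holder_class \<alpha> k (\<lambda>x. f x + g x)"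
proof (induction k arbitrary: f g)
  case 0
  obtain A B where A: "\<And>x. \<bar>f x\<bar> \<le> A" and B: "\<And>x. \<bar>g x\<bar> \<le> B" using 0 by auto
  obtain K L where K: "\<And>x y. \<bar>f y - f x\<bar> \<le> K * \<bar>y - x\<bar> powr \<alpha>"
    and L: "\<And>x y. \<bar>g y - g x\<bar> \<le> L * \<bar>y - x\<bar> powr \<alpha>"
    using 0 unfolding holder_class.simps holder_continuous_def by blast
  have "\<bar>(f y + g y) - (f x + g x)\<bar> \<le> (K + L) * \<bar>y - x\<bar> powr \<alpha>" for x y
    using K[where x=x and y=y] L[where x=x and y=y] by (simp add: distrib_right)
  then have "holder_continuous \<alpha> (\<lambda>x. f x + g x)" unfolding holder_continuous_def by blast
  moreover have "\<bar>f x + g x\<bar> \<le> A + B" for x using A[of x] B[of x] by linarith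
  ultimately show ?case using 0 by (auto intro!: continuous_intros)
next
  case (Suc k)
  obtain A B where A: "\<And>x. \<bar>f x\<bar> \<le> A" and B: "\<And>x. \<bar>g x\<bar> \<le> B" using Suc.prems by auto
  obtain f' g' where f': "\<And>x. (f has_real_derivative f' x) (at x)" "holder_class \<alpha> k f'"
    and g': "\<And>x. (g has_real_derivative g' x) (at x)" "holder_class \<alpha> k g'"
    using Suc.prems by auto
  have "((\<lambda>x. f x + g x) has_real_derivative f' x + g' x) (at x)" for x
    by (intro derivative_intros f' g')
  moreover have "holder_class \<alpha> k (\<lambda>x. f' x + g' x)" using Suc.IH f' g' by blast
  moreover have "\<bar>f x + g x\<bar> \<le> A + B" for x using A[of x] B[of x] by linarith
  ultimately show ?case unfolding holder_class.simps by (intro conjI exI allI)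
qed

lemma holder_class_mult:
  assumes \<alpha>: "0 \<le> \<alpha>" "\<alpha> \<le> 1"
  shows "holder_class \<alpha> k f \<Longrightarrow> holder_class \<alpha> k g \<Longrightarrow> holder_class \<alpha> k (\<lambda>x. f x * g x)"
proof (induction k arbitrary: f g)
  case 0
  obtain A where A: "0 \<le> A" "\<And>x. \<bar>f x\<bar> \<le> A" using holder_class_bounded[OF 0(1)] by blast
  obtain B where B: "0 \<le> B" "\<And>x. \<bar>g x\<bar> \<le> B" using holder_class_bounded[OF 0(2)] by blast
  obtain K L where K: "\<And>x y. \<bar>f y - f x\<bar> \<le> K * \<bar>y - x\<bar> powr \<alpha>"
    and L: "\<And>x y. \<bar>g y - g x\<bar> \<le> L * \<bar>y - x\<bar> powr \<alpha>"
    using 0 unfolding holder_class.simps holder_continuous_def by blast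
  have "\<bar>f y * g y - f x * g x\<bar> \<le> (A * L + B * K) * \<bar>y - x\<bar> powr \<alpha>" for x y
  proof -
    have "f y * g y - f x * g x = f y * (g y - g x) + g x * (f y - f x)" by (simp add: algebra_simps)
    then have "\<bar>f y * g y - f x * g x\<bar> \<le> \<bar>f y\<bar> * \<bar>g y - g x\<bar> + \<bar>g x\<bar> * \<bar>f y - f x\<bar>"
      by (metis abs_mult abs_triangle_ineq)
    also have "\<dots> \<le> A * (L * \<bar>y - x\<bar> powr \<alpha>) + B * (K * \<bar>y - x\<bar> powr \<alpha>)"
      using A B K L by (intro add_mono mult_mono) auto
    finally show ?thesis by (simp add: algebra_simps)
  qed
  then have "holder_continuous \<alpha> (\<lambda>x. f x * g x)" unfolding holder_continuous_def by blast
  moreover have "\<bar>f x * g x\<bar> \<le> A * B" for x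
    using A B by (simp add: abs_mult mult_mono)
  ultimately show ?case using 0 by (auto intro!: continuous_intros)
next
  case (Suc k)
  obtain A where A: "0 \<le> A" "\<And>x. \<bar>f x\<bar> \<le> A" using holder_class_bounded[OF Suc.prems(1)] by blast
  obtain B where B: "0 \<le> B" "\<And>x. \<bar>g x\<bar> \<le> B" using holder_class_bounded[OF Suc.prems(2)] by blast
  obtain f' g' where f': "\<And>x. (f has_real_derivative f' x) (at x)" "holder_class \<alpha> k f'"
    and g': "\<And>x. (g has_real_derivative g' x) (at x)" "holder_class \<alpha> k g'"
    using Suc.prems by auto
  have "((\<lambda>x. f x * g x) has_real_derivative f' x * g x + g' x * f x) (at x)" for x
    by (intro DERIV_mult f' g')
  moreover have "holder_class \<alpha> k (\<lambda>x. f' x * g x + g' x * f x)"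
    by (rule holder_class_add[OF Suc.IH[OF f'(2) holder_class_mono[OF \<alpha> Suc.prems(2)]]
          Suc.IH[OF g'(2) holder_class_mono[OF \<alpha> Suc.prems(1)]]])
  moreover have "\<bar>f x * g x\<bar> \<le> A * B" for x
    using A B by (simp add: abs_mult mult_mono)
  ultimately show ?case unfolding holder_class.simps by (intro conjI exI allI)
qed

lemma holder_class_inverse:
  assumes \<alpha>: "0 \<le> \<alpha>" "\<alpha> \<le> 1" and c: "0 < c"
  shows "holder_class \<alpha> k f \<Longrightarrow> (\<And>x. c \<le> f x) \<Longrightarrow> holder_class \<alpha> k (\<lambda>x. inverse (f x))"
proof (induction k arbitrary: f)
  case 0
  have pos: "0 < f x" for x using 0(2)[of x] c by linarith
  obtain K where K: "\<And>x y. \<bar>f y - f x\<bar> \<le> K * \<bar>y - x\<bar> powr \<alpha>"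
    using 0 unfolding holder_class.simps holder_continuous_def by blast
  have "\<bar>inverse (f y) - inverse (f x)\<bar> \<le> (K * inverse (c * c)) * \<bar>y - x\<bar> powr \<alpha>" for x y
  proof -
    have "\<bar>inverse (f y) - inverse (f x)\<bar> = \<bar>f y - f x\<bar> * inverse (f y * f x)"
      using pos[of x] pos[of y] by (simp add: inverse_diff_inverse abs_mult)
    also have "\<dots> \<le> (K * \<bar>y - x\<bar> powr \<alpha>) * inverse (c * c)"
      using K[of y x] 0(2) c pos
      by (intro mult_mono le_imp_inverse_le) (auto intro!: mult_mono less_imp_le)
    finally show ?thesis by (simp add: algebra_simps)
  qed
  then have "holder_continuous \<alpha> (\<lambda>x. inverse (f x))" unfolding holder_continuous_def by blast
  moreover have "\<bar>inverse (f x)\<bar> \<le> inverse c" for x using 0(2)[of x] c pos[of x] by (simp add: le_imp_inverse_le)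
  moreover have "continuous_on UNIV (\<lambda>x. inverse (f x))"
    using 0 pos by (intro continuous_on_inverse) (auto simp: less_imp_neq[OF pos, symmetric])
  ultimately show ?case by auto
next
  case (Suc k)
  have pos: "0 < f x" for x using Suc.prems(2)[of x] c by linarith
  obtain f' where f': "\<And>x. (f has_real_derivative f' x) (at x)" "holder_class \<alpha> k f'"
    using Suc.prems by auto
  have "((\<lambda>x. inverse (f x)) has_real_derivative (-1) * (f' x * (inverse (f x) * inverse (f x)))) (at x)" for x
    using DERIV_inverse_fun[OF f'(1)[of x]] pos[of x] by (simp add: power2_eq_square divide_inverse)
  moreover have inv: "holder_class \<alpha> k (\<lambda>x. inverse (f x))"
    by (rule Suc.IH[OF holder_class_mono[OF \<alpha> Suc.prems(1)] Suc.prems(2)])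
  have "holder_class \<alpha> k (\<lambda>x. (-1) * (f' x * (inverse (f x) * inverse (f x))))"
    by (rule holder_class_mult[OF \<alpha> holder_class_const
          holder_class_mult[OF \<alpha> f'(2) holder_class_mult[OF \<alpha> inv inv]]])
  moreover have "\<bar>inverse (f x)\<bar> \<le> inverse c" for x
    using Suc.prems(2)[of x] c pos[of x] by (simp add: le_imp_inverse_le)
  ultimately show ?case unfolding holder_class.simps by (intro conjI exI allI)
qed

text \<open>The inner function will be an inverse diffeomorphism, which is unbounded, so the
  hypotheses concern its derivative. They ask for one order less than \<open>u\<close> has, which
  permits bootstrapping.\<close>

lemma holder_class_compose:
  assumes \<alpha>: "0 \<le> \<alpha>" "\<alpha> \<le> 1" and g: "\<And>x. (g has_real_derivative g' x) (at x)" "\<And>x. \<bar>g' x\<bar> \<le> L"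
  shows "holder_class \<alpha> k u \<Longrightarrow> (\<And>l. k = Suc l \<Longrightarrow> holder_class \<alpha> l g') \<Longrightarrow> holder_class \<alpha> k (\<lambda>x. u (g x))"
proof (induction k arbitrary: u)
  case 0
  obtain A where A: "0 \<le> A" "\<And>x. \<bar>u x\<bar> \<le> A" using holder_class_bounded[OF 0(1)] by blast
  obtain K where K: "\<And>x y. \<bar>u y - u x\<bar> \<le> K * \<bar>y - x\<bar> powr \<alpha>"
    using 0 unfolding holder_class.simps holder_continuous_def by blast
  have L: "0 \<le> L" using g(2)[of 0] by linarith
  have "\<bar>u (g y) - u (g x)\<bar> \<le> (\<bar>K\<bar> * L powr \<alpha>) * \<bar>y - x\<bar> powr \<alpha>" for x y
  proof (cases "g x = g y")
    case True
    then show ?thesis by simp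
  next
    case False
    have "\<bar>u (g y) - u (g x)\<bar> \<le> \<bar>K\<bar> * \<bar>g y - g x\<bar> powr \<alpha>"
      using K[where x="g x" and y="g y"] mult_right_mono[of K "\<bar>K\<bar>" "\<bar>g y - g x\<bar> powr \<alpha>"]
      by (meson abs_ge_self order_trans powr_ge_zero)
    also have "\<dots> \<le> \<bar>K\<bar> * (L * \<bar>y - x\<bar>) powr \<alpha>"
      using lipschitz_of_derivative[OF g] \<alpha> by (intro mult_left_mono powr_mono2) auto
    finally show ?thesis using L by (simp add: powr_mult mult.assoc)
  qed
  then have "holder_continuous \<alpha> (\<lambda>x. u (g x))" unfolding holder_continuous_def by blast
  moreover have "continuous_on UNIV (\<lambda>x. u (g x))"
    using 0 g by (intro continuous_on_compose2[of UNIV u UNIV g])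
      (auto intro!: continuous_at_imp_continuous_on DERIV_isCont)
  ultimately show ?case using A by auto
next
  case (Suc k)
  obtain A where A: "0 \<le> A" "\<And>x. \<bar>u x\<bar> \<le> A" using holder_class_bounded[OF Suc.prems(1)] by blast
  obtain u' where u': "\<And>x. (u has_real_derivative u' x) (at x)" "holder_class \<alpha> k u'"
    using Suc.prems by auto
  have g'k: "holder_class \<alpha> k g'" using Suc.prems by blast
  have "((\<lambda>x. u (g x)) has_real_derivative u' (g x) * g' x) (at x)" for x
    by (rule DERIV_chain2[OF u'(1) g(1)])
  moreover have "holder_class \<alpha> k (\<lambda>x. u' (g x) * g' x)"
    using g'k u'(2) holder_class_mono[OF \<alpha>]
    by (intro holder_class_mult[OF \<alpha>] Suc.IH) auto
  ultimately show ?case using A unfolding holder_class.simps by (intro conjI exI allI) auto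
qed

lemma holder_class_deriv:
  "holder_class \<alpha> k g \<Longrightarrow> times_cont_differentiable k g \<and> holder_continuous \<alpha> ((deriv ^^ k) g)"
proof (induction k arbitrary: g)
  case 0
  then show ?case by (simp add: times_cont_differentiable_def)
next
  case (Suc k)
  then obtain g' where g': "\<And>x. (g has_real_derivative g' x) (at x)" "holder_class \<alpha> k g'" by auto
  have d: "deriv g = g'" using g'(1) by (auto intro!: DERIV_imp_deriv)
  have "g differentiable_on UNIV"
    using g'(1) by (meson differentiable_at_withinI differentiable_on_def real_differentiable_def)
  then show ?case
    using Suc.IH[OF g'(2)]
    by (auto simp: times_cont_differentiable_def d funpow_Suc_right less_Suc_eq_0_disj simp del: funpow.simps)
qed

lemma times_cont_differentiable_Suc:
  assumes "\<And>x. (f has_real_derivative f' x) (at x)" "holder_class \<alpha> k f'"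
  shows "times_cont_differentiable (Suc k) f \<and> holder_continuous \<alpha> ((deriv ^^ Suc k) f)"
proof -
  have d: "deriv f = f'" using assms(1) by (auto intro!: DERIV_imp_deriv)
  have "f differentiable_on UNIV"
    using assms(1) by (meson differentiable_at_withinI differentiable_on_def real_differentiable_def)
  then show ?thesis
    using holder_class_deriv[OF assms(2)]
    by (auto simp: times_cont_differentiable_def d funpow_Suc_right less_Suc_eq_0_disj simp del: funpow.simps)
qed

text \<open>The uniform lower bound c makes f surjective and the derivative of its inverse bounded
  by 1/c.\<close>

lemma diffeomorphism_of_derivative:
  assumes \<alpha>: "0 \<le> \<alpha>" "\<alpha> \<le> 1" and c: "0 < c"
    and f: "\<And>x. (f has_real_derivative f' x) (at x)" "holder_class \<alpha> k f'" "\<And>x. c \<le> f' x"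
  shows "diffeomorphism (Suc k) \<alpha> f"
proof -
  have cont: "continuous_on UNIV f"
    using f(1) by (auto intro!: continuous_at_imp_continuous_on DERIV_isCont)
  have mono: "c * (y - x) \<le> f y - f x" if "x \<le> y" for x y
  proof -
    have "f x - c * x \<le> f y - c * y"
    proof (rule DERIV_nonneg_imp_nondecreasing[OF that])
      fix z
      have "((\<lambda>x. f x - c * x) has_real_derivative f' z - c) (at z)"
        by (auto intro!: derivative_eq_intros f(1))
      then show "\<exists>y. ((\<lambda>x. f x - c * x) has_real_derivative y) (at z) \<and> 0 \<le> y"
        using f(3)[of z] by (intro exI conjI) auto
    qed
    then show ?thesis by (simp add: algebra_simps)
  qed
  have sm: "f x < f y" if "x < y" for x y
    using mono[of x y] mult_pos_pos[OF c, of "y - x"] that by simp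
  then have inj: "inj f" by (intro linorder_injI) (auto simp: less_imp_neq)
  have surj: "surj f"
  unfolding surj_def
  proof
    fix y
    define r where "r = \<bar>y - f 0\<bar> / c"
    have r: "0 \<le> r" "c * r = \<bar>y - f 0\<bar>" using c by (auto simp: r_def)
    have "f (-r) \<le> y" using mono[of "-r" 0] r by (simp add: algebra_simps, linarith?)
    moreover have "y \<le> f r" using mono[of 0 r] r by (simp, linarith?)
    ultimately have "\<exists>x\<ge>-r. x \<le> r \<and> f x = y"
      using r cont by (intro IVT') (auto intro: continuous_on_subset)
    then show "\<exists>x. y = f x" by blast
  qed
  have bij: "bij f" using inj surj by (simp add: bij_def)
  define g where "g = inv f"
  have fg: "f (g y) = y" for y using surj by (simp add: g_def surj_f_inv_f)
  have gf: "g (f x) = x" for x using inj by (simp add: g_def)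
  have gcont: "isCont g y" for y
  proof -
    have "isCont g (f (g y))"
      by (rule isCont_inverse_function[of 1]) (use gf cont in \<open>auto simp: continuous_on_eq_continuous_at\<close>)
    then show ?thesis by (simp add: fg)
  qed
  have pos: "0 < f' x" for x using f(3)[of x] c by linarith
  have g': "(g has_real_derivative inverse (f' (g y))) (at y)" for y
  proof (rule DERIV_inverse_function[where a="y - 1" and b="y + 1"])
    show "(f has_real_derivative f' (g y)) (at (g y))" by (rule f(1))
    show "f' (g y) \<noteq> 0" using pos[of "g y"] by simp
  qed (auto simp: fg gcont)
  have bnd: "\<bar>inverse (f' (g y))\<bar> \<le> inverse c" for y
    using f(3)[of "g y"] c pos[of "g y"] by (simp add: le_imp_inverse_le)
  have inv: "holder_class \<alpha> k (\<lambda>x. inverse (f' x))"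
    by (rule holder_class_inverse[OF \<alpha> c f(2,3)])
  have dec: "holder_class \<alpha> j (\<lambda>x. inverse (f' x))" if "j \<le> k" for j
    using that inv by (induction rule: inc_induct) (use holder_class_mono[OF \<alpha>] in blast)+
  \<comment> \<open>Bootstrap with g' = (1/f') composed with g: if g' has class j, then
    \<open>holder_class_compose\<close> gives the right-hand side class j + 1, as long as 1/f' has
    it.\<close>
  have "holder_class \<alpha> j (\<lambda>y. inverse (f' (g y)))" if "j \<le> k" for j
    using that
  proof (induction j)
    case 0
    show ?case by (rule holder_class_compose[OF \<alpha> g' bnd dec[OF 0]]) auto
  next
    case (Suc j)
    show ?case using Suc by (intro holder_class_compose[OF \<alpha> g' bnd dec[OF Suc.prems]]) auto
  qed
  then show ?thesis
    using times_cont_differentiable_Suc[OF f(1,2)] times_cont_differentiable_Suc[of g, OF g', of \<alpha> k] bij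
    unfolding diffeomorphism_def g_def by auto
qed

section \<open>Termwise differentiation of series\<close>

lemma has_derivative_suminf:
  fixes T0 T1 :: "nat \<Rightarrow> real \<Rightarrow> real"
  assumes M: "summable M"
    and T: "\<And>l x. (T0 l has_real_derivative T1 l x) (at x)" "\<And>l x. \<bar>T0 l x\<bar> \<le> M l" "\<And>l x. \<bar>T1 l x\<bar> \<le> M l"
  shows "((\<lambda>x. \<Sum>l. T0 l x) has_real_derivative (\<Sum>l. T1 l x)) (at x)"
proof (rule has_field_derivative_series'(2)[of UNIV])
  show "uniformly_convergent_on UNIV (\<lambda>n x. \<Sum>l<n. T1 l x)"
    unfolding uniformly_convergent_on_def
    by (rule exI, rule Weierstrass_m_test[OF _ M]) (use T(3) in auto)
  show "summable (\<lambda>l. T0 l 0)"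
    by (rule summable_comparison_test'[OF M]) (use T(2) in auto)
qed (use T(1) in auto)

text \<open>\<open>T i l\<close> stands for the i-th derivative of the l-th summand. Carrying the
  whole array lets the induction pass to the array shifted by one derivative.\<close>

lemma holder_class_suminf:
  assumes M: "summable M" and M0: "\<And>l. 0 \<le> M l"
  shows "(\<And>i l x. i < k \<Longrightarrow> (T i l has_real_derivative T (Suc i) l x) (at x)) \<Longrightarrow>
    (\<And>i l x. i \<le> k \<Longrightarrow> \<bar>T i l x\<bar> \<le> M l) \<Longrightarrow> (\<And>l. continuous_on UNIV (T k l)) \<Longrightarrow>
    (\<And>l x y. \<bar>T k l y - T k l x\<bar> \<le> M l * \<bar>y - x\<bar> powr \<alpha>) \<Longrightarrow>
    holder_class \<alpha> k (\<lambda>x. \<Sum>l::nat. T 0 l x)"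
proof (induction k arbitrary: T)
  case 0
  have sm: "summable (\<lambda>l. T 0 l x)" for x
    by (rule summable_comparison_test'[OF M]) (use 0(2) in auto)
  have "\<bar>\<Sum>l. T 0 l x\<bar> \<le> suminf M" for x
    using norm_suminf_le[of "\<lambda>l. T 0 l x" M] 0(2) M by auto
  moreover have "\<bar>(\<Sum>l. T 0 l y) - (\<Sum>l. T 0 l x)\<bar> \<le> suminf M * \<bar>y - x\<bar> powr \<alpha>" for x y
  proof -
    have "(\<Sum>l. T 0 l y) - (\<Sum>l. T 0 l x) = (\<Sum>l. T 0 l y - T 0 l x)"
      using sm by (intro suminf_diff) auto
    moreover have "norm (\<Sum>l. T 0 l y - T 0 l x) \<le> (\<Sum>l. M l * \<bar>y - x\<bar> powr \<alpha>)"
      using 0(4) M by (intro norm_suminf_le summable_mult2) auto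
    ultimately show ?thesis using suminf_mult2[OF M] by simp
  qed
  moreover have "continuous_on UNIV (\<lambda>x. \<Sum>l. T 0 l x)"
  proof (rule uniform_limit_theorem)
    show "uniform_limit UNIV (\<lambda>n x. \<Sum>l<n. T 0 l x) (\<lambda>x. \<Sum>l. T 0 l x) sequentially"
      using 0(2) M by (intro Weierstrass_m_test) auto
    show "\<forall>\<^sub>F n in sequentially. continuous_on UNIV (\<lambda>x. \<Sum>l<n. T 0 l x)"
      using 0(3) by (intro always_eventually allI continuous_on_sum) auto
  qed simp
  ultimately show ?case unfolding holder_class.simps holder_continuous_def by blast
next
  case (Suc k)
  have sm: "summable (\<lambda>l. T 0 l x)" for x
    by (rule summable_comparison_test'[OF M]) (use Suc.prems(2)[of 0] in auto)
  have "\<bar>\<Sum>l. T 0 l x\<bar> \<le> suminf M" for x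
    using norm_suminf_le[of "\<lambda>l. T 0 l x" M] Suc.prems(2)[of 0] M by auto
  moreover have "((\<lambda>x. \<Sum>l. T 0 l x) has_real_derivative (\<Sum>l. T 1 l x)) (at x)" for x
    by (rule has_derivative_suminf[OF M]) (use Suc.prems(1)[of 0] Suc.prems(2)[of 0] Suc.prems(2)[of 1] in auto)
  moreover have "holder_class \<alpha> k (\<lambda>x. \<Sum>l. T (Suc 0) l x)"
    by (rule Suc.IH[of "\<lambda>i. T (Suc i)"]) (use Suc.prems in auto)
  ultimately show ?case unfolding holder_class.simps One_nat_def by meson
qed


section \<open>Polynomial bumps and the perturbed identity\<close>

lemma pderiv_funpow_power_dvd:
  fixes w :: "real poly"
  shows "\<exists>r. (pderiv ^^ i) (w ^ (i + n)) = w ^ n * r"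
proof (induction i arbitrary: n)
  case 0
  then show ?case by (intro exI[of _ 1]) simp
next
  case (Suc i)
  from Suc[of "Suc n"] obtain r where r: "(pderiv ^^ i) (w ^ (i + Suc n)) = w ^ Suc n * r" by blast
  have "(pderiv ^^ Suc i) (w ^ (Suc i + n)) = pderiv (w ^ Suc n * r)" using r by simp
  also have "\<dots> = w ^ n * (smult (of_nat (Suc n)) (pderiv w * r) + w * pderiv r)"
    by (simp only: pderiv_mult pderiv_power_Suc) (simp add: algebra_simps smult_add_right)
  finally show ?case by blast
qed

lemma poly_bounded_unit:
  fixes p :: "real poly"
  obtains B where "0 \<le> B" "\<And>t. t \<in> {0..1} \<Longrightarrow> \<bar>poly p t\<bar> \<le> B"
proof -
  have "compact (poly p ` {0..1})"
    by (intro compact_continuous_image continuous_intros) auto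
  then obtain B where "\<And>t. t \<in> {0..1} \<Longrightarrow> \<bar>poly p t\<bar> \<le> B"
    by (fastforce dest: compact_imp_bounded simp: bounded_iff)
  then show thesis by (intro that[of "max B 0"]) (auto intro: max.coboundedI1)
qed

definition bump :: "real poly \<Rightarrow> (int \<Rightarrow> real) \<Rightarrow> real \<Rightarrow> real" where
  "bump p c y = c \<lfloor>y\<rfloor> * poly p (frac y)"

text \<open>At an integer the factor t^2 (1 - t)^2 gives a bound quadratic in the distance, so the
  derivative there is 0 whatever the coefficients of the two adjacent cells are. Elsewhere the
  function is locally a single polynomial.\<close>

lemma bump_has_derivative:
  assumes c: "\<And>k. \<bar>c k\<bar> \<le> C" and q: "q = [:0, 1, -1:] ^ 2 * r"
  shows "(bump q c has_real_derivative bump (pderiv q) c y) (at y)"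
proof (cases "y \<in> \<int>")
  case True
  then obtain k where y: "y = of_int k" by (elim Ints_cases)
  obtain R where R: "0 \<le> R" "\<And>t. t \<in> {0..1} \<Longrightarrow> \<bar>poly r t\<bar> \<le> R" using poly_bounded_unit by blast
  have C0: "0 \<le> C" using c[of 0] by linarith
  have q0: "poly q 0 = 0" "poly (pderiv q) 0 = 0"
    by (simp_all add: q power2_eq_square pderiv_mult pderiv_pCons)
  have est: "\<bar>bump q c z\<bar> \<le> C * R * \<bar>z - y\<bar> * \<bar>z - y\<bar>" if z: "\<bar>z - y\<bar> < 1" for z
  proof -
    define t where "t = frac z"
    have t: "0 \<le> t" "t < 1" by (auto simp: t_def frac_lt_1)
    have "t * (1 - t) \<le> \<bar>z - y\<bar>"
    proof (cases "y \<le> z")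
      case True
      then have "\<lfloor>z\<rfloor> = k" using z y by linarith
      then have "t = \<bar>z - y\<bar>" using True y by (simp add: t_def frac_def)
      then show ?thesis using t by (simp add: mult_left_le)
    next
      case False
      then have "\<lfloor>z\<rfloor> = k - 1" using z y by linarith
      then have "1 - t = \<bar>z - y\<bar>" using False y by (simp add: t_def frac_def)
      then show ?thesis using t by (simp add: mult_left_le_one_le)
    qed
    moreover have "\<bar>t - t * t\<bar> = t * (1 - t)"
    proof -
      have "t * t \<le> t" using t by (simp add: mult_left_le)
      moreover have "t * (1 - t) = t - t * t" by (simp add: algebra_simps)
      ultimately show ?thesis by linarith
    qed
    ultimately have w: "\<bar>t - t * t\<bar> \<le> \<bar>z - y\<bar>" by simp
    have "poly [:0, 1, -1:] t = t - t * t" by (simp add: algebra_simps)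
    then have "poly q t = (t - t * t) * (t - t * t) * poly r t"
      by (simp only: q poly_mult power2_eq_square)
    then have "\<bar>bump q c z\<bar> = \<bar>c \<lfloor>z\<rfloor>\<bar> * (\<bar>t - t * t\<bar> * \<bar>t - t * t\<bar> * \<bar>poly r t\<bar>)"
      by (simp only: bump_def t_def[symmetric] abs_mult)
    also have "\<dots> \<le> C * (\<bar>z - y\<bar> * \<bar>z - y\<bar> * R)"
      using w c R C0 t by (intro mult_mono) auto
    finally show ?thesis by (simp add: mult_ac)
  qed
  have "((\<lambda>z. (bump q c z - bump q c y) / (z - y)) \<longlongrightarrow> 0) (at y)"
  proof (rule Lim_null_comparison)
    show "((\<lambda>z. C * R * \<bar>z - y\<bar>) \<longlongrightarrow> 0) (at y)"
      by (auto intro!: tendsto_eq_intros)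
    have "\<forall>\<^sub>F z in at y. dist z y < 1" by (rule eventually_at_ball'[of 1 y UNIV, simplified, THEN eventually_mono]) (auto simp: dist_commute)
    then show "\<forall>\<^sub>F z in at y. norm ((bump q c z - bump q c y) / (z - y)) \<le> C * R * \<bar>z - y\<bar>"
    proof (eventually_elim)
      case (elim z)
      have "bump q c y = 0" using y q0 by (simp add: bump_def)
      then show ?case
        using est[of z] elim R C0 by (cases "z = y") (auto simp: dist_real_def divide_le_eq)
    qed
  qed
  then show ?thesis using y q0 by (simp add: has_field_derivative_iff bump_def)
next
  case False
  have ev: "\<forall>z\<in>{of_int \<lfloor>y\<rfloor><..<of_int \<lfloor>y\<rfloor> + 1}. c \<lfloor>y\<rfloor> * poly q (z - of_int \<lfloor>y\<rfloor>) = bump q c z"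
  proof
    fix z :: real assume "z \<in> {of_int \<lfloor>y\<rfloor><..<of_int \<lfloor>y\<rfloor> + 1}"
    then have "\<lfloor>z\<rfloor> = \<lfloor>y\<rfloor>" by (intro floor_unique) auto
    then show "c \<lfloor>y\<rfloor> * poly q (z - of_int \<lfloor>y\<rfloor>) = bump q c z" by (simp add: bump_def frac_def)
  qed
  have "of_int \<lfloor>y\<rfloor> \<noteq> y" using False by (metis Ints_of_int)
  then have yin: "y \<in> {of_int \<lfloor>y\<rfloor><..<of_int \<lfloor>y\<rfloor> + 1}"
    using of_int_floor_le[of y] floor_correct[of y] by (simp add: less_le)
  have "((\<lambda>z. c \<lfloor>y\<rfloor> * poly q (z - of_int \<lfloor>y\<rfloor>)) has_real_derivative bump (pderiv q) c y) (at y)"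
    by (auto intro!: derivative_eq_intros DERIV_chain2[OF poly_DERIV] simp: bump_def frac_def)
  then show ?thesis
    by (rule has_field_derivative_transform_within_open[OF _ _ yin]) (use ev in auto)
qed

text \<open>Levels \<open>2 j\<close> and \<open>2 j + 1\<close> both have scale \<open>2 ^ j\<close>, but their grids are shifted by half a cell, so every
  point lies in the middle half of a cell, where the bump is bounded below, at one of the two levels.
  The factor \<open>real (Suc l) ^ 3\<close> absorbs the noise, which is at most \<open>Suc l\<close>, and leaves a summable series
  also for \<open>\<alpha> = 0\<close> and \<open>\<alpha> = 1\<close>.\<close>

definition grid :: "nat \<Rightarrow> real \<Rightarrow> real" where
  "grid l x = 2 ^ (l div 2) * x + real (l mod 2) / 2"

definition amp :: "real \<Rightarrow> real \<Rightarrow> nat \<Rightarrow> real" where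
  "amp c \<beta> l = c * 2 powr (- \<beta> * real (l div 2)) / real (Suc l) ^ 3"

definition perturbation :: "real poly \<Rightarrow> real \<Rightarrow> real \<Rightarrow> (nat \<Rightarrow> int \<Rightarrow> real) \<Rightarrow> real \<Rightarrow> real" where
  "perturbation p c \<beta> X x = x + (\<Sum>l. amp c \<beta> l * bump p (X l) (grid l x))"

lemma summable_inverse_Suc_square: "summable (\<lambda>l. 1 / real (Suc l) ^ 2)"
  using inverse_squares_sums by (simp add: sums_iff add.commute)

lemma suminf_inverse_Suc_square: "(\<Sum>l. 1 / real (Suc l) ^ 2) \<le> 4"
proof -
  have "(\<Sum>l. 1 / real (Suc l) ^ 2) = pi ^ 2 / 6"
    using inverse_squares_sums by (simp add: sums_iff add.commute)
  moreover have "pi ^ 2 \<le> 4 ^ 2" using pi_less_4 by (intro power_mono) auto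
  ultimately show ?thesis by simp
qed

text \<open>By \<open>pderiv_funpow_power_dvd\<close> the exponent m + 2 leaves a double zero at the
  ends of the cells in all derivatives up to order m, as \<open>bump_has_derivative\<close> demands.
  The constant c is chosen before the coefficients, so it serves every realisation of the
  noise.\<close>

lemma perturbation_diffeomorphism:
  fixes m :: nat
  assumes m: "1 \<le> m" and \<alpha>: "0 \<le> \<alpha>" "\<alpha> \<le> 1"
  defines "p \<equiv> [:0, 1, -1:] ^ (m + 2)"
  obtains c where "0 < c"
    "\<forall>X. (\<forall>l k. \<bar>X l k\<bar> \<le> real (Suc l)) \<longrightarrow>
       diffeomorphism m \<alpha> (perturbation p c (real m + \<alpha>) X) \<and>
       (\<forall>x. summable (\<lambda>l. amp c (real m + \<alpha>) l * bump p (X l) (grid l x)))"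
proof -
  define D where "D i = (pderiv ^^ i) p" for i
  have "\<exists>B\<ge>0. \<forall>t\<in>{0..1}. \<bar>poly (D i) t\<bar> \<le> B" for i
    using poly_bounded_unit[of "D i"] by metis
  then obtain b where b: "\<And>i. 0 \<le> b i" "\<And>i t. t \<in> {0..1} \<Longrightarrow> \<bar>poly (D i) t\<bar> \<le> b i" by metis
  define B where "B = 1 + (\<Sum>i\<le>Suc m. b i)"
  have B1: "1 \<le> B" using b(1) by (simp add: B_def sum_nonneg)
  have B: "\<bar>poly (D i) t\<bar> \<le> B" if "i \<le> Suc m" "t \<in> {0..1}" for i t
  proof -
    have "b i \<le> (\<Sum>i\<le>Suc m. b i)" using that b(1) by (intro member_le_sum) auto
    then show ?thesis using b(2)[OF that(2), of i] by (simp add: B_def)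
  qed
  \<comment> \<open>With this choice the majorant \<open>M\<close> has sum at most 2 c B * 4 = 1/2,
    so the derivative of the perturbed identity is at least 1/2.\<close>
  define c where "c = 1 / (16 * B)"
  have c: "0 < c" "2 * c * B * 4 = 1 / 2" using B1 by (auto simp: c_def)
  define \<beta> where "\<beta> = real m + \<alpha>"
  define M where "M l = 2 * c * B * (1 / real (Suc l) ^ 2)" for l
  have M: "summable M" "\<And>l. 0 \<le> M l"
    unfolding M_def using c B1 by (intro summable_mult summable_inverse_Suc_square, auto)
  have M_sum: "suminf M \<le> 1 / 2"
  proof -
    have "suminf M = 2 * c * B * (\<Sum>l. 1 / real (Suc l) ^ 2)"
      unfolding M_def by (rule suminf_mult[OF summable_inverse_Suc_square])
    also have "\<dots> \<le> 2 * c * B * 4"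
      using suminf_inverse_Suc_square c B1 by (intro mult_left_mono) auto
    finally show ?thesis using c by simp
  qed
  have "diffeomorphism m \<alpha> (perturbation p c \<beta> X) \<and> (\<forall>x. summable (\<lambda>l. amp c \<beta> l * bump p (X l) (grid l x)))"
    if X: "\<And>l k. \<bar>X l k\<bar> \<le> real (Suc l)" for X
  proof
    \<comment> \<open>The i-th derivative of the l-th term; each differentiation brings out the
      factor 2^(l div 2) from the grid.\<close>
    define T where "T i l x = amp c \<beta> l * (2 ^ (l div 2)) ^ i * bump (D i) (X l) (grid l x)" for i l x
    have Td: "(T i l has_real_derivative T (Suc i) l x) (at x)" if i: "i \<le> m" for i l x
    proof -
      obtain r where "D i = [:0, 1, -1:] ^ (2 + (m - i)) * r"
        using pderiv_funpow_power_dvd[of i "[:0, 1, -1:]" "2 + (m - i)"] i by (auto simp: D_def p_def)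
      then have Di: "D i = [:0, 1, -1:] ^ 2 * ([:0, 1, -1:] ^ (m - i) * r)" by (simp only: power_add mult.assoc)
      have "(bump (D i) (X l) has_real_derivative bump (D (Suc i)) (X l) (grid l x)) (at (grid l x))"
        using bump_has_derivative[OF X Di] by (simp add: D_def)
      moreover have "(grid l has_real_derivative 2 ^ (l div 2)) (at x)"
        unfolding grid_def by (auto intro!: derivative_eq_intros)
      ultimately have "((\<lambda>x. bump (D i) (X l) (grid l x)) has_real_derivative
          bump (D (Suc i)) (X l) (grid l x) * 2 ^ (l div 2)) (at x)"
        by (rule DERIV_chain2)
      then show ?thesis unfolding T_def
        by (auto intro!: derivative_eq_intros simp: mult_ac)
    qed
    \<comment> \<open>The last factor is at most 1 for i \<le> m. For i = m + 1 it grows with the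
      level unless \<alpha> = 1, so that order is used only for interpolation.\<close>
    have Tb: "\<bar>T i l x\<bar> \<le> c * B * (1 / real (Suc l) ^ 2) * 2 powr (- (\<beta> - real i) * real (l div 2))"
      if i: "i \<le> Suc m" for i l x
    proof -
      have "\<bar>bump (D i) (X l) (grid l x)\<bar> \<le> real (Suc l) * B"
        unfolding bump_def abs_mult using X B[OF i, of "frac (grid l x)"]
        by (intro mult_mono) (auto simp: frac_lt_1 less_imp_le)
      then have "\<bar>T i l x\<bar> \<le> amp c \<beta> l * (2 ^ (l div 2)) ^ i * (real (Suc l) * B)"
        unfolding T_def abs_mult using c by (intro mult_mono) (auto simp: amp_def)
      also have "\<dots> = c * B * (real (Suc l) / real (Suc l) ^ 3) * (2 powr (- \<beta> * real (l div 2)) * (2 ^ (l div 2)) ^ i)"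
        by (simp add: amp_def)
      also have "real (Suc l) / real (Suc l) ^ 3 = 1 / real (Suc l) ^ 2"
        by (simp add: power3_eq_cube power2_eq_square)
      also have "2 powr (- \<beta> * real (l div 2)) * (2 ^ (l div 2)) ^ i = 2 powr (- (\<beta> - real i) * real (l div 2))"
        by (simp add: powr_realpow[symmetric] powr_powr powr_add[symmetric] algebra_simps)
      finally show ?thesis .
    qed
    have TM': "\<bar>T i l x\<bar> \<le> c * B * (1 / real (Suc l) ^ 2)" if i: "i \<le> m" for i l x
    proof -
      have "2 powr (- (\<beta> - real i) * real (l div 2)) \<le> 2 powr 0"
        using i \<alpha> by (intro powr_mono mult_nonpos_nonneg) (auto simp: \<beta>_def)
      then have "c * B * (1 / real (Suc l) ^ 2) * 2 powr (- (\<beta> - real i) * real (l div 2)) \<le> c * B * (1 / real (Suc l) ^ 2) * 1"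
        using c B1 by (intro mult_left_mono) auto
      then show ?thesis using Tb[of i l x] i by simp
    qed
    have TM: "\<bar>T i l x\<bar> \<le> M l" if i: "i \<le> m" for i l x
    proof -
      have "c * B * (1 / real (Suc l) ^ 2) \<le> M l"
        unfolding M_def using c B1 by (intro mult_right_mono) auto
      then show ?thesis using TM'[OF i, of l x] by linarith
    qed
    \<comment> \<open>Differences of \<open>T m l\<close> are at most A and its slope is at most A
      2^(l div 2). Interpolation gives the Hoelder constant A 2^(\<alpha> (l div 2)), which is
      \<open>M l\<close>. The factor 2 in \<open>M\<close> pays for taking a difference.\<close>
    have Th: "\<bar>T m l y - T m l x\<bar> \<le> M l * \<bar>y - x\<bar> powr \<alpha>" for l x y
    proof (cases "x = y")
      case False
      define A where "A = M l * 2 powr (- \<alpha> * real (l div 2))"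
      have Tm: "\<bar>T m l z\<bar> \<le> A / 2" for z
        using Tb[of m l z] by (simp add: A_def M_def \<beta>_def)
      have "\<bar>T (Suc m) l z\<bar> \<le> A * 2 ^ (l div 2)" for z
      proof -
        have "\<bar>T (Suc m) l z\<bar> \<le> M l * 2 powr (- (\<beta> - real (Suc m)) * real (l div 2)) / 2"
          using Tb[of "Suc m" l z] by (simp add: M_def)
        also have "\<dots> = A * 2 ^ (l div 2) / 2"
          by (simp add: A_def powr_realpow[symmetric] powr_add[symmetric] \<beta>_def algebra_simps)
        also have "\<dots> \<le> A * 2 ^ (l div 2)" using M(2) by (simp add: A_def)
        finally show ?thesis .
      qed
      then have "\<bar>T m l y - T m l x\<bar> \<le> A * 2 ^ (l div 2) * \<bar>y - x\<bar>"
        by (intro lipschitz_of_derivative[OF Td]) auto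
      moreover have "\<bar>T m l y - T m l x\<bar> \<le> A" using Tm[of x] Tm[of y] by linarith
      moreover have "0 \<le> A" using M(2) by (simp add: A_def)
      ultimately have "\<bar>T m l y - T m l x\<bar> \<le> A * (2 ^ (l div 2)) powr \<alpha> * \<bar>y - x\<bar> powr \<alpha>"
        using False \<alpha> by (intro powr_interpolation) (auto simp: mult.assoc)
      also have "A * (2 ^ (l div 2)) powr \<alpha> = M l"
        by (simp add: A_def powr_realpow[symmetric] powr_powr powr_add[symmetric] algebra_simps)
      finally show ?thesis .
    qed simp
    obtain k where k: "m = Suc k" using m by (cases m) auto
    have cls: "holder_class \<alpha> k (\<lambda>x. 1 + (\<Sum>l. T 1 l x))"
    proof (rule holder_class_add[OF holder_class_const])
      have "holder_class \<alpha> k (\<lambda>x. \<Sum>l. T (Suc 0) l x)"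
      proof (rule holder_class_suminf[OF M, of k "\<lambda>i. T (Suc i)"])
        show "continuous_on UNIV (T (Suc k) l)" for l
          using Td[of m] k by (meson DERIV_continuous_on has_field_derivative_at_within order_refl)
      qed (use k Td TM Th in auto)
      then show "holder_class \<alpha> k (\<lambda>x. \<Sum>l. T 1 l x)" by simp
    qed
    have T0: "T 0 l x = amp c \<beta> l * bump p (X l) (grid l x)" for l x by (simp add: T_def D_def)
    have der: "(perturbation p c \<beta> X has_real_derivative 1 + (\<Sum>l. T 1 l x)) (at x)" for x
    proof -
      have "((\<lambda>x. \<Sum>l. T 0 l x) has_real_derivative (\<Sum>l. T 1 l x)) (at x)"
        by (rule has_derivative_suminf[OF M(1)]) (use Td[of 0] TM[of 0] TM[of 1] m in auto)
      from DERIV_add[OF DERIV_ident this] show ?thesis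
        unfolding perturbation_def T0[symmetric] .
    qed
    have low: "1 / 2 \<le> 1 + (\<Sum>l. T 1 l x)" for x
    proof -
      have "norm (\<Sum>l. T 1 l x) \<le> suminf M"
        using TM[of 1] m by (intro norm_suminf_le[OF _ M(1)]) auto
      then show ?thesis using M_sum by (simp add: abs_le_iff)
    qed
    show "diffeomorphism m \<alpha> (perturbation p c \<beta> X)"
      unfolding k by (rule diffeomorphism_of_derivative[OF \<alpha> _ der cls low]) simp
    show "\<forall>x. summable (\<lambda>l. amp c \<beta> l * bump p (X l) (grid l x))"
      unfolding T0[symmetric] using TM[of 0] by (intro allI summable_comparison_test'[OF M(1)]) auto
  qed
  then show thesis using that c(1) unfolding \<beta>_def by blast
qed

subsection \<open>Concentration of integrals with random phases\<close>

lemma indep_vars_component: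
  assumes M: "\<And>i. prob_space (M i)" and I: "I \<noteq> {}"
  shows "prob_space.indep_vars (PiM I M) M (\<lambda>i \<omega>. \<omega> i) I"
proof -
  interpret prob_space "PiM I M" using M by (intro prob_space_PiM) auto
  have "distr (PiM I M) (PiM I M) (\<lambda>x. \<lambda>i\<in>I. x i) = distr (PiM I M) (PiM I M) (\<lambda>x. x)"
    by (intro distr_cong) (auto simp: space_PiM PiE_def extensional_restrict)
  also have "\<dots> = PiM I M" by simp
  also have "\<dots> = PiM I (\<lambda>i. distr (PiM I M) (M i) (\<lambda>\<omega>. \<omega> i))"
    using M by (intro PiM_cong) (auto simp: distr_PiM_component)
  finally show ?thesis
    using I by (subst indep_vars_iff_distr_eq_PiM') auto
qed

section \<open>Uniform variables and their sums\<close>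

definition unit_uniform :: "real measure" where
  "unit_uniform = density lborel (\<lambda>x. ennreal (indicator {-1..1} x / 2))"

text \<open>The uniform variable lies in [-1, 1] only almost surely. Clamping bounds every
  realisation of the noise, so that each one, and not just almost each, yields a
  diffeomorphism.\<close>

definition clamp1 :: "real \<Rightarrow> real" where
  "clamp1 x = max (-1) (min 1 x)"

lemma sets_unit_uniform [measurable_cong, simp]: "sets unit_uniform = sets borel"
  by (simp add: unit_uniform_def)

lemma clamp1_measurable [measurable]: "clamp1 \<in> borel_measurable borel"
  unfolding clamp1_def by measurable

lemma clamp1_bounded: "\<bar>clamp1 x\<bar> \<le> 1"
  by (auto simp: clamp1_def)

lemma prob_space_unit_uniform: "prob_space unit_uniform"
proof
  have "emeasure unit_uniform (space unit_uniform) = (\<integral>\<^sup>+(x::real). ennreal (1/2) * indicator {-1..1} x \<partial>lborel)"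
    unfolding unit_uniform_def
    by (subst emeasure_density) (auto intro!: nn_integral_cong simp: indicator_def)
  also have "\<dots> = ennreal (1/2) * ennreal 2"
    by (subst nn_integral_cmult_indicator) auto
  also have "\<dots> = 1" by (subst ennreal_mult[symmetric]) auto
  finally show "emeasure unit_uniform (space unit_uniform) = 1" .
qed

text \<open>The function is sin t / t; the two boundary terms of the antiderivative have modulus
  1/(2 |t|) each.\<close>

lemma char_clamp1_bound:
  assumes "t \<noteq> 0"
  shows "norm (char (distr unit_uniform borel clamp1) t) \<le> 1 / \<bar>t\<bar>"
proof -
  have "char (distr unit_uniform borel clamp1) t = (CLINT x|unit_uniform. iexp (t * clamp1 x))"
    unfolding char_def by (subst integral_distr) auto
  also have "\<dots> = (CLINT x|lborel. (indicator {-1..1} x / 2) *\<^sub>R iexp (t * clamp1 x))"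
    unfolding unit_uniform_def by (subst integral_density) auto
  also have "\<dots> = (CLINT x|lborel. indicator {-1..1} x *\<^sub>R (iexp (t * x) / 2))"
    by (intro Bochner_Integration.integral_cong) (auto simp: clamp1_def scaleR_conv_of_real split: split_indicator)
  also have "\<dots> = iexp (t * 1) / (2 * (\<i> * t)) - iexp (t * (-1)) / (2 * (\<i> * t))"
  proof (rule integral_FTC_atLeastAtMost)
    fix x :: real
    have "((\<lambda>x. exp (\<i> * (of_real t * of_real x)) / (2 * (\<i> * t))) has_vector_derivative exp (\<i> * (t * of_real x)) / 2) (at x within {-1..1})"
      by (rule has_vector_derivative_real_field[of "\<lambda>z. exp (\<i> * (t * z)) / (2 * (\<i> * t))"])
        (use assms in \<open>auto intro!: derivative_eq_intros\<close>)
    then show "((\<lambda>x. iexp (t * x) / (2 * (\<i> * t))) has_vector_derivative iexp (t * x) / 2) (at x within {-1..1})"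
      by simp
  qed (auto intro!: continuous_intros)
  also have "norm \<dots> \<le> norm (iexp (t * 1) / (2 * (\<i> * t))) + norm (iexp (t * (-1)) / (2 * (\<i> * t)))"
    by (rule norm_triangle_ineq4)
  also have "\<dots> = 1 / \<bar>t\<bar>"
    using assms by (simp add: norm_divide norm_mult)
  finally show ?thesis .
qed

definition coin_space :: "(nat \<Rightarrow> real) measure" where
  "coin_space = PiM UNIV (\<lambda>_. unit_uniform)"

text \<open>Level \<open>l\<close> uses the sum of \<open>Suc l\<close> uniform variables: its characteristic function is at most \<open>2\<^bsup>-l\<^esup>\<close> as
  soon as the argument exceeds 2, so no decay in the argument is needed.\<close>

definition coin_sum :: "nat \<Rightarrow> (nat \<Rightarrow> real) \<Rightarrow> real" where
  "coin_sum l v = (\<Sum>i<Suc l. clamp1 (v i))"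

lemma prob_space_coin_space: "prob_space coin_space"
  unfolding coin_space_def by (intro prob_space_PiM prob_space_unit_uniform)

lemma coin_sum_measurable [measurable]: "coin_sum l \<in> borel_measurable coin_space"
  unfolding coin_sum_def coin_space_def by measurable

lemma coin_sum_bounded: "\<bar>coin_sum l v\<bar> \<le> real (Suc l)"
proof -
  have "\<bar>coin_sum l v\<bar> \<le> (\<Sum>i<Suc l. \<bar>clamp1 (v i)\<bar>)" unfolding coin_sum_def by (rule sum_abs)
  also have "\<dots> \<le> (\<Sum>i<Suc l. 1)" by (intro sum_mono clamp1_bounded)
  finally show ?thesis by simp
qed

lemma char_coin_sum_bound:
  assumes "2 \<le> \<bar>t\<bar>"
  shows "norm (char (distr coin_space borel (coin_sum l)) t) \<le> (1 / 2) ^ Suc l"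
proof -
  interpret prob_space coin_space by (rule prob_space_coin_space)
  have "indep_vars (\<lambda>_. unit_uniform) (\<lambda>i v. v i) UNIV"
    unfolding coin_space_def by (intro indep_vars_component prob_space_unit_uniform) simp
  then have "indep_vars (\<lambda>_. borel) (\<lambda>i v. clamp1 (v i)) UNIV"
    by (rule indep_vars_compose2) simp
  then have "indep_vars (\<lambda>_. borel) (\<lambda>i v. clamp1 (v i)) {..<Suc l}"
    by (rule indep_vars_subset) simp
  from char_distr_sum[OF this, of t]
  have "char (distr coin_space borel (coin_sum l)) t = (\<Prod>i<Suc l. char (distr coin_space borel (\<lambda>v. clamp1 (v i))) t)"
    by (simp add: coin_sum_def[abs_def])
  also have "\<dots> = (\<Prod>i<Suc l. char (distr unit_uniform borel clamp1) t)"
  proof (rule prod.cong[OF refl])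
    fix i
    have "distr coin_space borel (\<lambda>v. clamp1 (v i)) = distr (distr coin_space unit_uniform (\<lambda>v. v i)) borel clamp1"
      unfolding coin_space_def by (subst distr_distr) (auto simp: comp_def)
    also have "distr coin_space unit_uniform (\<lambda>v. v i) = unit_uniform"
      unfolding coin_space_def by (rule distr_PiM_component) (auto simp: prob_space_unit_uniform)
    finally show "char (distr coin_space borel (\<lambda>v. clamp1 (v i))) t = char (distr unit_uniform borel clamp1) t"
      by simp
  qed
  finally have "norm (char (distr coin_space borel (coin_sum l)) t) = norm (char (distr unit_uniform borel clamp1) t) ^ Suc l"
    by (simp add: norm_power norm_mult)
  also have "\<dots> \<le> (1 / 2) ^ Suc l"
  proof (rule power_mono)
    have "norm (char (distr unit_uniform borel clamp1) t) \<le> 1 / \<bar>t\<bar>"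
      using assms by (intro char_clamp1_bound) auto
    also have "\<dots> \<le> 1 / 2" using assms by (intro divide_left_mono) auto
    finally show "norm (char (distr unit_uniform borel clamp1) t) \<le> 1 / 2" .
  qed simp
  finally show ?thesis .
qed

text \<open>The k-th summand ranges over an interval of length 2 v k. The squares of these lengths
  add up to at most 4 w, since the largest v k is at most w and their sum is at most 1. This is how
  a bound on the cell masses becomes a concentration bound.\<close>

lemma hoeffding_coordinates:
  fixes \<psi> :: "'b \<Rightarrow> 'a \<Rightarrow> real" and v :: "'b \<Rightarrow> real"
  assumes \<rho>: "prob_space \<rho>" and J: "finite J"
    and \<psi>: "\<And>k. \<psi> k \<in> borel_measurable \<rho>" "\<And>k x. \<bar>\<psi> k x\<bar> \<le> v k"
    and v: "\<And>k. v k \<le> w" "(\<Sum>k\<in>J. v k) \<le> 1" and w: "0 < w" and l: "0 < l"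
  shows "measure (PiM UNIV (\<lambda>_. \<rho>)) {\<omega>\<in>space (PiM UNIV (\<lambda>_. \<rho>)).
      l \<le> \<bar>(\<Sum>k\<in>J. \<psi> k (\<omega> k)) - (\<Sum>k\<in>J. LINT x|\<rho>. \<psi> k x)\<bar>} \<le> 2 * exp (- l\<^sup>2 / (2 * w))"
    (is "measure ?P ?E \<le> _")
proof (cases "(\<Sum>k\<in>J. (v k - (- v k))\<^sup>2) > 0")
  case True
  interpret P: prob_space ?P by (intro prob_space_PiM \<rho>)
  have "P.indep_vars (\<lambda>_. \<rho>) (\<lambda>i \<omega>. \<omega> i) UNIV"
    by (intro indep_vars_component \<rho>) simp
  then have "P.indep_vars (\<lambda>_. borel) (\<lambda>k \<omega>. \<psi> k (\<omega> k)) UNIV"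
    by (rule P.indep_vars_compose2) (use \<psi> in auto)
  then have ind: "P.indep_vars (\<lambda>_. borel) (\<lambda>k \<omega>. \<psi> k (\<omega> k)) J"
    by (rule P.indep_vars_subset) simp
  have mean: "P.expectation (\<lambda>\<omega>. \<psi> k (\<omega> k)) = (LINT x|\<rho>. \<psi> k x)" for k
  proof -
    have "(LINT x|\<rho>. \<psi> k x) = (LINT x|distr ?P \<rho> (\<lambda>\<omega>. \<omega> k). \<psi> k x)"
      using \<rho> by (subst distr_PiM_component) auto
    also have "\<dots> = P.expectation (\<lambda>\<omega>. \<psi> k (\<omega> k))"
      using \<psi> by (intro integral_distr) auto
    finally show ?thesis ..
  qed
  interpret H: Hoeffding_ineq ?P J "\<lambda>k \<omega>. \<psi> k (\<omega> k)" "\<lambda>k. - v k" v "\<Sum>k\<in>J. P.expectation (\<lambda>\<omega>. \<psi> k (\<omega> k))"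
    using J ind \<psi>(2) by unfold_locales (auto simp: abs_le_iff minus_le_iff)
  have "measure ?P ?E \<le> 2 * exp (- 2 * l\<^sup>2 / (\<Sum>k\<in>J. (v k - (- v k))\<^sup>2))"
    using H.Hoeffding_ineq_abs_ge[of l] True l by (simp add: mean)
  also have "\<dots> \<le> 2 * exp (- l\<^sup>2 / (2 * w))"
  proof -
    have v0: "0 \<le> v k" for k using \<psi>(2)[of k undefined] by linarith
    have "(\<Sum>k\<in>J. (v k - (- v k))\<^sup>2) \<le> (\<Sum>k\<in>J. 4 * w * v k)"
      using v(1) v0 by (intro sum_mono) (auto simp: power2_eq_square intro!: mult_right_mono)
    also have "\<dots> = 4 * w * (\<Sum>k\<in>J. v k)" by (simp add: sum_distrib_left)
    also have "\<dots> \<le> 4 * w" using v(2) w by simp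
    finally have "2 * l\<^sup>2 / (4 * w) \<le> 2 * l\<^sup>2 / (\<Sum>k\<in>J. (v k - (- v k))\<^sup>2)"
      using True by (intro divide_left_mono) auto
    then show ?thesis by simp
  qed
  finally show ?thesis .
next
  case False
  \<comment> \<open>Hoeffding's inequality needs a positive denominator. If all lengths vanish, the
    summands vanish too and there is no deviation.\<close>
  have "(\<Sum>k\<in>J. (v k - (- v k))\<^sup>2) = 0" using False by (simp add: antisym_conv sum_nonneg not_less)
  then have "\<psi> k x = 0" if "k \<in> J" for k x
    using that J \<psi>(2)[of k x] by (simp add: sum_nonneg_eq_0_iff)
  then have "?E = {}" using l by auto
  then have "measure ?P ?E = 0" by (simp only: measure_empty)
  also have "0 \<le> 2 * exp (- l\<^sup>2 / (2 * w))" by simp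
  finally show ?thesis .
qed

text \<open>The part of the integral over the cell \<kappa> x = k depends on the coordinate
  \<open>\<omega> k\<close> alone, so the integral is a sum of independent variables bounded by the
  cell masses. Here \<open>h\<close> collects the part of the phase that is not randomised, and
  \<open>S\<close> keeps the points where the random part has a large factor
  \<open>u\<close>.\<close>

lemma integral_phase_concentration:
  fixes \<kappa> :: "real \<Rightarrow> int" and h u :: "real \<Rightarrow> real" and c :: "'a \<Rightarrow> real"
  assumes \<mu>: "real_distribution \<mu>" and \<rho>: "prob_space \<rho>" and c [measurable]: "c \<in> borel_measurable \<rho>"
    and [measurable]: "\<kappa> \<in> borel \<rightarrow>\<^sub>M count_space UNIV" "h \<in> borel_measurable borel" "u \<in> borel_measurable borel" "S \<in> sets borel"
    and J: "finite J" "AE x in \<mu>. \<kappa> x \<in> J"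
    and u: "\<And>x. x \<in> S \<Longrightarrow> T \<le> \<bar>u x\<bar>" and \<eta>: "\<And>t. T \<le> \<bar>t\<bar> \<Longrightarrow> norm (char (distr \<rho> borel c) t) \<le> \<eta>" "0 \<le> \<eta>"
    and w: "0 < w" "\<And>k. measure \<mu> {x. \<kappa> x = k} \<le> w" and l: "0 < l"
  shows "measure (PiM UNIV (\<lambda>_. \<rho>)) {\<omega>\<in>space (PiM UNIV (\<lambda>_. \<rho>)).
      \<eta> + 2 * l \<le> norm (CLINT x|\<mu>. indicator S x *\<^sub>R iexp (h x + c (\<omega> (\<kappa> x)) * u x))} \<le> 4 * exp (- l\<^sup>2 / (2 * w))"
    (is "measure ?P ?E \<le> _")
proof -
  interpret \<mu>: real_distribution \<mu> by fact
  interpret \<rho>: prob_space \<rho> by fact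
  interpret P: prob_space ?P by (intro prob_space_PiM \<rho>)
  interpret pair_sigma_finite \<rho> \<mu> ..
  interpret D: real_distribution "distr \<rho> borel c" by (rule \<rho>.real_distribution_distr) simp
  have [measurable]: "{x. \<kappa> x = k} \<in> sets borel" for k by measurable
  define A where "A k = S \<inter> {x. \<kappa> x = k}" for k
  have [measurable]: "A k \<in> sets borel" for k by (simp add: A_def)
  define \<phi> where "\<phi> k y = (CLINT x|\<mu>. indicator (A k) x *\<^sub>R iexp (h x + c y * u x))" for k y
  define v where "v k = measure \<mu> (A k)" for k
  have \<phi>_meas [measurable]: "\<phi> k \<in> borel_measurable \<rho>" for k
    unfolding \<phi>_def by measurable
  have \<phi>_bound: "norm (\<phi> k y) \<le> v k" for k y
  proof -
    have "norm (\<phi> k y) \<le> (LINT x|\<mu>. norm (indicator (A k) x *\<^sub>R iexp (h x + c y * u x)))"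
      unfolding \<phi>_def by (rule integral_norm_bound)
    also have "\<dots> = (LINT x|\<mu>. indicator (A k) x)"
      by (intro Bochner_Integration.integral_cong) (auto split: split_indicator)
    finally show ?thesis by (simp add: v_def)
  qed
  have v_le: "v k \<le> w" for k
    using \<mu>.finite_measure_mono[of "A k" "{x. \<kappa> x = k}"] w(2)[of k] by (simp add: v_def A_def)
  have v_sum: "(\<Sum>k\<in>J. v k) \<le> 1"
  proof -
    have "(\<Sum>k\<in>J. v k) = measure \<mu> (\<Union>k\<in>J. A k)"
      unfolding v_def using J(1) by (intro \<mu>.finite_measure_finite_Union[symmetric]) (auto simp: A_def disjoint_family_on_def)
    then show ?thesis using \<mu>.prob_le_1 by simp
  qed
  have \<rho>int: "integrable \<rho> (\<phi> k)" for k
    using \<phi>_bound by (intro \<rho>.integrable_const_bound[of _ "v k"]) auto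
  \<comment> \<open>After exchanging the integrals the inner one is the characteristic function of c
    at u x, and |u x| \<ge> T on S.\<close>
  have mean: "norm (CLINT y|\<rho>. \<phi> k y) \<le> \<eta> * v k" for k
  proof -
    have int: "integrable (\<rho> \<Otimes>\<^sub>M \<mu>) (\<lambda>(y, x). indicator (A k) x *\<^sub>R iexp (h x + c y * u x))"
    proof -
      interpret pp: prob_space "\<rho> \<Otimes>\<^sub>M \<mu>" by (intro prob_space_pair \<rho> \<mu>.prob_space_axioms)
      show ?thesis
        by (rule pp.integrable_const_bound[of _ 1]) (auto split: split_indicator)
    qed
    have "(CLINT y|\<rho>. \<phi> k y) = (CLINT x|\<mu>. CLINT y|\<rho>. indicator (A k) x *\<^sub>R iexp (h x + c y * u x))"
      unfolding \<phi>_def using Fubini_integral[OF int] by simp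
    also have "\<dots> = (CLINT x|\<mu>. indicator (A k) x *\<^sub>R (iexp (h x) * char (distr \<rho> borel c) (u x)))"
    proof (intro Bochner_Integration.integral_cong refl)
      fix x
      have "(CLINT y|\<rho>. indicator (A k) x *\<^sub>R iexp (h x + c y * u x)) =
          (CLINT y|\<rho>. (indicator (A k) x *\<^sub>R iexp (h x)) * iexp (u x * c y))"
        by (intro Bochner_Integration.integral_cong) (auto simp: exp_add[symmetric] algebra_simps split: split_indicator)
      also have "\<dots> = (indicator (A k) x *\<^sub>R iexp (h x)) * (CLINT y|\<rho>. iexp (u x * c y))"
        by simp
      also have "(CLINT y|\<rho>. iexp (u x * c y)) = char (distr \<rho> borel c) (u x)"
        unfolding char_def by (subst integral_distr) auto
      finally show "(CLINT y|\<rho>. indicator (A k) x *\<^sub>R iexp (h x + c y * u x)) =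
          indicator (A k) x *\<^sub>R (iexp (h x) * char (distr \<rho> borel c) (u x))" by simp
    qed
    also have "norm \<dots> \<le> (LINT x|\<mu>. norm (indicator (A k) x *\<^sub>R (iexp (h x) * char (distr \<rho> borel c) (u x))))"
      by (rule integral_norm_bound)
    also have "\<dots> \<le> (LINT x|\<mu>. \<eta> * indicator (A k) x)"
    proof (rule integral_mono)
      have m [measurable]: "(\<lambda>x. indicator (A k) x *\<^sub>R (iexp (h x) * char (distr \<rho> borel c) (u x))) \<in> borel_measurable \<mu>"
        using measurable_compose[OF \<open>u \<in> borel_measurable borel\<close> D.char_measurable] by measurable
      show b: "norm (indicator (A k) x *\<^sub>R (iexp (h x) * char (distr \<rho> borel c) (u x))) \<le> \<eta> * indicator (A k) x" for x
        using \<eta>(1)[OF u, of x] by (auto simp: A_def norm_mult split: split_indicator)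
      show "integrable \<mu> (\<lambda>x. norm (indicator (A k) x *\<^sub>R (iexp (h x) * char (distr \<rho> borel c) (u x))))"
        using \<eta>(2) by (intro \<mu>.integrable_const_bound[of _ \<eta>] AE_I2)
          (auto simp: A_def norm_mult intro!: \<eta>(1) u split: split_indicator)
      show "integrable \<mu> (\<lambda>x. \<eta> * indicator (A k) x)"
        using \<eta>(2) by (intro \<mu>.integrable_const_bound[of _ \<eta>] AE_I2) (auto split: split_indicator)
    qed
    finally show ?thesis by (simp add: v_def)
  qed
  define Z where "Z \<omega> = (\<Sum>k\<in>J. \<phi> k (\<omega> k))" for \<omega>
  define m where "m = (\<Sum>k\<in>J. CLINT y|\<rho>. \<phi> k y)"
  have Zeq: "(CLINT x|\<mu>. indicator S x *\<^sub>R iexp (h x + c (\<omega> (\<kappa> x)) * u x)) = Z \<omega>" if \<omega>: "\<omega> \<in> space ?P" for \<omega>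
  proof -
    have "(CLINT x|\<mu>. indicator S x *\<^sub>R iexp (h x + c (\<omega> (\<kappa> x)) * u x)) =
        (CLINT x|\<mu>. \<Sum>k\<in>J. indicator (A k) x *\<^sub>R iexp (h x + c (\<omega> k) * u x))"
    proof (rule integral_cong_AE)
      have "(\<lambda>x. c (\<omega> (\<kappa> x))) \<in> borel_measurable borel"
        by (rule measurable_compose[of \<kappa> _ "count_space UNIV" "\<lambda>k. c (\<omega> k)"]) auto
      then show "(\<lambda>x. indicator S x *\<^sub>R iexp (h x + c (\<omega> (\<kappa> x)) * u x)) \<in> borel_measurable \<mu>" by measurable
      show "AE x in \<mu>. indicator S x *\<^sub>R iexp (h x + c (\<omega> (\<kappa> x)) * u x) =
          (\<Sum>k\<in>J. indicator (A k) x *\<^sub>R iexp (h x + c (\<omega> k) * u x))"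
        using J(2)
      proof eventually_elim
        case (elim x)
        have "(\<Sum>k\<in>J. indicator (A k) x *\<^sub>R iexp (h x + c (\<omega> k) * u x)) =
            (\<Sum>k\<in>{\<kappa> x}. indicator (A k) x *\<^sub>R iexp (h x + c (\<omega> k) * u x))"
          using J(1) elim by (intro sum.mono_neutral_right) (auto simp: A_def)
        then show ?case by (simp add: A_def indicator_def)
      qed
    qed measurable
    also have "\<dots> = Z \<omega>"
      unfolding Z_def \<phi>_def
      by (intro Bochner_Integration.integral_sum \<mu>.integrable_const_bound[of _ 1]) (auto split: split_indicator)
    finally show ?thesis .
  qed
  have m_le: "norm m \<le> \<eta>"
  proof -
    have "norm m \<le> (\<Sum>k\<in>J. \<eta> * v k)" unfolding m_def by (intro sum_norm_le mean)
    also have "\<dots> = \<eta> * (\<Sum>k\<in>J. v k)" by (simp add: sum_distrib_left)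
    also have "\<dots> \<le> \<eta> * 1" using v_sum \<eta>(2) by (intro mult_left_mono)
    finally show ?thesis by simp
  qed
  define E1 where "E1 = {\<omega>\<in>space ?P. l \<le> \<bar>(\<Sum>k\<in>J. Re (\<phi> k (\<omega> k))) - (\<Sum>k\<in>J. LINT y|\<rho>. Re (\<phi> k y))\<bar>}"
  define E2 where "E2 = {\<omega>\<in>space ?P. l \<le> \<bar>(\<Sum>k\<in>J. Im (\<phi> k (\<omega> k))) - (\<Sum>k\<in>J. LINT y|\<rho>. Im (\<phi> k y))\<bar>}"
  have [measurable]: "E1 \<in> sets ?P" "E2 \<in> sets ?P" unfolding E1_def E2_def by measurable
  \<comment> \<open>The mean has modulus at most \<eta>, so a deviation of at least 2 l remains, and
    its real or its imaginary part must be at least l.\<close>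
  have "?E \<subseteq> E1 \<union> E2"
  proof
    fix \<omega> assume \<omega>: "\<omega> \<in> ?E"
    then have "\<eta> + 2 * l \<le> norm (Z \<omega>)" using Zeq by auto
    also have "\<dots> \<le> norm m + norm (Z \<omega> - m)" by (metis add.commute diff_add_cancel norm_triangle_ineq)
    finally have "2 * l \<le> norm (Z \<omega> - m)" using m_le by simp
    also have "\<dots> \<le> \<bar>Re (Z \<omega> - m)\<bar> + \<bar>Im (Z \<omega> - m)\<bar>" by (rule cmod_le)
    finally have "l \<le> \<bar>Re (Z \<omega> - m)\<bar> \<or> l \<le> \<bar>Im (Z \<omega> - m)\<bar>" by linarith
    then show "\<omega> \<in> E1 \<union> E2"
      using \<omega> \<rho>int by (auto simp: E1_def E2_def Z_def m_def)
  qed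
  then have "measure ?P ?E \<le> measure ?P (E1 \<union> E2)" by (intro P.finite_measure_mono) auto
  also have "\<dots> \<le> measure ?P E1 + measure ?P E2" by (intro measure_Un_le) auto
  also have "measure ?P E1 \<le> 2 * exp (- l\<^sup>2 / (2 * w))"
    unfolding E1_def using \<phi>_bound v_le v_sum w l J
    by (intro hoeffding_coordinates[OF \<rho>]) (auto intro: order_trans[OF abs_Re_le_cmod])
  also have "measure ?P E2 \<le> 2 * exp (- l\<^sup>2 / (2 * w))"
    unfolding E2_def using \<phi>_bound v_le v_sum w l J
    by (intro hoeffding_coordinates[OF \<rho>]) (auto intro: order_trans[OF abs_Im_le_cmod])
  finally show ?thesis by simp
qed

subsection \<open>Fourier decay of random images\<close>

lemma measure_PiM_fun_upd_le:
  fixes Q :: "'i \<Rightarrow> 'a measure"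
  assumes Q: "\<And>i. prob_space (Q i)" and B: "B \<in> sets (PiM UNIV Q)" and e: "0 \<le> e"
    and le: "\<And>X. measure (Q l) {y\<in>space (Q l). X(l := y) \<in> B} \<le> e"
  shows "measure (PiM UNIV Q) B \<le> e"
proof -
  let ?I = "UNIV - {l}" and ?g = "\<lambda>(y, X). X(l := y)"
  interpret Ql: prob_space "Q l" by (rule Q)
  interpret QI: prob_space "PiM ?I Q" by (intro prob_space_PiM Q)
  interpret QU: prob_space "PiM UNIV Q" by (intro prob_space_PiM Q)
  interpret pair_sigma_finite "Q l" "PiM ?I Q" ..
  have ins: "insert l ?I = UNIV" by auto
  have eq: "distr (Q l \<Otimes>\<^sub>M PiM ?I Q) (PiM UNIV Q) ?g = PiM UNIV Q"
    using distr_pair_PiM_eq_PiM[of ?I Q l] Q unfolding ins by blast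
  have "?g = (\<lambda>z. (snd z)(l := fst z))" by (simp add: case_prod_unfold)
  also have "\<dots> \<in> Q l \<Otimes>\<^sub>M PiM ?I Q \<rightarrow>\<^sub>M PiM UNIV Q"
    by (rule measurable_fun_upd[of _ ?I]) auto
  finally have g: "?g \<in> Q l \<Otimes>\<^sub>M PiM ?I Q \<rightarrow>\<^sub>M PiM UNIV Q" .
  let ?A = "?g -` B \<inter> space (Q l \<Otimes>\<^sub>M PiM ?I Q)"
  have A: "?A \<in> sets (Q l \<Otimes>\<^sub>M PiM ?I Q)" using g B by (rule measurable_sets)
  have "emeasure (PiM UNIV Q) B = emeasure (distr (Q l \<Otimes>\<^sub>M PiM ?I Q) (PiM UNIV Q) ?g) B"
    by (simp only: eq)
  also have "\<dots> = emeasure (Q l \<Otimes>\<^sub>M PiM ?I Q) ?A" by (rule emeasure_distr[OF g B])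
  also have "\<dots> = (\<integral>\<^sup>+ X. emeasure (Q l) ((\<lambda>y. (y, X)) -` ?A) \<partial>PiM ?I Q)"
    by (rule emeasure_pair_measure_alt2[OF A])
  also have "\<dots> \<le> (\<integral>\<^sup>+ X. ennreal e \<partial>PiM ?I Q)"
  proof (rule nn_integral_mono)
    fix X assume X: "X \<in> space (PiM ?I Q)"
    have "(\<lambda>y. (y, X)) -` ?A = {y\<in>space (Q l). X(l := y) \<in> B}"
      using X by (auto simp: space_pair_measure)
    then show "emeasure (Q l) ((\<lambda>y. (y, X)) -` ?A) \<le> ennreal e"
      using le[of X] by (simp add: Ql.emeasure_eq_measure ennreal_leI)
  qed
  also have "\<dots> = ennreal e" by (simp add: QI.emeasure_space_1)
  finally show ?thesis using e by (simp add: QU.emeasure_eq_measure)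
qed

definition level_space :: "(int \<Rightarrow> nat \<Rightarrow> real) measure" where
  "level_space = PiM UNIV (\<lambda>_. coin_space)"

text \<open>A nested product over levels, then cells, then uniform summands, so that a whole level
  is a single coordinate that can be resampled with the others frozen.\<close>

definition noise_space :: "(nat \<Rightarrow> int \<Rightarrow> nat \<Rightarrow> real) measure" where
  "noise_space = PiM UNIV (\<lambda>_. level_space)"

definition noise :: "(nat \<Rightarrow> int \<Rightarrow> nat \<Rightarrow> real) \<Rightarrow> nat \<Rightarrow> int \<Rightarrow> real" where
  "noise \<omega> l k = coin_sum l (\<omega> l k)"

lemma space_coin_space [simp]: "space coin_space = UNIV"
  by (simp add: coin_space_def space_PiM unit_uniform_def)

lemma space_level_space [simp]: "space level_space = UNIV"
  by (simp add: level_space_def space_PiM)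

lemma space_noise_space [simp]: "space noise_space = UNIV"
  by (simp add: noise_space_def space_PiM)

lemma prob_space_level_space: "prob_space level_space"
  unfolding level_space_def by (intro prob_space_PiM prob_space_coin_space)

lemma prob_space_noise_space: "prob_space noise_space"
  unfolding noise_space_def by (intro prob_space_PiM prob_space_level_space)

lemma noise_bounded: "\<bar>noise \<omega> l k\<bar> \<le> real (Suc l)"
  unfolding noise_def by (rule coin_sum_bounded)

lemma grid_measurable [measurable]: "grid l \<in> borel_measurable borel"
  unfolding grid_def by measurable

lemma poly_frac_measurable [measurable]: "(\<lambda>x. poly p (frac x)) \<in> borel_measurable borel" for p :: "real poly"
proof -
  have [measurable]: "poly p \<in> borel_measurable borel"
    by (intro borel_measurable_continuous_onI continuous_intros)
  show ?thesis unfolding frac_def by measurable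
qed

lemma perturbation_measurable [measurable]:
  "(\<lambda>z. perturbation p c \<beta> (noise (fst z)) (snd z)) \<in> borel_measurable (noise_space \<Otimes>\<^sub>M borel)"
proof -
  have 1 [measurable]: "(\<lambda>z. noise (fst z) l k) \<in> borel_measurable (noise_space \<Otimes>\<^sub>M (borel :: real measure))" for l k
  proof -
    have "(\<lambda>\<omega>. \<omega> l) \<in> noise_space \<rightarrow>\<^sub>M level_space" unfolding noise_space_def by measurable
    moreover have "(\<lambda>v. v k) \<in> level_space \<rightarrow>\<^sub>M coin_space" unfolding level_space_def by measurable
    ultimately show ?thesis unfolding noise_def by measurable
  qed
  \<comment> \<open>The index varies with the point, but takes only countably many values.\<close>
  have [measurable]: "(\<lambda>z. noise (fst z) l \<lfloor>grid l (snd z)\<rfloor>) \<in> borel_measurable (noise_space \<Otimes>\<^sub>M borel)" for l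
    by (rule measurable_compose_countable[of "\<lambda>k z. noise (fst z) l k"]) measurable
  show ?thesis unfolding perturbation_def bump_def by measurable
qed

lemma perturbation_measurable_snd [measurable]: "perturbation p c \<beta> (noise \<omega>) \<in> borel_measurable borel"
  using measurable_Pair2[OF perturbation_measurable, of \<omega>] by simp

lemma phase_integral_measurable:
  assumes \<mu>: "real_distribution \<mu>" and [measurable]: "S \<in> sets borel"
  shows "(\<lambda>\<omega>. CLINT x|\<mu>. indicator S x *\<^sub>R iexp (a * perturbation p c \<beta> (noise \<omega>) x)) \<in> borel_measurable noise_space"
proof -
  interpret real_distribution \<mu> by fact
  have "(\<lambda>z. indicator S (snd z) *\<^sub>R iexp (a * perturbation p c \<beta> (noise (fst z)) (snd z)))
      \<in> borel_measurable (noise_space \<Otimes>\<^sub>M \<mu>)"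
    using perturbation_measurable[of p c \<beta>] by measurable
  then show ?thesis by (intro borel_measurable_lebesgue_integral) (simp add: case_prod_unfold)
qed

lemma suminf_change_one:
  fixes a b :: "nat \<Rightarrow> real"
  assumes "summable a" "summable b" "\<And>i. i \<noteq> l \<Longrightarrow> a i = b i"
  shows "suminf b = suminf a - a l + b l"
proof -
  have "suminf b - suminf a = (\<Sum>i. b i - a i)" using assms by (intro suminf_diff) auto
  also have "\<dots> = (\<Sum>i\<in>{l}. b i - a i)" using assms(3) by (intro suminf_finite) auto
  finally show ?thesis by simp
qed

text \<open>Convergence for all admissible coefficients is what makes it legitimate to split a
  single level off the series.\<close>

definition perturbation_summable :: "real poly \<Rightarrow> real \<Rightarrow> real \<Rightarrow> bool" where
  "perturbation_summable p c \<beta> \<longleftrightarrow> (\<forall>X x. (\<forall>l k. \<bar>X l k\<bar> \<le> real (Suc l)) \<longrightarrow>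
     summable (\<lambda>l. amp c \<beta> l * bump p (X l) (grid l x)))"

lemma level_estimate:
  assumes \<mu>: "real_distribution \<mu>" and supp: "AE x in \<mu>. x \<in> {-R..R}" and S [measurable]: "S \<in> sets borel"
    and sm: "perturbation_summable p c \<beta>"
    and large: "\<And>x. x \<in> S \<Longrightarrow> 2 \<le> \<bar>a * (amp c \<beta> l * poly p (frac (grid l x)))\<bar>"
    and w: "0 < w" "\<And>k. measure \<mu> {x. \<lfloor>grid l x\<rfloor> = k} \<le> w" and r: "0 < r"
  shows "measure noise_space {\<omega>. (1 / 2) ^ Suc l + 2 * r \<le>
      norm (CLINT x|\<mu>. indicator S x *\<^sub>R iexp (a * perturbation p c \<beta> (noise \<omega>) x))} \<le> 4 * exp (- r\<^sup>2 / (2 * w))"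
    (is "measure _ ?B \<le> _")
  unfolding noise_space_def
proof (rule measure_PiM_fun_upd_le[where l=l])
  show "prob_space level_space" by (rule prob_space_level_space)
  have "{\<omega>\<in>space noise_space. (1 / 2) ^ Suc l + 2 * r \<le>
      norm (CLINT x|\<mu>. indicator S x *\<^sub>R iexp (a * perturbation p c \<beta> (noise \<omega>) x))} \<in> sets noise_space"
    using phase_integral_measurable[OF \<mu> S, of a p c \<beta>] by measurable
  then show "?B \<in> sets (PiM UNIV (\<lambda>_. level_space))" by (simp add: noise_space_def[symmetric])
  show "0 \<le> 4 * exp (- r\<^sup>2 / (2 * w))" by simp
  fix X
  \<comment> \<open>\<open>h\<close> holds the contributions of the identity and of all frozen
    levels; the resampled level enters the phase as its noise times \<open>u\<close>.\<close>
  define h where "h x = a * (perturbation p c \<beta> (noise X) x - amp c \<beta> l * bump p (noise X l) (grid l x))" for x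
  define u where "u x = a * (amp c \<beta> l * poly p (frac (grid l x)))" for x
  have split: "a * perturbation p c \<beta> (noise (X(l := y))) x = h x + coin_sum l (y \<lfloor>grid l x\<rfloor>) * u x" for y x
  proof -
    have "(\<Sum>i. amp c \<beta> i * bump p (noise (X(l := y)) i) (grid i x)) =
        (\<Sum>i. amp c \<beta> i * bump p (noise X i) (grid i x)) - amp c \<beta> l * bump p (noise X l) (grid l x)
        + amp c \<beta> l * bump p (noise (X(l := y)) l) (grid l x)"
    proof (rule suminf_change_one)
      have "summable (\<lambda>i. amp c \<beta> i * bump p (noise Y i) (grid i x))" for Y
        using sm noise_bounded unfolding perturbation_summable_def by blast
      then show "summable (\<lambda>i. amp c \<beta> i * bump p (noise X i) (grid i x))"
        "summable (\<lambda>i. amp c \<beta> i * bump p (noise (X(l := y)) i) (grid i x))" by blast+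
      show "amp c \<beta> i * bump p (noise X i) (grid i x) = amp c \<beta> i * bump p (noise (X(l := y)) i) (grid i x)"
        if "i \<noteq> l" for i
        using that by (simp add: bump_def noise_def)
    qed
    then have eq: "perturbation p c \<beta> (noise (X(l := y))) x = perturbation p c \<beta> (noise X) x
        - amp c \<beta> l * bump p (noise X l) (grid l x) + amp c \<beta> l * bump p (noise (X(l := y)) l) (grid l x)"
      unfolding perturbation_def by linarith
    show ?thesis
      unfolding eq h_def u_def bump_def noise_def by (simp add: algebra_simps)
  qed
  have [measurable]: "h \<in> borel_measurable borel" "u \<in> borel_measurable borel"
  proof -
    have [measurable]: "(\<lambda>x. noise X l \<lfloor>grid l x\<rfloor>) \<in> borel_measurable borel"
      by (rule measurable_compose[of "\<lambda>x. \<lfloor>grid l x\<rfloor>" _ "count_space UNIV"]) auto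
    show "h \<in> borel_measurable borel" unfolding h_def bump_def by measurable
    show "u \<in> borel_measurable borel" unfolding u_def by measurable
  qed
  have fin: "AE x in \<mu>. \<lfloor>grid l x\<rfloor> \<in> {\<lfloor>grid l (-R)\<rfloor>..\<lfloor>grid l R\<rfloor>}"
  proof -
    have mono: "grid l x \<le> grid l y" if "x \<le> y" for x y using that by (simp add: grid_def)
    show ?thesis by (rule eventually_mono[OF supp]) (auto intro!: floor_mono mono)
  qed
  have "measure (PiM UNIV (\<lambda>_. coin_space)) {y\<in>space (PiM UNIV (\<lambda>_::int. coin_space)). (1 / 2) ^ Suc l + 2 * r \<le>
      norm (CLINT x|\<mu>. indicator S x *\<^sub>R iexp (h x + coin_sum l (y \<lfloor>grid l x\<rfloor>) * u x))} \<le> 4 * exp (- r\<^sup>2 / (2 * w))"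
    by (rule integral_phase_concentration[OF \<mu> prob_space_coin_space _ _ _ _ S _ fin, where T=2])
      (use large w r char_coin_sum_bound in \<open>auto simp: u_def\<close>)
  then show "measure level_space {y\<in>space level_space. X(l := y) \<in> ?B} \<le> 4 * exp (- r\<^sup>2 / (2 * w))"
    unfolding level_space_def[symmetric] by (simp only: split mem_Collect_eq)
qed

text \<open>A cell of the shifted grid is the union of two cells of the next finer dyadic
  level.\<close>

lemma shifted_cell_measure:
  assumes \<mu>: "real_distribution \<mu>" and s: "0 \<le> s"
    and C: "\<And>n k. measure \<mu> (cell n k) \<le> C * 2 powr (- s * real n)"
  shows "measure \<mu> {x. \<lfloor>2 ^ j * x\<rfloor> = k} \<le> 2 * C * 2 powr (- s * real j)"
    and "measure \<mu> {x. \<lfloor>2 ^ j * x + 1 / 2\<rfloor> = k} \<le> 2 * C * 2 powr (- s * real j)"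
proof -
  interpret real_distribution \<mu> by fact
  have C0: "0 \<le> C" by (rule order_trans[OF measure_nonneg[of \<mu> "cell 0 0"]]) (use C[of 0 0] in simp)
  show "measure \<mu> {x. \<lfloor>2 ^ j * x\<rfloor> = k} \<le> 2 * C * 2 powr (- s * real j)"
    using C[of j k] mult_right_mono[OF _ powr_ge_zero, of C "2 * C" 2 "- s * real j"] C0
    unfolding cell_def by linarith
  have "{x. \<lfloor>2 ^ j * x + 1 / 2\<rfloor> = k} \<subseteq> cell (Suc j) (2 * k - 1) \<union> cell (Suc j) (2 * k)"
  proof
    fix x :: real assume "x \<in> {x. \<lfloor>2 ^ j * x + 1 / 2\<rfloor> = k}"
    moreover have "2 ^ Suc j * x = 2 * (2 ^ j * x)" by simp
    ultimately have "\<lfloor>2 ^ Suc j * x\<rfloor> = 2 * k - 1 \<or> \<lfloor>2 ^ Suc j * x\<rfloor> = 2 * k" by simp linarith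
    then show "x \<in> cell (Suc j) (2 * k - 1) \<union> cell (Suc j) (2 * k)" by (auto simp: cell_def)
  qed
  then have "measure \<mu> {x. \<lfloor>2 ^ j * x + 1 / 2\<rfloor> = k} \<le> measure \<mu> (cell (Suc j) (2 * k - 1) \<union> cell (Suc j) (2 * k))"
    by (intro finite_measure_mono) auto
  also have "\<dots> \<le> measure \<mu> (cell (Suc j) (2 * k - 1)) + measure \<mu> (cell (Suc j) (2 * k))"
    by (intro measure_Un_le) auto
  also have "\<dots> \<le> 2 * C * 2 powr (- s * real (Suc j))"
    using C[of "Suc j" "2 * k - 1"] C[of "Suc j" "2 * k"] by simp
  also have "\<dots> \<le> 2 * C * 2 powr (- s * real j)"
  proof (rule mult_left_mono)
    have "- s * real (Suc j) \<le> - s * real j" using s by (simp add: algebra_simps)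
    then show "2 powr (- s * real (Suc j)) \<le> 2 powr (- s * real j)" by (rule powr_mono) simp
  qed (use C0 in simp)
  finally show "measure \<mu> {x. \<lfloor>2 ^ j * x + 1 / 2\<rfloor> = k} \<le> 2 * C * 2 powr (- s * real j)" .
qed

text \<open>The line is split into the points in the middle half of their cell at level 2 j and the
  rest, which lie in the middle half of their cell at level 2 j + 1. Each part is randomised by its
  own level, with bumps bounded below by q.\<close>

lemma frequency_estimate:
  assumes \<mu>: "real_distribution \<mu>" and supp: "AE x in \<mu>. x \<in> {-R..R}"
    and sm: "perturbation_summable p c \<beta>" and c: "0 < c"
    and p: "\<And>t. t \<in> {1/4..3/4} \<Longrightarrow> q \<le> poly p t" "0 < q"
    and s: "0 \<le> s" and C: "0 < C" "\<And>n k. measure \<mu> (cell n k) \<le> C * 2 powr (- s * real n)"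
    and large: "2 \<le> \<bar>a\<bar> * (c * 2 powr (- \<beta> * real j) / (2 * real j + 2) ^ 3) * q"
    and r: "(1 / 2) ^ Suc (2 * j) \<le> r"
  shows "measure noise_space {\<omega>. 6 * r \<le> norm (CLINT x|\<mu>. iexp (a * perturbation p c \<beta> (noise \<omega>) x))}
     \<le> 8 * exp (- r\<^sup>2 / (4 * C * 2 powr (- s * real j)))"
proof -
  interpret \<mu>: real_distribution \<mu> by fact
  interpret N: prob_space noise_space by (rule prob_space_noise_space)
  define S :: "real set" where "S = {x. frac (2 ^ j * x) \<in> {1/4..3/4}}"
  have S [measurable]: "S \<in> sets borel" unfolding S_def frac_def by measurable
  have r0: "0 < r" using r by (rule less_le_trans[rotated]) simp
  define w where "w = 2 * C * 2 powr (- s * real j)"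
  have w: "0 < w" using C by (simp add: w_def)
  define I where "I A \<omega> = (CLINT x|\<mu>. indicator A x *\<^sub>R iexp (a * perturbation p c \<beta> (noise \<omega>) x))" for A \<omega>
  have grid0: "grid (2 * j) x = 2 ^ j * x" for x by (simp add: grid_def)
  have grid1: "grid (Suc (2 * j)) x = 2 ^ j * x + 1 / 2" for x by (simp add: grid_def)
  have amp: "c * 2 powr (- \<beta> * real j) / (2 * real j + 2) ^ 3 \<le> amp c \<beta> l" if "l = 2 * j \<or> l = Suc (2 * j)" for l
  proof -
    have "l div 2 = j" "real (Suc l) \<le> 2 * real j + 2" using that by auto
    then show ?thesis unfolding amp_def using c
      by (auto intro!: divide_left_mono power_mono mult_pos_pos zero_less_power)
  qed
  have big: "2 \<le> \<bar>a * (amp c \<beta> l * poly p t)\<bar>" if "l = 2 * j \<or> l = Suc (2 * j)" "t \<in> {1/4..3/4}" for l t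
  proof -
    have "2 \<le> \<bar>a\<bar> * (amp c \<beta> l * poly p t)"
    proof (rule order_trans[OF large])
      have "c * 2 powr (- \<beta> * real j) / (2 * real j + 2) ^ 3 * q \<le> amp c \<beta> l * poly p t"
        using amp[OF that(1)] p(1)[OF that(2)] p(2) c by (intro mult_mono) (auto simp: amp_def)
      then show "\<bar>a\<bar> * (c * 2 powr (- \<beta> * real j) / (2 * real j + 2) ^ 3) * q \<le> \<bar>a\<bar> * (amp c \<beta> l * poly p t)"
        by (simp only: mult.assoc) (intro mult_left_mono, auto)
    qed
    moreover have "0 \<le> amp c \<beta> l * poly p t"
      using c p(1)[OF that(2)] p(2) by (intro mult_nonneg_nonneg) (auto simp: amp_def)
    ultimately show ?thesis by (metis abs_mult abs_of_nonneg)
  qed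
  have "measure noise_space {\<omega>. (1 / 2) ^ Suc (2 * j) + 2 * r \<le> norm (I S \<omega>)} \<le> 4 * exp (- r\<^sup>2 / (2 * w))"
    unfolding I_def
  proof (rule level_estimate[OF \<mu> supp S sm _ w _ r0])
    show "2 \<le> \<bar>a * (amp c \<beta> (2 * j) * poly p (frac (grid (2 * j) x)))\<bar>" if "x \<in> S" for x
      using big[of "2 * j" "frac (grid (2 * j) x)"] that by (simp add: S_def grid0)
    show "measure \<mu> {x. \<lfloor>grid (2 * j) x\<rfloor> = k} \<le> w" for k
      unfolding grid0 w_def by (rule shifted_cell_measure(1)[OF \<mu> s C(2)])
  qed
  moreover have "measure noise_space {\<omega>. (1 / 2) ^ Suc (Suc (2 * j)) + 2 * r \<le> norm (I (- S) \<omega>)} \<le> 4 * exp (- r\<^sup>2 / (2 * w))"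
    unfolding I_def
  proof (rule level_estimate[OF \<mu> supp _ sm _ w _ r0])
    show "- S \<in> sets borel" by measurable
    show "2 \<le> \<bar>a * (amp c \<beta> (Suc (2 * j)) * poly p (frac (grid (Suc (2 * j)) x)))\<bar>" if "x \<in> - S" for x
    proof -
      \<comment> \<open>Shifting by half a cell moves the two outer quarters of a cell into the
        middle half.\<close>
      have "frac (2 ^ j * x + 1 / 2) \<in> {1/4..3/4}"
      proof -
        define y where "y = 2 ^ j * x"
        have "frac y < 1 / 4 \<or> frac y > 3 / 4" using that by (auto simp: S_def y_def)
        then have "frac (y + 1 / 2) \<in> {1/4..3/4}"
        proof
          assume y: "frac y < 1 / 4"
          then have "\<lfloor>y + 1 / 2\<rfloor> = \<lfloor>y\<rfloor>" unfolding frac_def by linarith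
          then show ?thesis using y frac_ge_0[of y] by (simp add: frac_def)
        next
          assume y: "3 / 4 < frac y"
          then have "\<lfloor>y + 1 / 2\<rfloor> = \<lfloor>y\<rfloor> + 1" unfolding frac_def by linarith
          then show ?thesis using y frac_lt_1[of y] by (simp add: frac_def)
        qed
        then show ?thesis by (simp add: y_def)
      qed
      then show ?thesis using big[of "Suc (2 * j)" "frac (grid (Suc (2 * j)) x)"] by (simp add: grid1)
    qed
    show "measure \<mu> {x. \<lfloor>grid (Suc (2 * j)) x\<rfloor> = k} \<le> w" for k
      unfolding grid1 w_def by (rule shifted_cell_measure(2)[OF \<mu> s C(2)])
  qed
  moreover have "measure noise_space {\<omega>. 6 * r \<le> norm (CLINT x|\<mu>. iexp (a * perturbation p c \<beta> (noise \<omega>) x))} \<le>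
      measure noise_space {\<omega>. (1 / 2) ^ Suc (2 * j) + 2 * r \<le> norm (I S \<omega>)} +
      measure noise_space {\<omega>. (1 / 2) ^ Suc (Suc (2 * j)) + 2 * r \<le> norm (I (- S) \<omega>)}"
  proof -
    have meas: "{\<omega>. r \<le> norm (I A \<omega>)} \<in> sets noise_space" if "A \<in> sets borel" for r A
    proof -
      have "{\<omega>\<in>space noise_space. r \<le> norm (I A \<omega>)} \<in> sets noise_space"
        unfolding I_def using phase_integral_measurable[OF \<mu> that, of a p c \<beta>] by measurable
      then show ?thesis by simp
    qed
    have eq: "(CLINT x|\<mu>. iexp (a * perturbation p c \<beta> (noise \<omega>) x)) = I S \<omega> + I (- S) \<omega>" for \<omega>
    proof -
      have int: "integrable \<mu> (\<lambda>x. indicator A x *\<^sub>R iexp (a * perturbation p c \<beta> (noise \<omega>) x))"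
        if [measurable]: "A \<in> sets borel" for A
        by (intro \<mu>.integrable_const_bound[of _ 1]) (auto split: split_indicator)
      have "I S \<omega> + I (- S) \<omega> = (CLINT x|\<mu>. indicator S x *\<^sub>R iexp (a * perturbation p c \<beta> (noise \<omega>) x)
          + indicator (- S) x *\<^sub>R iexp (a * perturbation p c \<beta> (noise \<omega>) x))"
        unfolding I_def by (intro Bochner_Integration.integral_add[symmetric] int) auto
      also have "\<dots> = (CLINT x|\<mu>. iexp (a * perturbation p c \<beta> (noise \<omega>) x))"
        by (intro Bochner_Integration.integral_cong) (auto split: split_indicator)
      finally show ?thesis ..
    qed
    \<comment> \<open>Outside both events each part contributes less than r + 2 r, since (1/2)^Suc l
      is at most r at either level.\<close>
    have "{\<omega>. 6 * r \<le> norm (CLINT x|\<mu>. iexp (a * perturbation p c \<beta> (noise \<omega>) x))} \<subseteq>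
        {\<omega>. (1 / 2) ^ Suc (2 * j) + 2 * r \<le> norm (I S \<omega>)} \<union>
        {\<omega>. (1 / 2) ^ Suc (Suc (2 * j)) + 2 * r \<le> norm (I (- S) \<omega>)}"
    proof
      fix \<omega> assume "\<omega> \<in> {\<omega>. 6 * r \<le> norm (CLINT x|\<mu>. iexp (a * perturbation p c \<beta> (noise \<omega>) x))}"
      then have "6 * r \<le> norm (I S \<omega>) + norm (I (- S) \<omega>)"
        unfolding eq using norm_triangle_ineq[of "I S \<omega>" "I (- S) \<omega>"] by simp
      moreover have "(1 / 2) ^ Suc (Suc (2 * j)) \<le> r"
        using r r0 by simp
      ultimately show "\<omega> \<in> {\<omega>. (1 / 2) ^ Suc (2 * j) + 2 * r \<le> norm (I S \<omega>)} \<union>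
          {\<omega>. (1 / 2) ^ Suc (Suc (2 * j)) + 2 * r \<le> norm (I (- S) \<omega>)}"
        using r by simp linarith
    qed
    then show ?thesis
      by (intro order_trans[OF N.finite_measure_mono measure_Un_le]) (auto intro!: meas sets.Un)
  qed
  ultimately have "measure noise_space {\<omega>. 6 * r \<le> norm (CLINT x|\<mu>. iexp (a * perturbation p c \<beta> (noise \<omega>) x))}
      \<le> 8 * exp (- r\<^sup>2 / (2 * w))" by linarith
  moreover have "2 * w = 4 * C * 2 powr (- s * real j)" by (simp add: w_def)
  ultimately show ?thesis by (simp only:)
qed

text \<open>At |\<xi>| = sqrt n the target n^(-t/4) is |\<xi>|^(-t/2). Three asymptotic inequalities
  put the hypotheses of \<open>frequency_estimate\<close> in force and make the probabilities
  summable.\<close>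

lemma decay_AE:
  assumes \<mu>: "real_distribution \<mu>" and supp: "AE x in \<mu>. x \<in> {-R..R}"
    and sm: "perturbation_summable p c \<beta>" and c: "0 < c"
    and p: "\<And>t. t \<in> {1/4..3/4} \<Longrightarrow> q \<le> poly p t" "0 < q"
    and s: "0 < s" "s \<le> 1" and C: "0 < C" "\<And>n k. measure \<mu> (cell n k) \<le> C * 2 powr (- s * real n)"
    and \<beta>: "0 < \<beta>" and t: "0 < t" "t < s / \<beta>"
  shows "AE \<omega> in noise_space. \<forall>\<^sub>F n in sequentially.
    norm (CLINT x|\<mu>. iexp ((- 2 * pi * sqrt (real n)) * perturbation p c \<beta> (noise \<omega>) x)) \<le> 6 * real n powr (- (t / 4))"
proof -
  interpret N: prob_space noise_space by (rule prob_space_noise_space)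
  have "t / s < 1 / \<beta>" using t s \<beta> by (simp add: field_simps)
  \<comment> \<open>The number \<tau> relates scale and frequency by 2^j = |\<xi>|^\<tau>, up to
    rounding; its two bounds are the two competing demands on j.\<close>
  then obtain \<tau> where "t / s < \<tau>" "\<tau> < 1 / \<beta>" using dense by blast
  then have \<tau>: "t < s * \<tau>" "\<beta> * \<tau> < 1" using s \<beta> by (simp_all add: field_simps)
  have \<tau>0: "0 < \<tau>" using \<tau>(1) t(1) s by (metis less_trans zero_less_mult_pos)
  have "s * \<tau> \<le> 1 * \<tau>" using s \<tau>0 by (intro mult_right_mono) auto
  then have t\<tau>: "t / 4 < \<tau>" using \<tau>(1) t(1) by simp
  \<comment> \<open>The factor 1/2 appears because the frequency is sqrt n.\<close>
  define j where "j n = nat \<lfloor>\<tau> / 2 * log 2 (real n)\<rfloor>" for n :: nat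
  define r where "r n = real n powr (- (t / 4))" for n :: nat
  define E where "E n = {\<omega>. 6 * r n \<le> norm (CLINT x|\<mu>. iexp ((- 2 * pi * sqrt (real n)) * perturbation p c \<beta> (noise \<omega>) x))}" for n
  have Em: "E n \<in> sets noise_space" for n
  proof -
    have "{\<omega>\<in>space noise_space. 6 * r n \<le> norm (CLINT x|\<mu>. indicator UNIV x *\<^sub>R iexp ((- 2 * pi * sqrt (real n)) * perturbation p c \<beta> (noise \<omega>) x))} \<in> sets noise_space"
      using phase_integral_measurable[OF \<mu>, of UNIV "- 2 * pi * sqrt (real n)" p c \<beta>] by measurable
    then show ?thesis by (simp add: E_def)
  qed
  \<comment> \<open>Large phases: \<beta> \<tau> < 1 leaves a positive power of n, which beats the
    cubed logarithm from \<open>amp\<close>.\<close>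
  have ev1: "\<forall>\<^sub>F n in sequentially. 2 \<le> (2 * pi * c * q) * real n powr (1 / 2 - \<beta> * \<tau> / 2) / (\<tau> * log 2 (real n) + 2) ^ 3"
  proof -
    have "0 < 2 * pi * c * q" "0 < 1 / 2 - \<beta> * \<tau> / 2" using c p(2) \<tau>(2) by auto
    then show ?thesis using \<tau>0 by real_asymp
  qed
  \<comment> \<open>Small means: the bound 2^(-2 j - 1) of the characteristic functions is of order
    n^(-\<tau>), below the target.\<close>
  have ev2: "\<forall>\<^sub>F n in sequentially. 4 * real n powr (- \<tau>) \<le> real n powr (- (t / 4))"
    using t\<tau> by real_asymp
  \<comment> \<open>Small probabilities: t < s \<tau> puts a positive power of n into the exponent.
    One factor 2 in 8 C comes from rounding j down.\<close>
  have ev3: "\<forall>\<^sub>F n in sequentially. 8 * exp (- ((1 / (8 * C)) * real n powr ((s * \<tau> - t) / 2))) \<le> 1 / real n ^ 2"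
  proof -
    have "0 < 1 / (8 * C)" "0 < (s * \<tau> - t) / 2" using C(1) \<tau>(1) by auto
    then show ?thesis by real_asymp
  qed
  have "\<forall>\<^sub>F n in sequentially. norm (measure noise_space (E n)) \<le> inverse (real n ^ 2)"
    using ev1 ev2 ev3 eventually_ge_at_top[of 1]
  proof eventually_elim
    case (elim n)
    define y where "y = \<tau> / 2 * log 2 (real n)"
    have n: "0 < real n" and y0: "0 \<le> y" using elim \<tau>0 by (auto simp: y_def)
    have jy: "real (j n) \<le> y" "y < real (j n) + 1"
      using y0 unfolding j_def y_def[symmetric] by linarith+
    have pw: "2 powr (a * y) = real n powr (a * \<tau> / 2)" for a
    proof -
      have "2 powr (a * y) = (2 powr log 2 (real n)) powr (a * \<tau> / 2)"
        by (simp add: powr_powr y_def mult_ac)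
      then show ?thesis using n by simp
    qed
    have small\<beta>: "real n powr (- \<beta> * \<tau> / 2) \<le> 2 powr (- \<beta> * real (j n))"
      unfolding pw[symmetric] using jy \<beta> by (intro powr_mono) auto
    have "2 powr (- s * real (j n)) \<le> 2 powr (1 + - s * y)"
    proof (intro powr_mono)
      have "s * y \<le> s * (real (j n) + 1)" using jy s by (intro mult_left_mono) auto
      then show "- s * real (j n) \<le> 1 + - s * y" using s by (simp add: algebra_simps)
    qed simp
    also have "\<dots> = 2 * real n powr (- s * \<tau> / 2)" by (simp only: powr_add pw) simp
    finally have sj: "2 powr (- s * real (j n)) \<le> 2 * real n powr (- s * \<tau> / 2)" .
    have large: "2 \<le> \<bar>- 2 * pi * sqrt (real n)\<bar> * (c * 2 powr (- \<beta> * real (j n)) / (2 * real (j n) + 2) ^ 3) * q"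
    proof -
      have "2 \<le> (2 * pi * c * q) * (real n powr (1 / 2) * real n powr (- \<beta> * \<tau> / 2)) / (\<tau> * log 2 (real n) + 2) ^ 3"
        using elim(1) by (simp add: powr_add[symmetric] diff_divide_distrib)
      also have "\<dots> \<le> (2 * pi * c * q) * (real n powr (1 / 2) * 2 powr (- \<beta> * real (j n))) / (2 * real (j n) + 2) ^ 3"
      proof (intro frac_le mult_left_mono power_mono small\<beta>)
        show "2 * real (j n) + 2 \<le> \<tau> * log 2 (real n) + 2" using jy(1) by (simp add: y_def)
      qed (use c p(2) in auto)
      also have "\<dots> = \<bar>- 2 * pi * sqrt (real n)\<bar> * (c * 2 powr (- \<beta> * real (j n)) / (2 * real (j n) + 2) ^ 3) * q"
        using n by (simp add: powr_half_sqrt abs_mult)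
      finally show ?thesis .
    qed
    have "(1 / 2) ^ Suc (2 * j n) = 2 powr (- real (Suc (2 * j n)))"
      by (simp add: powr_minus powr_realpow power_divide inverse_eq_divide del: of_nat_Suc)
    also have "\<dots> \<le> 2 powr (1 + (- 2) * y)"
      using jy by (intro powr_mono) auto
    also have "\<dots> = 2 * real n powr (- \<tau>)" by (simp only: powr_add pw) simp
    also have "\<dots> \<le> 4 * real n powr (- \<tau>)" by simp
    also have "\<dots> \<le> r n" using elim(2) by (simp add: r_def)
    finally have rj: "(1 / 2) ^ Suc (2 * j n) \<le> r n" .
    have "measure noise_space (E n) \<le> 8 * exp (- (r n)\<^sup>2 / (4 * C * 2 powr (- s * real (j n))))"
      unfolding E_def using frequency_estimate[OF \<mu> supp sm c p _ C large rj] s by simp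
    also have "\<dots> \<le> 8 * exp (- ((1 / (8 * C)) * real n powr ((s * \<tau> - t) / 2)))"
    proof -
      have "(1 / (8 * C)) * real n powr ((s * \<tau> - t) / 2) = (r n)\<^sup>2 / (4 * C * (2 * real n powr (- s * \<tau> / 2)))"
      proof -
        have "(r n)\<^sup>2 = real n powr (- (t / 2))"
          unfolding r_def power2_eq_square by (simp add: powr_add[symmetric])
        then have eq: "(r n)\<^sup>2 / real n powr (- s * \<tau> / 2) = real n powr ((s * \<tau> - t) / 2)"
          by (simp add: powr_diff[symmetric] diff_divide_distrib)
        show ?thesis unfolding eq[symmetric] by simp
      qed
      also have "\<dots> \<le> (r n)\<^sup>2 / (4 * C * 2 powr (- s * real (j n)))"
        using sj C(1) n by (intro divide_left_mono mult_left_mono mult_pos_pos) auto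
      finally show ?thesis by simp
    qed
    also have "\<dots> \<le> 1 / real n ^ 2" by (rule elim(3))
    finally show ?case by (simp add: inverse_eq_divide)
  qed
  then have "summable (\<lambda>n. measure noise_space (E n))"
    by (rule summable_comparison_test_ev) (rule inverse_power_summable, simp)
  then have "AE \<omega> in noise_space. \<forall>\<^sub>F n in sequentially. \<omega> \<in> space noise_space - E n"
    using Em by (intro borel_cantelli_AE1) (auto simp: N.emeasure_eq_measure)
  then show ?thesis
    by eventually_elim (auto elim!: eventually_mono simp: E_def r_def)
qed

section \<open>From sampled frequencies to Fourier dimension\<close>

lemma char_lipschitz:
  assumes \<nu>: "real_distribution \<nu>" and L: "AE y in \<nu>. \<bar>y\<bar> \<le> L"
  shows "norm (char \<nu> u - char \<nu> v) \<le> L * \<bar>u - v\<bar>"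
proof -
  interpret real_distribution \<nu> by fact
  have int: "integrable \<nu> (\<lambda>y. iexp (u * y))" for u
    by (intro integrable_const_bound[of _ 1]) auto
  have "char \<nu> u - char \<nu> v = (CLINT y|\<nu>. iexp (u * y) - iexp (v * y))"
    unfolding char_def by (intro Bochner_Integration.integral_diff[symmetric] int)
  also have "norm \<dots> \<le> (LINT y|\<nu>. norm (iexp (u * y) - iexp (v * y)))" by (rule integral_norm_bound)
  also have "\<dots> \<le> (LINT y|\<nu>. L * \<bar>u - v\<bar>)"
  proof (rule integral_mono_AE)
    show "integrable \<nu> (\<lambda>y. norm (iexp (u * y) - iexp (v * y)))"
      by (intro integrable_norm Bochner_Integration.integrable_diff int)
    show "AE y in \<nu>. norm (iexp (u * y) - iexp (v * y)) \<le> L * \<bar>u - v\<bar>"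
      using L
    proof eventually_elim
      case (elim y)
      have "iexp (u * y) - iexp (v * y) = iexp (v * y) * (iexp ((u - v) * y) - 1)"
        by (simp add: algebra_simps exp_add[symmetric])
      then have "norm (iexp (u * y) - iexp (v * y)) = norm (iexp ((u - v) * y) - 1)"
        by (simp add: norm_mult del: of_real_mult)
      also have "\<dots> \<le> \<bar>(u - v) * y\<bar>" using iexp_approx1[of "(u - v) * y" 0] by simp
      also have "\<dots> \<le> L * \<bar>u - v\<bar>" using elim by (simp add: abs_mult mult.commute[of "\<bar>u - v\<bar>"] mult_right_mono)
      finally show ?case .
    qed
  qed simp
  finally show ?thesis using prob_space by simp
qed

lemma norm_char_minus: "norm (char \<nu> (- u)) = norm (char \<nu> u)"
proof -
  have "char \<nu> (- u) = (CLINT y|\<nu>. cnj (iexp (u * y)))"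
    unfolding char_def by (simp add: exp_cnj)
  then show ?thesis unfolding char_def using Bochner_Integration.integral_cnj[of \<nu> "\<lambda>y. iexp (u * y)"] by (metis complex_mod_cnj)
qed

text \<open>A frequency x lies within 1/x of the sampled frequency y = sqrt n with n the integer
  part of x^2. The Lipschitz bound makes the error of order 1/x, which x^(-t/2) dominates because t
  \<le> 1.\<close>

lemma fourier_dim_measure_ge:
  assumes \<nu>: "real_distribution \<nu>" and L: "AE y in \<nu>. \<bar>y\<bar> \<le> L" and t: "0 < t" "t \<le> 1"
    and decay: "\<forall>\<^sub>F n in sequentially. norm (char \<nu> (- 2 * pi * sqrt (real n))) \<le> 6 * real n powr (- (t / 4))"
  shows "t \<le> fourier_dim_measure \<nu>"
proof -
  interpret real_distribution \<nu> by fact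
  have L0: "0 \<le> L"
  proof (rule ccontr)
    assume "\<not> 0 \<le> L"
    then have "AE y in \<nu>. False" by (intro eventually_mono[OF L]) linarith
    then show False by simp
  qed
  define G where "G \<xi> = norm (char \<nu> (- 2 * pi * \<xi>))" for \<xi>
  have G1: "G \<xi> \<le> 1" for \<xi> unfolding G_def by (rule cmod_char_le_1)
  have Gabs: "G \<bar>\<xi>\<bar> = G \<xi>" for \<xi>
    using norm_char_minus[of \<nu> "- 2 * pi * \<xi>"] by (cases "0 \<le> \<xi>") (auto simp: G_def)
  obtain n0 where n0: "\<And>n. n0 \<le> n \<Longrightarrow> G (sqrt (real n)) \<le> 6 * real n powr (- (t / 4))"
    using decay unfolding G_def eventually_sequentially by blast
  \<comment> \<open>Beyond this threshold the integer part n of x^2 is at least n0, and x > 2 gives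
    n \<ge> x^2 / 2.\<close>
  define X where "X = max 2 (sqrt (real n0 + 1))"
  \<comment> \<open>The first entry serves small frequencies through the trivial bound 1. In the
    second, 12 is 6 times a bound 2 for 2^(t/4), the loss in passing from n to x^2.\<close>
  define K where "K = max (X powr (t / 2)) (12 + 2 * pi * L)"
  have "G \<xi> * \<bar>\<xi>\<bar> powr (t / 2) \<le> K" for \<xi>
  proof (cases "\<bar>\<xi>\<bar> \<le> X")
    case True
    have "G \<xi> * \<bar>\<xi>\<bar> powr (t / 2) \<le> 1 * X powr (t / 2)"
      using True t by (intro mult_mono G1 powr_mono2) auto
    then show ?thesis by (simp add: K_def)
  next
    case False
    define x where "x = \<bar>\<xi>\<bar>"
    have x: "2 < x" "sqrt (real n0 + 1) < x" using False by (auto simp: X_def x_def)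
    define n where "n = nat \<lfloor>x\<^sup>2\<rfloor>"
    have "2\<^sup>2 < x\<^sup>2" using x by (intro power_strict_mono) auto
    then have x2: "4 < x\<^sup>2" by simp
    have n: "real n \<le> x\<^sup>2" "x\<^sup>2 < real n + 1" using x2 unfolding n_def by linarith+
    have "(sqrt (real n0 + 1))\<^sup>2 < x\<^sup>2" using x(2) by (intro power_strict_mono) auto
    then have "real n0 + 1 < x\<^sup>2" by simp
    then have "n0 \<le> n" using n by linarith
    have nx: "x\<^sup>2 / 2 \<le> real n" using n x2 by linarith
    define y where "y = sqrt (real n)"
    have y: "0 \<le> y" "y \<le> x" "y\<^sup>2 = real n" using n x by (auto simp: y_def real_le_lsqrt)
    have "(x - y) * x \<le> (x - y) * (x + y)" using y by (intro mult_left_mono) auto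
    also have "\<dots> = x\<^sup>2 - y\<^sup>2" by (simp add: power2_eq_square algebra_simps)
    also have "\<dots> \<le> 1" using n y by simp
    finally have xy: "x - y \<le> 1 / x" using x by (simp add: le_divide_eq)
    have "G x \<le> G y + norm (char \<nu> (- 2 * pi * x) - char \<nu> (- 2 * pi * y))"
      unfolding G_def using norm_triangle_ineq2 by (simp add: norm_triangle_sub)
    also have "\<dots> \<le> G y + L * \<bar>- 2 * pi * x - (- 2 * pi * y)\<bar>"
      by (intro add_left_mono char_lipschitz[OF \<nu> L])
    also have "\<bar>- 2 * pi * x - (- 2 * pi * y)\<bar> = 2 * pi * (x - y)"
      using y by (simp add: abs_if algebra_simps)
    also have "G y + L * (2 * pi * (x - y)) \<le> 6 * real n powr (- (t / 4)) + L * (2 * pi * (1 / x))"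
      using n0[OF \<open>n0 \<le> n\<close>] xy L0 unfolding y_def by (intro add_mono mult_left_mono) auto
    also have "\<dots> \<le> 6 * (2 * x powr (- (t / 2))) + L * (2 * pi * x powr (- (t / 2)))"
    proof (intro add_mono mult_left_mono)
      have "real n powr (- (t / 4)) \<le> (x\<^sup>2 / 2) powr (- (t / 4))"
        using nx x t by (intro powr_mono2') auto
      also have "\<dots> = x powr (- (t / 2)) * 2 powr (t / 4)"
      proof -
        have "x\<^sup>2 / 2 = x powr 2 * 2 powr (- 1)" using x by (simp add: powr_minus)
        then have "(x\<^sup>2 / 2) powr (- (t / 4)) = (x powr 2) powr (- (t / 4)) * (2 powr (- 1)) powr (- (t / 4))"
          by (simp only: powr_mult)
        also have "\<dots> = x powr (2 * (- (t / 4))) * 2 powr ((- 1) * (- (t / 4)))"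
          by (simp only: powr_powr)
        finally show ?thesis by simp
      qed
      also have "\<dots> \<le> x powr (- (t / 2)) * 2 powr 1"
        using t by (intro mult_left_mono powr_mono) auto
      finally show "real n powr (- (t / 4)) \<le> 2 * x powr (- (t / 2))" by (simp add: mult.commute)
      have "x powr (- 1) \<le> x powr (- (t / 2))" using x t by (intro powr_mono) auto
      then show "1 / x \<le> x powr (- (t / 2))" using x by (simp add: powr_minus_divide)
    qed (use L0 in auto)
    also have "\<dots> = (12 + 2 * pi * L) * x powr (- (t / 2))" by (simp add: algebra_simps)
    finally have "G x * x powr (t / 2) \<le> (12 + 2 * pi * L) * x powr (- (t / 2)) * x powr (t / 2)"
      by (intro mult_right_mono) auto
    also have "\<dots> = 12 + 2 * pi * L" using x by (simp add: powr_minus)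
    finally show ?thesis by (simp add: K_def x_def Gabs)
  qed
  then have "bounded (range (\<lambda>\<xi>. G \<xi> * \<bar>\<xi>\<bar> powr (t / 2)))"
    by (intro boundedI[where B=K]) (auto simp: G_def abs_mult)
  then have "t \<in> {s \<in> {0..1}. bounded (range (\<lambda>\<xi>. cmod (fourier_transform \<nu> \<xi>) * \<bar>\<xi>\<bar> powr (s / 2)))}"
    using t by (simp add: G_def fourier_transform_eq_char)
  then show ?thesis
    unfolding fourier_dim_measure_def by (rule cSup_upper) (rule bdd_aboveI[of _ 1], auto)
qed

lemma fourier_dim_ge:
  assumes "prob_space \<nu>" "sets \<nu> = sets borel" "measure \<nu> F = 1"
  shows "fourier_dim_measure \<nu> \<le> fourier_dim F"
proof -
  have "F \<noteq> {}" using assms(3) by auto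
  moreover have "fourier_dim_measure \<nu> \<le> Sup {fourier_dim_measure \<mu> | \<mu>. prob_space \<mu> \<and> sets \<mu> = sets borel \<and> measure \<mu> F = 1}"
  proof (rule cSup_upper)
    show "bdd_above {fourier_dim_measure \<mu> | \<mu>. prob_space \<mu> \<and> sets \<mu> = sets borel \<and> measure \<mu> F = 1}"
      using fourier_dim_measure_range by (intro bdd_aboveI[of _ 1]) auto
  qed (use assms in blast)
  ultimately show ?thesis by (simp add: fourier_dim_def)
qed

lemma fourier_dim_nonneg:
  assumes "F \<in> sets borel"
  shows "0 \<le> fourier_dim F"
proof (cases "F = {}")
  case False
  then obtain a where a: "a \<in> F" by blast
  interpret prob_space "return borel a" by (rule prob_space_return) simp
  have "measure (return borel a) F = 1" using a assms by (simp add: measure_return)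
  then have "fourier_dim_measure (return borel a) \<le> fourier_dim F"
    by (intro fourier_dim_ge prob_space_axioms) auto
  moreover have "0 \<le> fourier_dim_measure (return borel a)"
    using fourier_dim_measure_range[OF prob_space_axioms] by simp
  ultimately show ?thesis by simp
qed (simp add: fourier_dim_def)

text \<open>About 2 R 2^n cells of level n meet [-R, R], so for s > 1 the total mass would be at
  most a multiple of 2^((1 - s) n), which tends to 0. The bound keeps the decay exponents in the
  range [0, 1] over which Fourier dimension is taken.\<close>

lemma frostman_exponent_le_1:
  assumes \<mu>: "real_distribution \<mu>" and R: "measure \<mu> {-R..R} = 1"
    and C: "\<And>n k. measure \<mu> (cell n k) \<le> C * 2 powr (- s * real n)"
  shows "s \<le> 1"
proof (rule ccontr)
  assume "\<not> s \<le> 1"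
  then have s: "1 < s" by simp
  interpret real_distribution \<mu> by fact
  have C0: "0 \<le> C" by (rule order_trans[OF measure_nonneg[of \<mu> "cell 0 0"]]) (use C[of 0 0] in simp)
  have "{-R..R} \<noteq> {}" using R by (metis measure_empty zero_neq_one)
  then have R0: "0 \<le> R" by simp
  have bound: "1 \<le> (2 * R * 2 ^ n + 2) * (C * 2 powr (- s * real n))" for n
  proof -
    define J where "J = {\<lfloor>2 ^ n * (-R)\<rfloor>..\<lfloor>2 ^ n * R\<rfloor>}"
    have "{-R..R} \<subseteq> (\<Union>k\<in>J. cell n k)"
    proof
      fix x assume "x \<in> {-R..R}"
      then have "\<lfloor>2 ^ n * x\<rfloor> \<in> J" unfolding J_def atLeastAtMost_iff by (intro conjI floor_mono mult_left_mono) auto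
      then show "x \<in> (\<Union>k\<in>J. cell n k)" by (auto simp: cell_def)
    qed
    then have "1 \<le> measure \<mu> (\<Union>k\<in>J. cell n k)"
      unfolding R[symmetric] by (intro finite_measure_mono) (auto simp: J_def)
    also have "\<dots> \<le> (\<Sum>k\<in>J. measure \<mu> (cell n k))"
      by (intro measure_UNION_le) (auto simp: J_def)
    also have "\<dots> \<le> (\<Sum>k\<in>J. C * 2 powr (- s * real n))" by (intro sum_mono C)
    also have "\<dots> = real (card J) * (C * 2 powr (- s * real n))" by simp
    also have "\<dots> \<le> (2 * R * 2 ^ n + 2) * (C * 2 powr (- s * real n))"
    proof (rule mult_right_mono)
      have "real_of_int (\<lfloor>2 ^ n * R\<rfloor> + 1 - \<lfloor>2 ^ n * (-R)\<rfloor>) \<le> 2 * (2 ^ n * R) + 2" by linarith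
      moreover have "0 \<le> 2 ^ n * R" using R0 by simp
      ultimately show "real (card J) \<le> 2 * R * 2 ^ n + 2" by (simp add: J_def mult_ac)
    qed (use C0 in simp)
    finally show ?thesis .
  qed
  have "(\<lambda>n. (2 * R * 2 ^ n + 2) * (C * 2 powr (- s * real n))) \<longlonglongrightarrow> 0"
  proof -
    have "(\<lambda>n. 2 * R * C * 2 powr ((1 - s) * real n) + 2 * C * 2 powr (- s * real n)) \<longlonglongrightarrow> 2 * R * C * 0 + 2 * C * 0"
    proof (intro tendsto_add tendsto_mult tendsto_const)
      define e where "e = s - 1"
      have e: "0 < e" "1 - s = - e" using s by (simp_all add: e_def)
      show "(\<lambda>n. 2 powr ((1 - s) * real n)) \<longlonglongrightarrow> 0" unfolding e(2) using e(1) by real_asymp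
      show "(\<lambda>n. 2 powr (- s * real n)) \<longlonglongrightarrow> 0" using s by real_asymp
    qed
    moreover have "(2 * R * 2 ^ n + 2) * (C * 2 powr (- s * real n)) = 2 * R * C * 2 powr ((1 - s) * real n) + 2 * C * 2 powr (- s * real n)" for n
      by (simp add: left_diff_distrib powr_diff powr_minus powr_realpow field_simps)
    ultimately show ?thesis by simp
  qed
  then have "(1 :: real) \<le> 0" by (rule LIMSEQ_le_const) (use bound in auto)
  then show False by simp
qed

lemma bij_image_eq_vimage_inv: "bij f \<Longrightarrow> f ` A = inv f -` A"
  by (metis bij_imp_bij_inv bij_vimage_eq_inv_image inv_inv_eq)

lemma diffeomorphism_continuous:
  assumes "diffeomorphism m \<alpha> f" "1 \<le> m"
  shows "continuous_on UNIV f" "continuous_on UNIV (inv f)" "bij f"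
proof -
  have f: "times_cont_differentiable m f" "times_cont_differentiable m (inv f)"
    using assms(1) by (simp_all add: diffeomorphism_def)
  have "continuous_on UNIV g" if "times_cont_differentiable m g" for g
  proof -
    have "(deriv ^^ 0) g differentiable_on UNIV"
      using that assms(2) unfolding times_cont_differentiable_def by (elim conjE allE[of _ 0] impE) auto
    then show ?thesis by (simp add: differentiable_imp_continuous_on)
  qed
  then show "continuous_on UNIV f" "continuous_on UNIV (inv f)" using f by blast+
  show "bij f" using assms(1) by (simp add: diffeomorphism_def)
qed

text \<open>The image of F is Borel as the preimage of F under the continuous inverse, and the
  pushed-forward measure has bounded support because f maps [-R, R] to a compact set.\<close>

lemma fourier_dim_image_ge:
  assumes \<mu>: "real_distribution \<mu>" and F: "F \<in> sets borel" "measure \<mu> F = 1" and supp: "AE x in \<mu>. x \<in> {-R..R}"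
    and f: "continuous_on UNIV f" "continuous_on UNIV (inv f)" "bij f" and t: "0 < t" "t \<le> 1"
    and decay: "\<forall>\<^sub>F n in sequentially. norm (CLINT x|\<mu>. iexp ((- 2 * pi * sqrt (real n)) * f x)) \<le> 6 * real n powr (- (t / 4))"
  shows "t \<le> fourier_dim (f ` F)"
proof -
  interpret real_distribution \<mu> by fact
  have fm [measurable]: "f \<in> borel_measurable borel" using f(1) by (rule borel_measurable_continuous_onI)
  have gm: "inv f \<in> borel_measurable borel" using f(2) by (rule borel_measurable_continuous_onI)
  define \<nu> where "\<nu> = distr \<mu> borel f"
  have \<nu>: "real_distribution \<nu>" unfolding \<nu>_def by (rule real_distribution_distr) simp
  interpret \<nu>: real_distribution \<nu> by fact
  have "compact (f ` {-R..R})"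
    using f(1) by (intro compact_continuous_image) (auto intro: continuous_on_subset)
  then obtain L where L: "\<And>x. x \<in> {-R..R} \<Longrightarrow> \<bar>f x\<bar> \<le> L"
    by (fastforce dest: compact_imp_bounded simp: bounded_iff)
  have "AE x in \<mu>. \<bar>f x\<bar> \<le> L" using supp by eventually_elim (rule L)
  then have "AE y in \<nu>. \<bar>y\<bar> \<le> L" unfolding \<nu>_def by (subst AE_distr_iff) auto
  moreover have "char \<nu> u = (CLINT x|\<mu>. iexp (u * f x))" for u
    unfolding char_def \<nu>_def by (subst integral_distr) auto
  ultimately have "t \<le> fourier_dim_measure \<nu>"
    using decay by (intro fourier_dim_measure_ge[OF \<nu> _ t]) auto
  also have "\<dots> \<le> fourier_dim (f ` F)"
  proof (rule fourier_dim_ge)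
    have "f ` F = inv f -` F" using f(3) by (rule bij_image_eq_vimage_inv)
    then have "f ` F \<in> sets borel" using measurable_sets[OF gm F(1)] by simp
    then show "measure \<nu> (f ` F) = 1"
      using F f(3) by (simp add: \<nu>_def measure_distr inj_vimage_image_eq bij_is_inj)
  qed (use \<nu>.prob_space_axioms in auto)
  finally show ?thesis .
qed

theorem theorem1:
  fixes m :: nat and \<alpha> :: real and F :: "real set"
  assumes "m \<ge> 1" and "\<alpha> \<in> {0..1}" and "F \<in> sets borel"
  shows "\<exists>f. diffeomorphism m \<alpha> f \<and> fourier_dim (f ` F) \<ge> hausdorff_dim F / (real m + \<alpha>)"
proof -
  define \<beta> where "\<beta> = real m + \<alpha>"
  have \<alpha>: "0 \<le> \<alpha>" "\<alpha> \<le> 1" using assms(2) by auto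
  have \<beta>: "1 \<le> \<beta>" using assms by (simp add: \<beta>_def)
  define p :: "real poly" where "p = [:0, 1, -1:] ^ (m + 2)"
  obtain c where c: "0 < c" and pert: "\<forall>X. (\<forall>l k. \<bar>X l k\<bar> \<le> real (Suc l)) \<longrightarrow>
       diffeomorphism m \<alpha> (perturbation p c \<beta> X) \<and>
       (\<forall>x. summable (\<lambda>l. amp c \<beta> l * bump p (X l) (grid l x)))"
    by (rule perturbation_diffeomorphism[OF assms(1) \<alpha>, folded p_def \<beta>_def])
  have sm: "perturbation_summable p c \<beta>" using pert unfolding perturbation_summable_def by blast
  have diffeo: "diffeomorphism m \<alpha> (perturbation p c \<beta> (noise \<omega>))" for \<omega>
    using pert noise_bounded by blast
  \<comment> \<open>On [1/4, 3/4] the polynomial t (1 - t) is at least its value 3/16 at the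
    endpoints.\<close>
  define q :: real where "q = (3 / 16) ^ (m + 2)"
  have q: "0 < q" "\<And>t. t \<in> {1/4..3/4} \<Longrightarrow> q \<le> poly p t"
  proof -
    show "q \<le> poly p t" if "t \<in> {1/4..3/4}" for t
    proof -
      have "0 \<le> (t - 1 / 4) * (3 / 4 - t)" using that by (intro mult_nonneg_nonneg) auto
      moreover have "(t - 1 / 4) * (3 / 4 - t) = t - t * t - 3 / 16" by (simp add: field_simps)
      ultimately have "3 / 16 \<le> t - t * t" by linarith
      moreover have "poly [:0, 1, -1:] t = t - t * t" by (simp add: algebra_simps)
      ultimately show ?thesis unfolding q_def p_def poly_power by (intro power_mono) auto
    qed
  qed (simp add: q_def)
  define d where "d = hausdorff_dim F"
  interpret N: prob_space noise_space by (rule prob_space_noise_space)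
  show ?thesis
  proof (cases "0 < d")
    case False
    \<comment> \<open>With dimension 0 the right-hand side is at most 0, and any diffeomorphism of
      the class will do.\<close>
    define f where "f = perturbation p c \<beta> (noise undefined)"
    have f: "diffeomorphism m \<alpha> f" unfolding f_def by (rule diffeo)
    note fc = diffeomorphism_continuous[OF f assms(1)]
    have "f ` F = inv f -` F" using fc(3) by (rule bij_image_eq_vimage_inv)
    then have "f ` F \<in> sets borel"
      using measurable_sets[OF borel_measurable_continuous_onI[OF fc(2)] assms(3)] by simp
    then have "0 \<le> fourier_dim (f ` F)" by (rule fourier_dim_nonneg)
    moreover have "hausdorff_dim F / (real m + \<alpha>) \<le> 0"
      using False \<beta> by (intro divide_nonpos_pos) (auto simp: d_def \<beta>_def)
    ultimately show ?thesis using f by (intro exI[of _ f]) auto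
  next
    case True
    \<comment> \<open>Factors below 1 that increase to 1: one makes s i < d strict, as Frostman's
      lemma requires, and another makes t i < s i / \<beta> strict, as \<open>decay_AE\<close>
      requires.\<close>
    define \<theta> where "\<theta> i = 1 - 1 / real (i + 2)" for i :: nat
    have \<theta>: "0 < \<theta> i" "\<theta> i < 1" for i by (auto simp: \<theta>_def)
    define s where "s i = d * \<theta> i" for i
    define t where "t i = s i / \<beta> * \<theta> i" for i
    have s: "0 < s i" "s i < d" for i using True \<theta>[of i] by (auto simp: s_def)
    have t: "0 < t i" "t i < s i / \<beta>" for i
    proof -
      have "0 < s i / \<beta>" using s[of i] \<beta> by simp
      then show "0 < t i" unfolding t_def using \<theta>(1) by (intro mult_pos_pos)
      have "s i / \<beta> * \<theta> i < s i / \<beta> * 1"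
        using \<open>0 < s i / \<beta>\<close> \<theta>(2) by (intro mult_strict_left_mono)
      then show "t i < s i / \<beta>" by (simp add: t_def)
    qed
    have "\<exists>\<mu> C R. real_distribution \<mu> \<and> measure \<mu> F = 1 \<and> measure \<mu> {-R..R} = 1 \<and>
        (\<forall>n k. measure \<mu> (cell n k) \<le> C * 2 powr (- s i * real n))" for i
    proof -
      have "hausdorff_measure (s i) F \<noteq> 0"
      proof
        assume "hausdorff_measure (s i) F = 0"
        then have "d \<le> s i" unfolding d_def hausdorff_dim_def using s(1)[of i]
          by (intro cInf_lower) (auto intro!: bdd_belowI[of _ 0])
        then show False using s(2)[of i] by simp
      qed
      then show ?thesis using frostman[OF assms(3) s(1)[of i]] by metis
    qed
    then obtain \<mu> C R where \<mu>: "\<And>i. real_distribution (\<mu> i)" "\<And>i. measure (\<mu> i) F = 1"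
      and R: "\<And>i. measure (\<mu> i) {-R i..R i} = 1"
      and C: "\<And>i n k. measure (\<mu> i) (cell n k) \<le> C i * 2 powr (- s i * real n)" by metis
    have s1: "s i \<le> 1" for i by (rule frostman_exponent_le_1[OF \<mu>(1) R C])
    have supp: "AE x in \<mu> i. x \<in> {-R i..R i}" for i
    proof -
      interpret real_distribution "\<mu> i" by (rule \<mu>(1))
      show ?thesis using R[of i] by (rule AE_prob_1)
    qed
    have "AE \<omega> in noise_space. \<forall>\<^sub>F n in sequentially. norm (CLINT x|\<mu> i.
        iexp ((- 2 * pi * sqrt (real n)) * perturbation p c \<beta> (noise \<omega>) x)) \<le> 6 * real n powr (- (t i / 4))" for i
    proof (rule decay_AE[OF \<mu>(1) supp sm c q(2) q(1) s(1) s1 _ _ _ t])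
      show "measure (\<mu> i) (cell n k) \<le> (\<bar>C i\<bar> + 1) * 2 powr (- s i * real n)" for n k
        by (rule order_trans[OF C mult_right_mono]) auto
    qed (use \<beta> in auto)
    \<comment> \<open>The diffeomorphism must not depend on the exponent; countably many almost sure
      events have a common realisation.\<close>
    then have "AE \<omega> in noise_space. \<forall>i. \<forall>\<^sub>F n in sequentially. norm (CLINT x|\<mu> i.
        iexp ((- 2 * pi * sqrt (real n)) * perturbation p c \<beta> (noise \<omega>) x)) \<le> 6 * real n powr (- (t i / 4))"
      by (simp add: AE_all_countable)
    then obtain \<omega> where \<omega>: "\<And>i. \<forall>\<^sub>F n in sequentially. norm (CLINT x|\<mu> i.
        iexp ((- 2 * pi * sqrt (real n)) * perturbation p c \<beta> (noise \<omega>) x)) \<le> 6 * real n powr (- (t i / 4))"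
      using eventually_happens'[OF N.ae_filter_bot] by blast
    define f where "f = perturbation p c \<beta> (noise \<omega>)"
    have f: "diffeomorphism m \<alpha> f" unfolding f_def by (rule diffeo)
    note fc = diffeomorphism_continuous[OF f assms(1)]
    have "t i \<le> fourier_dim (f ` F)" for i
    proof (rule fourier_dim_image_ge[OF \<mu>(1) assms(3) \<mu>(2) supp fc t(1)])
      have "s i / \<beta> \<le> s i / 1" using s(1)[of i] \<beta> by (intro divide_left_mono) auto
      then show "t i \<le> 1" using t(2)[of i] s1[of i] by simp
      show "\<forall>\<^sub>F n in sequentially. norm (CLINT x|\<mu> i. iexp ((- 2 * pi * sqrt (real n)) * f x)) \<le> 6 * real n powr (- (t i / 4))"
        unfolding f_def by (rule \<omega>)
    qed
    moreover have "t \<longlonglongrightarrow> d / \<beta>"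
    proof -
      have "\<theta> \<longlonglongrightarrow> 1" unfolding \<theta>_def by real_asymp
      then have "(\<lambda>i. d * \<theta> i / \<beta> * \<theta> i) \<longlonglongrightarrow> d * 1 / \<beta> * 1"
        using \<beta> by (intro tendsto_intros) auto
      then show ?thesis by (simp add: t_def[abs_def] s_def)
    qed
    ultimately have "d / \<beta> \<le> fourier_dim (f ` F)" by (intro LIMSEQ_le_const2) auto
    then show ?thesis using f unfolding d_def \<beta>_def by blast
  qed
qed

end
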